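(* Let $k\ge 3$. There exist constants $c_1,c_2>0$ such that for all integers $n\ge 2$, $$\frac{c_1n^k}{(\log n)^{2k-2}}\le r(F_{2k-1},n)\le \frac{c_2n^k}{\log n}.$$
   Context: A $k$-graph is a hypergraph all of whose edges have exactly $k$ vertices; an independent set is a vertex set containing no edge. For a $k$-graph $F$ and positive integer $n$, $r(F,n)$ is the minimum $N$ such that every $F$-free $k$-graph on $N$ vertices has an independent set of size $n$. For $k\ge 3$, $F_{2k-1}$ is the $k$-graph on the $2k-1$ vertices $v_1,\dots,v_{k-1},w_1,\dots,w_k$ with the $k$ edges $\{v_1,\dots,v_{k-1},w_i\}$ for $1\le i\le k-1$, and $\{w_1,\dots,w_k\}$. *)

theory Defs
  imports Complex_Main
begin

text \<open>A hypergraph is a pair of a vertex set and a set of edges.\<close>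

type_synonym 'a hypergraph = "'a set \<times> 'a set set"

abbreviation verts :: "'a hypergraph \<Rightarrow> 'a set" where
  "verts H \<equiv> fst H"

abbreviation edges :: "'a hypergraph \<Rightarrow> 'a set set" where
  "edges H \<equiv> snd H"

definition uniform_hypergraph :: "nat \<Rightarrow> 'a hypergraph \<Rightarrow> bool" where
  "uniform_hypergraph k H \<longleftrightarrow>
     finite (verts H) \<and> (\<forall>e\<in>edges H. e \<subseteq> verts H \<and> card e = k)"

definition independent_set :: "'a hypergraph \<Rightarrow> 'a set \<Rightarrow> bool" where
  "independent_set H S \<longleftrightarrow> S \<subseteq> verts H \<and> (\<forall>e\<in>edges H. \<not> e \<subseteq> S)"

text \<open>Copies are not required to be induced.\<close>

definition contains_copy :: "'b hypergraph \<Rightarrow> 'a hypergraph \<Rightarrow> bool" where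
  "contains_copy F H \<longleftrightarrow>
     (\<exists>f. inj_on f (verts F) \<and> f ` verts F \<subseteq> verts H \<and> (\<forall>e\<in>edges F. f ` e \<in> edges H))"

text \<open>Up to isomorphism, every finite hypergraph has its vertices in \<^typ>\<open>nat\<close>. For a finite
  \<open>k\<close>-graph \<open>F\<close> a suitable \<open>N\<close> exists by Ramsey's theorem, so the minimum is attained.\<close>

definition ramsey_number :: "nat \<Rightarrow> 'b hypergraph \<Rightarrow> nat \<Rightarrow> nat" where
  "ramsey_number k F n =
     (LEAST N. \<forall>H :: nat hypergraph.
        uniform_hypergraph k H \<and> card (verts H) = N \<and> \<not> contains_copy F H \<longrightarrow>
        (\<exists>S. independent_set H S \<and> card S = n))"

text \<open>The vertex \<open>v\<^sub>i\<close> is \<^term>\<open>Inl i\<close> and the vertex \<open>w\<^sub>i\<close> is \<^term>\<open>Inr i\<close>.\<close>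

definition F_graph :: "nat \<Rightarrow> (nat + nat) hypergraph" where
  "F_graph k =
     (Inl ` {1..k-1} \<union> Inr ` {1..k},
      {Inl ` {1..k-1} \<union> {Inr i} | i. i \<in> {1..k-1}} \<union> {Inr ` {1..k}})"

end

(*
  Upper bound. In an F-free k-graph the common neighbourhood of k - 1 vertices is independent, so
  without an independent set of size n all codegrees are less than n. Sample a random vertex set S of
  about n^(1 + delta) vertices, small enough that the link of a typical vertex v within S meets
  every edge of S in at most one vertex, and let W be a uniformly random independent set of S. In the
  manner of Shearer and Alon, conditioning on W outside the link shows that either W contains
  many link sets of v in expectation, or v could be added to W with probability at least
  n^(-delta / 2). The second alternative cannot hold for a typical v because independent sets have at
  most n vertices. The first one cannot either when N >= C n^k / ln n: double counting the pairs of v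
  and a (k - 1)-subset of W in its link gives at most n^k of them.

  Lower bound. Choose random blocks, randomly coloured with k colours, and take as edges
  the rainbow k-subsets of a block that have fewer than k - 1 vertices in every other block. Such a
  k-graph is F-free. For a fixed n-set I, an edge inside I can only be lost if its block meets an
  earlier or a later block in k - 1 vertices of I. Revealing the blocks one by one from either end,
  an exponential supermartingale shows that this is so rare that a union bound over all I succeeds for
  N about n^k / (ln n)^4, which suffices as 2k - 2 >= 4.
*)

theory Submission
  imports Defs "HOL-Real_Asymp.Real_Asymp" "HOL-Library.FuncSet"
begin

section \<open>Auxiliary estimates\<close>

text \<open>In the upper bound the logarithm is the threshold y between few and many available link
  sets. If there are at most y, avoiding them all costs a factor 2^y, which must stay below the
  ratio n^\<delta> of the sample size to n; so y is a small multiple of ln n. Sampling is needed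
  because codegrees of at most n still let many edges of the whole hypergraph overlap; a
  first-moment count shows that such configurations rarely survive at density n^(1 + \<delta>) / N,
  while the double count of links does not depend on the sample size.

  In the lower bound the expected number of candidate edges inside I, of order n (ln n)^(3/2), has
  to beat the n ln n of the union bound. The obstacle is to bound the number of (k - 1)-sets of I
  lying in blocks: a block with a vertices in I may contain about a^(k - 1) of them, and the
  exponential of that has no useful mean. So a^(k - 2) is bounded by a cap on all block sizes, and
  only one factor a enters the supermartingale. The cap is of order n / (ln n)^(5/2), which is what
  the factor (ln n)^4 in N pays for.\<close>

lemma exp_2_le_9: "exp (2::real) \<le> 9"
proof -
  have "exp (2::real) = exp 1 * exp 1" by (simp flip: exp_add)
  also have "\<dots> \<le> 3 * 3" using exp_le by (intro mult_mono) auto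
  finally show ?thesis by simp
qed

lemma ln_ge_1: "3 \<le> x \<Longrightarrow> 1 \<le> ln (x::real)"
  using exp_le by (simp add: ln_ge_iff)

lemma sum_Bex_le:
  fixes w :: "'a \<Rightarrow> real"
  assumes "finite A" "finite I" "\<And>s. s \<in> A \<Longrightarrow> 0 \<le> w s"
  shows "(\<Sum>s | s \<in> A \<and> (\<exists>i\<in>I. R i s). w s) \<le> (\<Sum>i\<in>I. \<Sum>s | s \<in> A \<and> R i s. w s)"
proof -
  have "(\<Sum>s | s \<in> A \<and> (\<exists>i\<in>I. R i s). w s) = (\<Sum>s\<in>A. if \<exists>i\<in>I. R i s then w s else 0)"
    using assms(1) by (rule sum.inter_filter)
  also have "\<dots> \<le> (\<Sum>s\<in>A. \<Sum>i\<in>I. if R i s then w s else 0)"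
  proof (rule sum_mono)
    fix s assume s: "s \<in> A"
    show "(if \<exists>i\<in>I. R i s then w s else 0) \<le> (\<Sum>i\<in>I. if R i s then w s else 0)"
    proof (cases "\<exists>i\<in>I. R i s")
      case True
      then obtain i where "i \<in> I" "R i s" by blast
      then show ?thesis
        using member_le_sum[of i I "\<lambda>i. if R i s then w s else 0"] assms s True by simp
    qed (simp add: assms s sum_nonneg)
  qed
  also have "\<dots> = (\<Sum>i\<in>I. \<Sum>s\<in>A. if R i s then w s else 0)" by (rule sum.swap)
  also have "\<dots> = (\<Sum>i\<in>I. \<Sum>s | s \<in> A \<and> R i s. w s)"
    using assms(1) by (intro sum.cong refl sum.inter_filter[symmetric])
  finally show ?thesis .
qed

lemma sum_Un_le:
  fixes w :: "'a \<Rightarrow> real"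
  assumes "finite A" "finite B" "\<And>s. s \<in> A \<union> B \<Longrightarrow> 0 \<le> w s"
  shows "sum w (A \<union> B) \<le> sum w A + sum w B"
proof -
  have "sum w (A \<union> B) = sum w A + sum w B - sum w (A \<inter> B)"
    using sum.union_inter[OF assms(1,2), of w] by simp
  moreover have "0 \<le> sum w (A \<inter> B)" using assms by (intro sum_nonneg) auto
  ultimately show ?thesis by simp
qed

lemma card_subsets_le_power:
  assumes "finite X"
  shows "card {Q. Q \<subseteq> X \<and> card Q = t} \<le> card X ^ t"
proof (cases "t \<le> card X")
  case True
  then show ?thesis using assms by (simp add: n_subsets binomial_le_pow)
next
  case False
  then show ?thesis using assms by (simp add: n_subsets binomial_eq_0)
qed

lemma card_Sigma_le:
  assumes "finite A" "card A \<le> a" "\<And>x. x \<in> A \<Longrightarrow> finite (B x)" "\<And>x. x \<in> A \<Longrightarrow> card (B x) \<le> b"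
  shows "card (Sigma A B) \<le> a * b"
proof -
  have "card (Sigma A B) = (\<Sum>x\<in>A. card (B x))" using assms by (simp add: card_SigmaI)
  also have "\<dots> \<le> of_nat (card A) * b" using assms(4) by (rule sum_bounded_above)
  also have "\<dots> \<le> a * b" using assms(2) by simp
  finally show ?thesis .
qed

lemma sum_Sigma_Sigma:
  assumes "finite A" "\<And>a. a \<in> A \<Longrightarrow> finite (B a)" "\<And>a b. a \<in> A \<Longrightarrow> b \<in> B a \<Longrightarrow> finite (C a b)"
  shows "(\<Sum>(a, b, c)\<in>(SIGMA a:A. SIGMA b:B a. C a b). f a b c) = (\<Sum>a\<in>A. \<Sum>b\<in>B a. \<Sum>c\<in>C a b. f a b c)"
proof -
  have "(\<Sum>a\<in>A. \<Sum>b\<in>B a. \<Sum>c\<in>C a b. f a b c) = (\<Sum>a\<in>A. \<Sum>(b, c)\<in>Sigma (B a) (C a). f a b c)"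
    using assms by (intro sum.cong refl sum.Sigma) auto
  also have "\<dots> = (\<Sum>(a, b, c)\<in>(SIGMA a:A. SIGMA b:B a. C a b). f a b c)"
    using assms by (subst sum.Sigma) auto
  finally show ?thesis by simp
qed

section \<open>Random subsets and independent sets\<close>

definition subset_weight :: "real \<Rightarrow> 'a set \<Rightarrow> 'a set \<Rightarrow> real" where
  "subset_weight p X S = p ^ card S * (1 - p) ^ card (X - S)"

lemma subset_weight_nonneg: "0 \<le> p \<Longrightarrow> p \<le> 1 \<Longrightarrow> 0 \<le> subset_weight p X S"
  by (simp add: subset_weight_def)

lemma sum_subset_weight:
  assumes "finite X"
  shows "(\<Sum>S\<in>Pow X. subset_weight p X S) = 1"
  using prod_add[OF assms, of "\<lambda>_. p" "\<lambda>_. 1 - p"] by (simp add: subset_weight_def)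

lemma sum_subset_weight_superset:
  assumes "finite X" "T \<subseteq> X"
  shows "(\<Sum>S | S \<subseteq> X \<and> T \<subseteq> S. subset_weight p X S) = p ^ card T"
proof -
  have inj: "inj_on (\<lambda>Q. T \<union> Q) (Pow (X - T))" by (auto simp: inj_on_def)
  have eq: "{S. S \<subseteq> X \<and> T \<subseteq> S} = (\<lambda>Q. T \<union> Q) ` Pow (X - T)"
  proof (intro equalityI subsetI)
    fix S assume "S \<in> {S. S \<subseteq> X \<and> T \<subseteq> S}"
    then have "S = T \<union> (S - T)" "S - T \<in> Pow (X - T)" by auto
    then show "S \<in> (\<lambda>Q. T \<union> Q) ` Pow (X - T)" by blast
  qed (use assms in auto)
  have w: "subset_weight p X (T \<union> Q) = p ^ card T * subset_weight p (X - T) Q"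
    if "Q \<in> Pow (X - T)" for Q
  proof -
    have "X - (T \<union> Q) = X - T - Q" by auto
    moreover have "card (T \<union> Q) = card T + card Q"
      using that assms finite_subset[of _ X] by (intro card_Un_disjoint) auto
    ultimately show ?thesis by (simp add: subset_weight_def power_add)
  qed
  show ?thesis
    unfolding eq sum.reindex[OF inj] o_def
    using sum_subset_weight[of "X - T" p] assms by (simp add: w flip: sum_distrib_left)
qed

lemma subset_weight_union_bound:
  assumes "finite X" "finite I" "0 \<le> p" "p \<le> 1" "\<And>i. i \<in> I \<Longrightarrow> F i \<subseteq> X"
  shows "(\<Sum>S | S \<subseteq> X \<and> (\<exists>i\<in>I. F i \<subseteq> S). subset_weight p X S) \<le> (\<Sum>i\<in>I. p ^ card (F i))"
proof -
  have "(\<Sum>S | S \<in> Pow X \<and> (\<exists>i\<in>I. F i \<subseteq> S). subset_weight p X S)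
    \<le> (\<Sum>i\<in>I. \<Sum>S | S \<in> Pow X \<and> F i \<subseteq> S. subset_weight p X S)"
    using assms by (intro sum_Bex_le) (auto simp: subset_weight_nonneg)
  also have "\<dots> = (\<Sum>i\<in>I. p ^ card (F i))"
    using assms by (intro sum.cong refl) (simp add: sum_subset_weight_superset)
  finally show ?thesis by simp
qed

definition indep_subsets :: "'a set set \<Rightarrow> 'a set \<Rightarrow> 'a set set" where
  "indep_subsets E S = {W. W \<subseteq> S \<and> (\<forall>e\<in>E. \<not> e \<subseteq> W)}"

definition link_sets :: "'a set set \<Rightarrow> 'a set \<Rightarrow> 'a \<Rightarrow> 'a set set" where
  "link_sets E S v = {L. L \<subseteq> S \<and> v \<notin> L \<and> insert v L \<in> E}"

lemma finite_indep_subsets [simp]: "finite S \<Longrightarrow> finite (indep_subsets E S)"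
  by (simp add: indep_subsets_def)

lemma finite_link_sets [simp]: "finite S \<Longrightarrow> finite (link_sets E S v)"
  by (simp add: link_sets_def)

section \<open>Link sets inside random independent sets\<close>

text \<open>If at most y members of \<open>L\<close> lie inside \<open>A\<close>, deleting one
  vertex from each leaves at least \<open>card A\<close> - y vertices, all of whose subsets avoid
  \<open>L\<close>; this gives the first term. If more than y of them do, each lies in a share 2^-r
  of the subsets of \<open>A\<close>, so a random subset contains more than y / 2^r on average; this
  gives the second.\<close>

lemma link_fiber_inequality:
  fixes y :: real
  assumes A: "finite A" and L: "finite L" "{} \<notin> L" "\<And>e. e \<in> L \<Longrightarrow> card e = r" and y: "y > 0"
  shows "real (card (Pow A)) \<le> 2 powr y * real (card {B. B \<subseteq> A \<and> (\<forall>e\<in>L. \<not> e \<subseteq> B)})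
           + 2 ^ r / y * real (\<Sum>B\<in>Pow A. card {e\<in>L. e \<subseteq> B})"
proof -
  define J where "J = {e \<in> L. e \<subseteq> A}"
  define C where "C = {B. B \<subseteq> A \<and> (\<forall>e\<in>L. \<not> e \<subseteq> B)}"
  define rep :: "'a set \<Rightarrow> 'a" where "rep e = (SOME u. u \<in> e)" for e
  have rep: "rep e \<in> e" if "e \<in> L" for e
    using that L(2) by (metis rep_def some_in_eq)
  have finJ: "finite J" using L by (simp add: J_def)
  have "Pow (A - rep ` J) \<subseteq> C"
  proof
    fix B assume B: "B \<in> Pow (A - rep ` J)"
    have False if "e \<in> L" "e \<subseteq> B" for e
    proof -
      have "e \<in> J" using that B by (auto simp: J_def)
      then show False using rep[OF that(1)] that B by auto
    qed
    then show "B \<in> C" using B by (auto simp: C_def)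
  qed
  then have "card (Pow (A - rep ` J)) \<le> card C"
    using A by (intro card_mono) (auto simp: C_def)
  moreover have "card A \<le> card (A - rep ` J) + card J"
    using A finJ card_image_le[OF finJ, of rep] diff_card_le_card_Diff[of "rep ` J" A] by simp
  then have "2 ^ card A \<le> (2::nat) ^ (card (A - rep ` J) + card J)"
    by (intro power_increasing) auto
  ultimately have "2 ^ card A \<le> card C * (2::nat) ^ card J"
    using A by (simp add: card_Pow power_add) (meson le_trans mult_le_mono1)
  then have c1: "2 ^ card A \<le> real (card C) * 2 ^ card J"
    using of_nat_mono[of "2 ^ card A" "card C * 2 ^ card J", where ?'a = real] by simp
  have "(\<Sum>B\<in>Pow A. card {e\<in>L. e \<subseteq> B}) = (\<Sum>B\<in>Pow A. \<Sum>e\<in>L. if e \<subseteq> B then 1 else 0)"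
    using L by (simp add: sum.If_cases Int_def conj_commute)
  also have "\<dots> = (\<Sum>e\<in>L. card {B. B \<subseteq> A \<and> e \<subseteq> B})"
    using A by (subst sum.swap) (simp add: sum.If_cases Int_def)
  also have "\<dots> \<ge> (\<Sum>e\<in>J. card {B. B \<subseteq> A \<and> e \<subseteq> B})"
    using L by (intro sum_mono2) (auto simp: J_def)
  finally have s: "(\<Sum>e\<in>J. card {B. B \<subseteq> A \<and> e \<subseteq> B}) \<le> (\<Sum>B\<in>Pow A. card {e\<in>L. e \<subseteq> B})" .
  have "2 ^ card A \<le> 2 ^ r * card {B. B \<subseteq> A \<and> e \<subseteq> B}" if "e \<in> J" for e
  proof -
    have e: "e \<subseteq> A" "card e = r" using that L by (auto simp: J_def)
    have "inj_on (\<lambda>B. e \<union> B) (Pow (A - e))" by (auto simp: inj_on_def)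
    moreover have "(\<lambda>B. e \<union> B) ` Pow (A - e) \<subseteq> {B. B \<subseteq> A \<and> e \<subseteq> B}" using e by auto
    ultimately have "card (Pow (A - e)) \<le> card {B. B \<subseteq> A \<and> e \<subseteq> B}"
      using A by (intro card_inj_on_le) auto
    moreover have "card A = r + card (A - e)"
      using e A by (metis add.commute card_Diff_subset card_mono finite_subset le_add_diff_inverse2)
    ultimately show ?thesis using A by (simp add: card_Pow power_add)
  qed
  then have "(\<Sum>e\<in>J. 2 ^ card A) \<le> (\<Sum>e\<in>J. 2 ^ r * card {B. B \<subseteq> A \<and> e \<subseteq> B})"
    by (rule sum_mono)
  then have "card J * 2 ^ card A \<le> 2 ^ r * (\<Sum>B\<in>Pow A. card {e\<in>L. e \<subseteq> B})"
    using s by (simp flip: sum_distrib_left) (meson le_trans mult_le_mono2)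
  then have c2: "real (card J) * 2 ^ card A \<le> 2 ^ r * real (\<Sum>B\<in>Pow A. card {e\<in>L. e \<subseteq> B})"
    using of_nat_mono[of "card J * 2 ^ card A", where ?'a = real] by fastforce
  have "2 ^ card A \<le> 2 powr y * real (card C) + real (card J) * 2 ^ card A / y"
  proof (cases "real (card J) \<le> y")
    case True
    then have "(2::real) ^ card J \<le> 2 powr y"
      by (simp add: powr_realpow[symmetric])
    then have "real (card C) * 2 ^ card J \<le> 2 powr y * real (card C)"
      by (simp add: mult.commute mult_left_mono)
    then show ?thesis using c1 y by (smt (verit) divide_nonneg_pos mult_nonneg_nonneg of_nat_0_le_iff zero_le_power)
  next
    case False
    then have "1 * 2 ^ card A \<le> real (card J) / y * 2 ^ card A"
      using y by (intro mult_right_mono) auto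
    then show ?thesis by (simp add: add_increasing)
  qed
  also have "real (card J) * 2 ^ card A / y \<le> 2 ^ r * real (\<Sum>B\<in>Pow A. card {e\<in>L. e \<subseteq> B}) / y"
    using c2 y by (intro divide_right_mono) auto
  finally show ?thesis using A by (simp add: card_Pow C_def)
qed

text \<open>Fibering the independent sets by their part outside the links, every fiber is the power set
  of the set of available vertices, since an edge with at most one vertex in the links is already
  excluded by single vertices.\<close>

lemma indep_subsets_link_inequality:
  fixes y :: real
  assumes S: "finite S" and edges: "\<And>e. e \<in> E \<Longrightarrow> card e = Suc r" and r: "r > 0" and y: "y > 0"
    and good: "\<And>f. f \<in> E \<Longrightarrow> f \<subseteq> S \<Longrightarrow> card (f \<inter> \<Union>(link_sets E S v)) \<le> 1"
  shows "real (card (indep_subsets E S)) \<le>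
      2 powr y * real (card {W \<in> indep_subsets E S. \<forall>e\<in>link_sets E S v. \<not> e \<subseteq> W})
    + 2 ^ r / y * real (\<Sum>W\<in>indep_subsets E S. card {e \<in> link_sets E S v. e \<subseteq> W})"
proof -
  define L where "L = link_sets E S v"
  define U where "U = \<Union>L"
  define A where "A W = {u\<in>U. insert u W \<in> indep_subsets E S}" for W
  define Z where "Z = indep_subsets E (S - U)"
  have US: "U \<subseteq> S" by (auto simp: U_def L_def link_sets_def)
  have finL: "finite L" using S by (simp add: L_def)
  have finU: "finite U" using S US finite_subset by blast
  have finA: "finite (A W)" for W using finU by (simp add: A_def)
  have finZ: "finite Z" using S by (simp add: Z_def)
  have cardL: "card e = r" if "e \<in> L" for e
    using that edges[of "insert v e"] S finite_subset[of e S] by (auto simp: L_def link_sets_def)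
  have L0: "{} \<notin> L" using cardL r by force
  have bij: "bij_betw (\<lambda>(W, B). W \<union> B) (Sigma Z (\<lambda>W. Pow (A W))) (indep_subsets E S)"
  proof (rule bij_betw_byWitness[where f' = "\<lambda>W. (W - U, W \<inter> U)"])
    show "\<forall>a\<in>Sigma Z (\<lambda>W. Pow (A W)). (\<lambda>W. (W - U, W \<inter> U)) ((\<lambda>(W, B). W \<union> B) a) = a"
    proof (rule ballI)
      fix a assume "a \<in> Sigma Z (\<lambda>W. Pow (A W))"
      then obtain W B where a: "a = (W, B)" "W \<in> Z" "B \<subseteq> A W" by auto
      then have "W \<inter> U = {}" "B \<subseteq> U" by (auto simp: Z_def A_def indep_subsets_def)
      then show "(\<lambda>W. (W - U, W \<inter> U)) ((\<lambda>(W, B). W \<union> B) a) = a"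
        unfolding a by auto
    qed
    show "\<forall>W\<in>indep_subsets E S. (\<lambda>(W, B). W \<union> B) (W - U, W \<inter> U) = W" by auto
    show "(\<lambda>W. (W - U, W \<inter> U)) ` indep_subsets E S \<subseteq> Sigma Z (\<lambda>W. Pow (A W))"
    proof (rule image_subsetI)
      fix W assume W: "W \<in> indep_subsets E S"
      then have "W - U \<in> Z" by (auto simp: Z_def indep_subsets_def)
      moreover have "u \<in> A (W - U)" if "u \<in> W \<inter> U" for u
      proof -
        have "insert u (W - U) \<subseteq> W" using that by auto
        then show ?thesis using W that by (auto simp: A_def indep_subsets_def)
      qed
      ultimately show "(W - U, W \<inter> U) \<in> Sigma Z (\<lambda>W. Pow (A W))" by blast
    qed
    show "(\<lambda>(W, B). W \<union> B) ` Sigma Z (\<lambda>W. Pow (A W)) \<subseteq> indep_subsets E S"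
    proof clarify
      fix W B assume W: "W \<in> Z" and B: "B \<subseteq> A W"
      have WS: "W \<subseteq> S - U" and Wi: "\<And>e. e \<in> E \<Longrightarrow> \<not> e \<subseteq> W"
        using W by (auto simp: Z_def indep_subsets_def)
      have BU: "B \<subseteq> U" using B by (auto simp: A_def)
      have "\<not> f \<subseteq> W \<union> B" if f: "f \<in> E" for f
      proof
        assume sub: "f \<subseteq> W \<union> B"
        then have "f \<subseteq> S" using WS BU US by blast
        then have "card (f \<inter> U) \<le> 1" using good[OF f] by (simp add: L_def U_def)
        moreover have "finite (f \<inter> U)" using US S finite_subset by blast
        ultimately consider "f \<inter> U = {}" | u where "f \<inter> U = {u}"
          by (metis One_nat_def card_1_singletonE card_0_eq le_0_eq le_Suc_eq)
        then show False
        proof cases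
          case 1
          then show False using sub BU Wi[OF f] by blast
        next
          case 2
          then have "u \<in> B" "f \<subseteq> insert u W" using sub BU WS by auto
          then show False using B f by (auto simp: A_def indep_subsets_def)
        qed
      qed
      then show "W \<union> B \<in> indep_subsets E S" using WS BU US by (auto simp: indep_subsets_def)
    qed
  qed
  have part: "(\<Sum>W\<in>indep_subsets E S. g W) = (\<Sum>W\<in>Z. \<Sum>B\<in>Pow (A W). g (W \<union> B))"
    for g :: "'a set \<Rightarrow> nat"
  proof -
    have "(\<Sum>W\<in>indep_subsets E S. g W) = (\<Sum>(W, B)\<in>Sigma Z (\<lambda>W. Pow (A W)). g (W \<union> B))"
      using sum.reindex_bij_betw[OF bij, of g] by (simp add: case_prod_unfold)
    then show ?thesis using finZ finA by (simp add: sum.Sigma)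
  qed
  \<comment> \<open>\<open>W\<close> avoids \<open>U\<close> and link sets lie inside
    \<open>U\<close>, so both quantities in the conclusion depend only on the fiber part
    \<open>B\<close>.\<close>
  have sub: "e \<subseteq> W \<union> B \<longleftrightarrow> e \<subseteq> B" if "e \<in> L" "W \<in> Z" for e W B
    using that by (auto simp: Z_def indep_subsets_def U_def)
  have eq1: "card (indep_subsets E S) = (\<Sum>W\<in>Z. card (Pow (A W)))"
    using part[of "\<lambda>_. 1"] by simp
  have eq2: "card {W \<in> indep_subsets E S. \<forall>e\<in>L. \<not> e \<subseteq> W}
    = (\<Sum>W\<in>Z. card {B. B \<subseteq> A W \<and> (\<forall>e\<in>L. \<not> e \<subseteq> B)})"
  proof -
    have "card {W \<in> indep_subsets E S. \<forall>e\<in>L. \<not> e \<subseteq> W}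
      = (\<Sum>W\<in>indep_subsets E S. if \<forall>e\<in>L. \<not> e \<subseteq> W then 1 else 0)"
      using S by (simp add: sum.If_cases Int_def)
    also have "\<dots> = (\<Sum>W\<in>Z. \<Sum>B\<in>Pow (A W). if \<forall>e\<in>L. \<not> e \<subseteq> B then 1 else 0)"
      unfolding part by (intro sum.cong) (auto simp: sub)
    also have "\<dots> = (\<Sum>W\<in>Z. card {B. B \<subseteq> A W \<and> (\<forall>e\<in>L. \<not> e \<subseteq> B)})"
      using finA by (simp add: sum.If_cases Int_def)
    finally show ?thesis .
  qed
  have eq3: "(\<Sum>W\<in>indep_subsets E S. card {e \<in> L. e \<subseteq> W})
    = (\<Sum>W\<in>Z. \<Sum>B\<in>Pow (A W). card {e\<in>L. e \<subseteq> B})"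
    unfolding part by (intro sum.cong refl arg_cong[where f=card]) (auto simp: sub)
  have "real (card (indep_subsets E S)) = (\<Sum>W\<in>Z. real (card (Pow (A W))))"
    by (simp add: eq1)
  also have "\<dots> \<le> (\<Sum>W\<in>Z. 2 powr y * real (card {B. B \<subseteq> A W \<and> (\<forall>e\<in>L. \<not> e \<subseteq> B)})
           + 2 ^ r / y * real (\<Sum>B\<in>Pow (A W). card {e\<in>L. e \<subseteq> B}))"
    using link_fiber_inequality[OF finA finL L0 cardL y] by (intro sum_mono) blast
  also have "\<dots> = 2 powr y * real (card {W \<in> indep_subsets E S. \<forall>e\<in>L. \<not> e \<subseteq> W})
     + 2 ^ r / y * real (\<Sum>W\<in>indep_subsets E S. card {e \<in> L. e \<subseteq> W})"
    unfolding eq2 eq3 by (simp add: sum.distrib sum_distrib_left)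
  finally show ?thesis by (simp add: L_def)
qed

section \<open>Hypergraphs of bounded codegree\<close>

text \<open>In the application r = k - 1 and d = n. Link sets have r vertices, and the codegree
  bound is all that is kept of being F-free.\<close>

locale bounded_codegree =
  fixes V :: "'a set" and E :: "'a set set" and r d :: nat
  assumes finite_V: "finite V" and r_ge_2: "2 \<le> r"
    and edges: "\<And>e. e \<in> E \<Longrightarrow> e \<subseteq> V \<and> card e = Suc r"
    and codegree: "\<And>R. R \<subseteq> V \<Longrightarrow> card R = r \<Longrightarrow> card {w \<in> V - R. insert w R \<in> E} \<le> d"
begin

lemma finite_E: "finite E"
  using finite_V edges by (intro finite_subset[of E "Pow V"]) auto

lemma finite_edge: "e \<in> E \<Longrightarrow> finite e"
  using finite_V edges finite_subset by blast

text \<open>All but one of the missing vertices are chosen freely; the resulting r-set has at most d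
  completions to an edge. Compared with the trivial count, one factor \<open>card V\<close> is
  traded for d.\<close>

lemma card_edges_superset_le:
  assumes T: "T \<subseteq> V" "card T \<le> r"
  shows "card {e \<in> E. T \<subseteq> e} \<le> card V ^ (r - card T) * d"
proof -
  define Qs where "Qs = {Q. Q \<subseteq> V - T \<and> card Q = r - card T}"
  define ext where "ext Q = (\<lambda>w. insert w (T \<union> Q)) ` {w \<in> V - (T \<union> Q). insert w (T \<union> Q) \<in> E}" for Q
  have finT: "finite T" using T finite_V finite_subset by blast
  have finQs: "finite Qs" using finite_V by (simp add: Qs_def)
  have finext: "finite (ext Q)" for Q using finite_V by (simp add: ext_def)
  have "{e \<in> E. T \<subseteq> e} \<subseteq> (\<Union>Q\<in>Qs. ext Q)"
  proof
    fix e assume "e \<in> {e \<in> E. T \<subseteq> e}"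
    then have e: "e \<in> E" "T \<subseteq> e" by auto
    have ce: "e \<subseteq> V" "card e = Suc r" "finite e" using edges[OF e(1)] finite_edge[OF e(1)] by auto
    have "card (e - T) = Suc r - card T" using ce e finT by (simp add: card_Diff_subset)
    then have "card (e - T) \<noteq> 0" using T by linarith
    then have "e - T \<noteq> {}" by force
    then obtain w where w: "w \<in> e - T" by blast
    have "card (e - T - {w}) = r - card T"
      using w ce \<open>card (e - T) = Suc r - card T\<close> T by simp
    then have "e - T - {w} \<in> Qs" using ce by (auto simp: Qs_def)
    moreover have "insert w (T \<union> (e - T - {w})) = e" using w e by auto
    then have "e \<in> ext (e - T - {w})" using w e ce by (force simp: ext_def)
    ultimately show "e \<in> (\<Union>Q\<in>Qs. ext Q)" by blast
  qed
  then have "card {e \<in> E. T \<subseteq> e} \<le> card (\<Union>Q\<in>Qs. ext Q)"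
    using finQs finext by (intro card_mono) auto
  also have "\<dots> \<le> (\<Sum>Q\<in>Qs. card (ext Q))" by (rule card_UN_le[OF finQs])
  also have "\<dots> \<le> of_nat (card Qs) * d"
  proof (rule sum_bounded_above)
    fix Q assume Q: "Q \<in> Qs"
    have "finite Q" using Q finite_V finite_subset by (auto simp: Qs_def)
    then have "card (T \<union> Q) = r"
      using Q finT T by (subst card_Un_disjoint) (auto simp: Qs_def)
    moreover have "T \<union> Q \<subseteq> V" using Q T by (auto simp: Qs_def)
    ultimately have "card {w \<in> V - (T \<union> Q). insert w (T \<union> Q) \<in> E} \<le> d"
      using codegree by blast
    then show "card (ext Q) \<le> d"
      unfolding ext_def using finite_V by (intro order.trans[OF card_image_le]) auto
  qed
  also have "card Qs \<le> card (V - T) ^ (r - card T)"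
    unfolding Qs_def using finite_V by (intro card_subsets_le_power) auto
  also have "card (V - T) ^ (r - card T) \<le> card V ^ (r - card T)"
    using finite_V by (intro power_mono card_mono) auto
  finally show ?thesis by simp
qed

section \<open>Sparse samples: overlapping edges and loose triangles\<close>

definition good :: "'a set \<Rightarrow> 'a \<Rightarrow> bool" where
  "good S v \<longleftrightarrow> (\<forall>f\<in>E. f \<subseteq> S \<longrightarrow> card (f \<inter> \<Union>(link_sets E S v)) \<le> 1)"

text \<open>The intersection \<open>T\<close> is part of the index so that the number of choices for
  \<open>h\<close> can be bounded for each overlap separately. The bound
  \<open>card T \<le> r\<close> excludes g = h.\<close>

definition overlaps :: "'a \<Rightarrow> ('a set \<times> 'a set \<times> 'a set) set" where
  "overlaps v = (SIGMA g:{g\<in>E. v \<in> g}. SIGMA T:{T. T \<subseteq> g \<and> 2 \<le> card T \<and> card T \<le> r}. {h\<in>E. g \<inter> h = T})"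

text \<open>These include the loose triangles with corners v, x, y: three edges of r + 1 vertices
  that pairwise share just one corner span 3 (r + 1) - 3 vertices. Only this number matters for the
  first moment, so the intersections themselves are not recorded.\<close>

definition triangles :: "'a \<Rightarrow> ('a set \<times> 'a \<times> 'a set \<times> 'a \<times> 'a set) set" where
  "triangles v = (SIGMA g:{g\<in>E. v \<in> g}. SIGMA x:g. SIGMA f:{f\<in>E. x \<in> f}. SIGMA y:f.
     {h\<in>E. v \<in> h \<and> y \<in> h \<and> y \<noteq> v \<and> card (g \<union> f \<union> h) = 3 * r})"

lemma finite_overlaps: "finite (overlaps v)"
  unfolding overlaps_def using finite_E finite_edge by (intro finite_SigmaI) auto

lemma finite_triangles: "finite (triangles v)"
  unfolding triangles_def using finite_E finite_edge by (intro finite_SigmaI) auto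

text \<open>Two vertices x, y of an edge f that lie in link sets of v produce edges g and h through
  v. Either two distinct ones among f, g, h share at least two vertices, or all pairwise
  intersections are single corners and the three edges form a loose triangle.\<close>

lemma not_good_imp:
  assumes S: "S \<subseteq> V - {v}" and ng: "\<not> good S v"
  shows "(\<exists>(g, T, h)\<in>overlaps v. g \<union> h - {v} \<subseteq> S) \<or> (\<exists>(g, x, f, y, h)\<in>triangles v. g \<union> f \<union> h - {v} \<subseteq> S)"
proof -
  obtain f where f: "f \<in> E" "f \<subseteq> S" "\<not> card (f \<inter> \<Union>(link_sets E S v)) \<le> 1"
    using ng by (auto simp: good_def)
  have finf: "finite f" "card f = Suc r" using f finite_edge edges by auto
  have "2 \<le> card (f \<inter> \<Union>(link_sets E S v))" using f by simp
  then obtain B where "B \<subseteq> f \<inter> \<Union>(link_sets E S v)" "card B = 2"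
    by (meson obtain_subset_with_card_n)
  moreover from \<open>card B = 2\<close> obtain x y where "B = {x, y}" "x \<noteq> y"
    by (auto simp: card_2_iff)
  ultimately have xy: "x \<in> f" "y \<in> f" "x \<noteq> y" "x \<in> \<Union>(link_sets E S v)" "y \<in> \<Union>(link_sets E S v)"
    by simp_all
  obtain L M where L: "L \<in> link_sets E S v" "x \<in> L" and M: "M \<in> link_sets E S v" "y \<in> M"
    using xy by auto
  define g where "g = insert v L"
  define h where "h = insert v M"
  have g: "g \<in> E" "v \<in> g" "g \<subseteq> insert v S" "x \<in> g" and h: "h \<in> E" "v \<in> h" "h \<subseteq> insert v S" "y \<in> h"
    using L M by (auto simp: g_def h_def link_sets_def)
  have vf: "v \<notin> f" "x \<noteq> v" "y \<noteq> v" using f S xy by auto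
  have fin: "finite g" "finite h" "card g = Suc r" "card h = Suc r"
    using g h finite_edge edges by auto
  have over: "(a, a \<inter> b, b) \<in> overlaps v" if "a \<in> E" "v \<in> a" "b \<in> E" "a \<noteq> b" "2 \<le> card (a \<inter> b)" for a b
  proof -
    have fab: "finite a" "finite b" "card a = Suc r" "card b = Suc r" using that finite_edge edges by auto
    have "card (a \<inter> b) \<noteq> Suc r"
      using fab that by (metis Int_lower1 Int_lower2 card_subset_eq)
    moreover have "card (a \<inter> b) \<le> Suc r" using fab card_mono[of a "a \<inter> b"] by simp
    ultimately show ?thesis using that by (auto simp: overlaps_def)
  qed
  show ?thesis
  proof (cases "2 \<le> card (g \<inter> f) \<or> 2 \<le> card (h \<inter> f) \<or> (g \<noteq> h \<and> 2 \<le> card (g \<inter> h))")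
    case True
    moreover have ?thesis if "(a, T, b) \<in> overlaps v" "a \<subseteq> insert v S" "b \<subseteq> insert v S" for a T b
    proof -
      have "a \<union> b - {v} \<subseteq> S" using that by auto
      then show ?thesis using that(1) by (intro disjI1 bexI[of _ "(a, T, b)"]) auto
    qed
    moreover have "g \<noteq> f" "h \<noteq> f" "f \<subseteq> insert v S" using g h f vf by auto
    ultimately show ?thesis using over[OF g(1,2) f(1)] over[OF h(1,2) f(1)] over[OF g(1,2) h(1)] g(3) h(3)
      by blast
  next
    case False
    have one: "A = {a}" if "finite A" "a \<in> A" "\<not> 2 \<le> card A" for A and a :: 'a
    proof -
      have "card A = 1" using that by (metis One_nat_def card_eq_0_iff empty_iff less_2_cases not_le)
      then show ?thesis using that(2) by (metis card_1_singletonE singletonD)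
    qed
    have gf: "g \<inter> f = {x}" and hf: "h \<inter> f = {y}"
      using False g h xy fin one by auto
    then have "g \<noteq> h" using xy by auto
    then have gh: "g \<inter> h = {v}" using False g h fin one by auto
    have 1: "card (g \<union> f) = 2 * r + 1"
      using card_Un_Int[of g f] fin finf gf by simp
    have "(g \<union> f) \<inter> h = {v, y}" using gh hf by auto
    then have "card (g \<union> f \<union> h) = 3 * r"
      using card_Un_Int[of "g \<union> f" h] fin finf 1 vf by simp
    then have "(g, x, f, y, h) \<in> triangles v"
      using g h f xy vf by (simp add: triangles_def)
    moreover have "g \<union> f \<union> h - {v} \<subseteq> S" using g h f by auto
    ultimately show ?thesis by (intro disjI2 bexI[of _ "(g, x, f, y, h)"]) auto
  qed
qed

text \<open>For an overlap of size s, apart from v there are 2 r + 1 - s vertices to be sampled, and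
  \<open>h\<close> has about N^(r - s) d choices. The product is d p^(r + 1) (p N)^(r - s), and
  since p N \<ge> 1 the worst case is s = 2.\<close>

lemma sum_overlaps_le:
  fixes p :: real
  assumes v: "v \<in> V" and p: "0 \<le> p" "p \<le> 1" and m: "1 \<le> p * card V"
  shows "(\<Sum>(g, T, h)\<in>overlaps v. p ^ card (g \<union> h - {v}))
    \<le> 2 ^ Suc r * card V ^ (r - 1) * d ^ 2 * p ^ (r + 1) * (p * card V) ^ (r - 2)"
proof -
  let ?N = "real (card V)"
  define C where "C = d * p ^ (r + 1) * (p * ?N) ^ (r - 2)"
  have C0: "0 \<le> C" using p by (simp add: C_def)
  have inner: "(\<Sum>h\<in>{h\<in>E. g \<inter> h = T}. p ^ card (g \<union> h - {v})) \<le> C"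
    if g: "g \<in> E" "v \<in> g" and T: "T \<subseteq> g" "2 \<le> card T" "card T \<le> r" for g T
  proof -
    have cardg: "finite g" "card g = Suc r" "g \<subseteq> V" using g finite_edge edges by auto
    have card: "card (g \<union> h - {v}) = 2 * r + 1 - card T" if "h \<in> E" "g \<inter> h = T" for h
    proof -
      have "finite h" "card h = Suc r" using that finite_edge edges by auto
      then have "card (g \<union> h) = 2 * r + 2 - card T"
        using card_Un_Int[of g h] cardg that by simp
      then show ?thesis using g cardg \<open>finite h\<close> by simp
    qed
    have "(\<Sum>h\<in>{h\<in>E. g \<inter> h = T}. p ^ card (g \<union> h - {v})) = card {h\<in>E. g \<inter> h = T} * p ^ (2 * r + 1 - card T)"
      by (simp add: card)
    also have "\<dots> \<le> real (card V ^ (r - card T) * d) * p ^ (2 * r + 1 - card T)"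
    proof -
      have "card {h\<in>E. g \<inter> h = T} \<le> card {h\<in>E. T \<subseteq> h}"
        using finite_E by (intro card_mono) auto
      also have "\<dots> \<le> card V ^ (r - card T) * d"
        using T cardg by (intro card_edges_superset_le) auto
      finally show ?thesis using p by (intro mult_right_mono) (auto simp del: of_nat_mult of_nat_power)
    qed
    also have "\<dots> = d * p ^ (r + 1) * (p * ?N) ^ (r - card T)"
    proof -
      have "2 * r + 1 - card T = (r + 1) + (r - card T)" using T by simp
      then have "p ^ (2 * r + 1 - card T) = p ^ (r + 1) * p ^ (r - card T)"
        by (simp only: power_add)
      then show ?thesis by (simp add: power_mult_distrib)
    qed
    also have "\<dots> \<le> C"
      unfolding C_def using T p m by (intro mult_left_mono power_increasing) auto
    finally show ?thesis .
  qed
  have "(\<Sum>(g, T, h)\<in>overlaps v. p ^ card (g \<union> h - {v})) =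
    (\<Sum>g\<in>{g\<in>E. v \<in> g}. \<Sum>T\<in>{T. T \<subseteq> g \<and> 2 \<le> card T \<and> card T \<le> r}. \<Sum>h\<in>{h\<in>E. g \<inter> h = T}. p ^ card (g \<union> h - {v}))"
    unfolding overlaps_def using finite_E finite_edge by (intro sum_Sigma_Sigma) auto
  also have "\<dots> \<le> (\<Sum>g\<in>{g\<in>E. v \<in> g}. 2 ^ Suc r * C)"
  proof (rule sum_mono)
    fix g assume g: "g \<in> {g\<in>E. v \<in> g}"
    then have fg: "finite g" "card g = Suc r" using finite_edge edges by auto
    have "(\<Sum>T\<in>{T. T \<subseteq> g \<and> 2 \<le> card T \<and> card T \<le> r}. \<Sum>h\<in>{h\<in>E. g \<inter> h = T}. p ^ card (g \<union> h - {v}))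
      \<le> of_nat (card {T. T \<subseteq> g \<and> 2 \<le> card T \<and> card T \<le> r}) * C"
      using inner g by (intro sum_bounded_above) auto
    also have "\<dots> \<le> of_nat (card (Pow g)) * C"
      using fg C0 by (intro mult_right_mono) (auto intro!: card_mono)
    finally show "(\<Sum>T\<in>{T. T \<subseteq> g \<and> 2 \<le> card T \<and> card T \<le> r}. \<Sum>h\<in>{h\<in>E. g \<inter> h = T}. p ^ card (g \<union> h - {v}))
      \<le> 2 ^ Suc r * C" using fg by (simp add: card_Pow)
  qed
  also have "\<dots> = card {g\<in>E. v \<in> g} * (2 ^ Suc r * C)" by simp
  also have "\<dots> \<le> real (card V ^ (r - 1) * d) * (2 ^ Suc r * C)"
  proof -
    have "card {g\<in>E. {v} \<subseteq> g} \<le> card V ^ (r - card {v}) * d"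
      using v r_ge_2 by (intro card_edges_superset_le) auto
    then show ?thesis using C0 by (intro mult_right_mono) (auto simp del: of_nat_mult of_nat_power)
  qed
  finally show ?thesis by (simp add: C_def power2_eq_square mult_ac)
qed

text \<open>Once g and f are chosen through one known vertex each, h must contain the two known
  vertices v and y, so it has only N^(r - 2) d choices. The exponent 3 r - 1 leaves out v, which is
  not sampled.\<close>

lemma sum_triangles_le:
  fixes p :: real
  assumes v: "v \<in> V" and p: "0 \<le> p" "p \<le> 1"
  shows "(\<Sum>(g, x, f, y, h)\<in>triangles v. p ^ card (g \<union> f \<union> h - {v}))
    \<le> (Suc r)\<^sup>2 * (card V ^ (r - 1) * d)\<^sup>2 * (card V ^ (r - 2) * d) * p ^ (3 * r - 1)"
proof -
  define D where "D = card V ^ (r - 1) * d"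
  define D2 where "D2 = card V ^ (r - 2) * d"
  have deg: "card {g\<in>E. w \<in> g} \<le> D" if "w \<in> V" for w
    using card_edges_superset_le[of "{w}"] that r_ge_2 by (simp add: D_def)
  have deg2: "card {h\<in>E. v \<in> h \<and> y \<in> h \<and> y \<noteq> v \<and> P h} \<le> D2" if "y \<in> V" for y P
  proof (cases "y = v")
    case False
    have "card {h\<in>E. v \<in> h \<and> y \<in> h \<and> y \<noteq> v \<and> P h} \<le> card {h\<in>E. {v, y} \<subseteq> h}"
      using finite_E by (intro card_mono) auto
    also have "\<dots> \<le> D2"
      using card_edges_superset_le[of "{v, y}"] that v r_ge_2 False by (simp add: D2_def numeral_2_eq_2)
    finally show ?thesis .
  qed simp
  have Vg: "w \<in> V" if "g \<in> E" "w \<in> g" for g w using edges that by blast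
  have "card (triangles v) \<le> D * (Suc r * (D * (Suc r * D2)))"
    unfolding triangles_def
    by (intro card_Sigma_le finite_SigmaI)
      (use finite_E finite_edge edges deg deg2 Vg v in auto)
  also have "\<dots> = (Suc r)\<^sup>2 * D\<^sup>2 * D2" by (simp only: power2_eq_square mult_ac)
  finally have c: "card (triangles v) \<le> (Suc r)\<^sup>2 * D\<^sup>2 * D2" .
  have "(\<Sum>(g, x, f, y, h)\<in>triangles v. p ^ card (g \<union> f \<union> h - {v})) = (\<Sum>_\<in>triangles v. p ^ (3 * r - 1))"
    by (intro sum.cong) (auto simp: triangles_def)
  also have "\<dots> = card (triangles v) * p ^ (3 * r - 1)" by simp
  also have "\<dots> \<le> real ((Suc r)\<^sup>2 * D\<^sup>2 * D2) * p ^ (3 * r - 1)"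
    using c p by (intro mult_right_mono) (auto simp del: of_nat_mult of_nat_power)
  finally show ?thesis by (simp add: D_def D2_def)
qed

lemma sum_not_good_le:
  fixes p :: real
  assumes v: "v \<in> V" and p: "0 \<le> p" "p \<le> 1" and m: "1 \<le> p * card V"
  shows "(\<Sum>S | S \<subseteq> V - {v} \<and> \<not> good S v. subset_weight p (V - {v}) S)
    \<le> 2 ^ Suc r * card V ^ (r - 1) * d ^ 2 * p ^ (r + 1) * (p * card V) ^ (r - 2)
      + (Suc r)\<^sup>2 * (card V ^ (r - 1) * d)\<^sup>2 * (card V ^ (r - 2) * d) * p ^ (3 * r - 1)"
proof -
  let ?w = "subset_weight p (V - {v})"
  let ?O = "{S. S \<subseteq> V - {v} \<and> (\<exists>i\<in>overlaps v. (\<lambda>(g, T, h). g \<union> h - {v}) i \<subseteq> S)}"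
  let ?T = "{S. S \<subseteq> V - {v} \<and> (\<exists>i\<in>triangles v. (\<lambda>(g, x, f, y, h). g \<union> f \<union> h - {v}) i \<subseteq> S)}"
  have eV: "e \<subseteq> V" if "e \<in> E" for e using edges[OF that] by blast
  have w: "0 \<le> ?w S" for S using p by (rule subset_weight_nonneg)
  have fin: "finite ?O" "finite ?T" using finite_V by auto
  have sub: "{S. S \<subseteq> V - {v} \<and> \<not> good S v} \<subseteq> ?O \<union> ?T"
  proof
    fix S assume "S \<in> {S. S \<subseteq> V - {v} \<and> \<not> good S v}"
    then have "S \<subseteq> V - {v}" "\<not> good S v" by auto
    then show "S \<in> ?O \<union> ?T" using not_good_imp[of S v] by (simp add: case_prod_unfold)
  qed
  have "(\<Sum>S | S \<subseteq> V - {v} \<and> \<not> good S v. ?w S) \<le> sum ?w (?O \<union> ?T)"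
    using fin sub w by (intro sum_mono2) auto
  also have "\<dots> \<le> sum ?w ?O + sum ?w ?T"
    using fin w sum.union_inter[of ?O ?T ?w] by (smt (verit) sum_nonneg)
  also have "sum ?w ?O \<le> (\<Sum>i\<in>overlaps v. p ^ card ((\<lambda>(g, T, h). g \<union> h - {v}) i))"
    using finite_V finite_overlaps p eV
    by (intro subset_weight_union_bound) (auto simp: overlaps_def)
  also have "\<dots> \<le> 2 ^ Suc r * card V ^ (r - 1) * d ^ 2 * p ^ (r + 1) * (p * card V) ^ (r - 2)"
    using sum_overlaps_le[OF v p m] by (simp add: case_prod_unfold)
  also have "sum ?w ?T \<le> (\<Sum>i\<in>triangles v. p ^ card ((\<lambda>(g, x, f, y, h). g \<union> f \<union> h - {v}) i))"
    using finite_V finite_triangles p eV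
    by (intro subset_weight_union_bound) (auto simp: triangles_def)
  also have "\<dots> \<le> (Suc r)\<^sup>2 * (card V ^ (r - 1) * d)\<^sup>2 * (card V ^ (r - 2) * d) * p ^ (3 * r - 1)"
    using sum_triangles_le[OF v p] by (simp add: case_prod_unfold)
  finally show ?thesis by simp
qed

section \<open>Averaging over the vertex and the random independent set\<close>

lemma subset_weight_remove:
  assumes "finite X" "S \<subseteq> X - {v}" "v \<in> X"
  shows "subset_weight p X (insert v S) = p * subset_weight p (X - {v}) S"
    and "subset_weight p X S = (1 - p) * subset_weight p (X - {v}) S"
proof -
  have fS: "finite S" "v \<notin> S" using assms finite_subset by auto
  have "X - insert v S = X - {v} - S" by auto
  then show "subset_weight p X (insert v S) = p * subset_weight p (X - {v}) S"
    using fS by (simp add: subset_weight_def)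
  have "X - S = insert v (X - {v} - S)" using assms fS by auto
  moreover have "v \<notin> X - {v} - S" "finite (X - {v} - S)" using assms by auto
  ultimately have "card (X - S) = Suc (card (X - {v} - S))" by simp
  then show "subset_weight p X S = (1 - p) * subset_weight p (X - {v}) S"
    by (simp add: subset_weight_def)
qed

lemma card_indep_subsets_pos: "finite S \<Longrightarrow> 0 < card (indep_subsets E S)"
proof -
  assume S: "finite S"
  have "{} \<in> indep_subsets E S" using edges by (fastforce simp: indep_subsets_def)
  then show ?thesis using S by (auto simp: card_gt_0_iff)
qed

text \<open>Independent sets of \<open>S\<close> containing no link set of \<open>v\<close> correspond to independent sets of
  \<open>insert v S\<close> that contain \<open>v\<close>; moving \<open>v\<close> into the random set costs a factor \<open>1 / p\<close>.\<close>

lemma sum_no_link_le: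
  fixes p n :: real
  assumes p: "0 < p" "p \<le> 1" and n: "\<And>W. W \<in> indep_subsets E V \<Longrightarrow> card W \<le> n"
  shows "(\<Sum>v\<in>V. \<Sum>S\<in>Pow (V - {v}). subset_weight p (V - {v}) S *
      (card {W \<in> indep_subsets E S. \<forall>e\<in>link_sets E S v. \<not> e \<subseteq> W} / card (indep_subsets E S)))
    \<le> 2 * n / p"
proof -
  define I where "I = indep_subsets E"
  define Y where "Y S v = {W \<in> I S. \<forall>e\<in>link_sets E S v. \<not> e \<subseteq> W}" for S v
  define Q where "Q S v = card {W \<in> I S. v \<in> W} / card (I S)" for S and v :: 'a
  have finS: "finite S" if "S \<subseteq> V" for S using that finite_V finite_subset by blast
  have key: "subset_weight p (V - {v}) S * (card (Y S v) / card (I S))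
    \<le> 2 / p * (subset_weight p V (insert v S) * Q (insert v S) v)"
    if v: "v \<in> V" and S: "S \<in> Pow (V - {v})" for v S
  proof -
    have fS: "finite S" "v \<notin> S" using S finS by auto
    have eq: "{W \<in> I (insert v S). v \<in> W} = insert v ` Y S v"
    proof (intro equalityI subsetI)
      fix W assume W: "W \<in> {W \<in> I (insert v S). v \<in> W}"
      have "W - {v} \<in> Y S v"
      proof -
        have "\<not> e \<subseteq> W - {v}" if "e \<in> link_sets E S v" for e
        proof
          assume "e \<subseteq> W - {v}"
          then have "insert v e \<subseteq> W" using W by auto
          then show False using that W by (auto simp: I_def indep_subsets_def link_sets_def)
        qed
        moreover have "W - {v} \<in> I S" using W by (auto simp: I_def indep_subsets_def)
        ultimately show ?thesis by (simp add: Y_def)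
      qed
      moreover have "W = insert v (W - {v})" using W by auto
      ultimately show "W \<in> insert v ` Y S v" by blast
    next
      fix W assume "W \<in> insert v ` Y S v"
      then obtain B where B: "B \<in> Y S v" "W = insert v B" by auto
      have "\<not> e \<subseteq> insert v B" if e: "e \<in> E" for e
      proof
        assume sub: "e \<subseteq> insert v B"
        show False
        proof (cases "v \<in> e")
          case True
          have "e - {v} \<in> link_sets E S v"
            using True sub B e fS by (auto simp: link_sets_def Y_def I_def indep_subsets_def insert_absorb)
          moreover have "e - {v} \<subseteq> B" using sub by auto
          ultimately show False using B by (auto simp: Y_def)
        next
          case False
          then have "e \<subseteq> B" using sub by auto
          then show False using B e by (auto simp: Y_def I_def indep_subsets_def)
        qed
      qed
      then show "W \<in> {W \<in> I (insert v S). v \<in> W}"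
        using B by (auto simp: Y_def I_def indep_subsets_def)
    qed
    have "inj_on (insert v) (Y S v)"
      using fS by (auto simp: inj_on_def Y_def I_def indep_subsets_def)
    then have cY: "card {W \<in> I (insert v S). v \<in> W} = card (Y S v)"
      unfolding eq by (rule card_image)
    have "I (insert v S) = I S \<union> {W \<in> I (insert v S). v \<in> W}"
      by (auto simp: I_def indep_subsets_def)
    then have "card (I (insert v S)) \<le> card (I S) + card (Y S v)"
      by (metis card_Un_le cY)
    moreover have "card (Y S v) \<le> card (I S)"
      using fS by (intro card_mono) (auto simp: Y_def I_def)
    \<comment> \<open>Adding one vertex at most doubles the number of independent sets. This is the
      2 in the conclusion; the 1 / p comes from forcing v into the sample.\<close>
    ultimately have "card (I (insert v S)) \<le> 2 * card (I S)" by simp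
    moreover have pos: "0 < card (I (insert v S))" "0 < card (I S)"
      using card_indep_subsets_pos fS by (simp_all add: I_def)
    ultimately have "2 * real (card (Y S v)) / (2 * card (I S)) \<le> 2 * real (card (Y S v)) / card (I (insert v S))"
      by (intro divide_left_mono mult_pos_pos) auto
    then have "card (Y S v) / card (I S) \<le> 2 * (card (Y S v) / card (I (insert v S)))" by simp
    then have "subset_weight p (V - {v}) S * (card (Y S v) / card (I S))
      \<le> subset_weight p (V - {v}) S * (2 * Q (insert v S) v)"
      using p by (intro mult_left_mono subset_weight_nonneg) (auto simp: Q_def cY)
    moreover have "subset_weight p V (insert v S) = p * subset_weight p (V - {v}) S"
      using subset_weight_remove(1)[OF finite_V _ v] S by auto
    ultimately show ?thesis using p by simp
  qed
  \<comment> \<open>Summing over v and S - {v} is the same as summing over S and v in S. For fixed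
    S, the probabilities \<open>Q S v\<close> that a random independent set contains v add up to its
    expected size, which is at most n.\<close>
  have bij: "bij_betw (\<lambda>(v, S). (insert v S, v)) (SIGMA v:V. Pow (V - {v})) (SIGMA S:Pow V. S)"
    by (rule bij_betw_byWitness[where f' = "\<lambda>(S, v). (v, S - {v})"]) auto
  have "(\<Sum>(v, S)\<in>(SIGMA v:V. Pow (V - {v})). subset_weight p V (insert v S) * Q (insert v S) v)
    = (\<Sum>(S, v)\<in>(SIGMA S:Pow V. S). subset_weight p V S * Q S v)"
    using sum.reindex_bij_betw[OF bij, of "\<lambda>(S, v). subset_weight p V S * Q S v"]
    by (simp add: case_prod_unfold)
  also have "\<dots> = (\<Sum>S\<in>Pow V. \<Sum>v\<in>S. subset_weight p V S * Q S v)"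
    using finite_V finS by (simp add: sum.Sigma)
  also have "\<dots> \<le> (\<Sum>S\<in>Pow V. subset_weight p V S * n)"
  proof (rule sum_mono)
    fix S assume S: "S \<in> Pow V"
    then have fS: "finite S" using finS by auto
    have "(\<Sum>v\<in>S. card {W \<in> I S. v \<in> W}) = (\<Sum>v\<in>S. \<Sum>W\<in>I S. if v \<in> W then 1 else 0)"
      using fS by (simp add: I_def sum.If_cases Int_def)
    also have "\<dots> = (\<Sum>W\<in>I S. card (S \<inter> W))"
      using fS by (subst sum.swap) (simp add: sum.If_cases)
    finally have eq: "(\<Sum>v\<in>S. card {W \<in> I S. v \<in> W}) = (\<Sum>W\<in>I S. card (S \<inter> W))" .
    have "(\<Sum>v\<in>S. real (card {W \<in> I S. v \<in> W})) = (\<Sum>W\<in>I S. real (card (S \<inter> W)))"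
      using eq by (metis of_nat_sum)
    also have "\<dots> \<le> (\<Sum>W\<in>I S. n)"
    proof (rule sum_mono)
      fix W assume "W \<in> I S"
      then have "S \<inter> W = W" "W \<in> indep_subsets E V" using S by (auto simp: I_def indep_subsets_def)
      then show "real (card (S \<inter> W)) \<le> n" using n by simp
    qed
    finally have "(\<Sum>v\<in>S. real (card {W \<in> I S. v \<in> W})) \<le> card (I S) * n" by simp
    then have "(\<Sum>v\<in>S. Q S v) \<le> n"
      unfolding Q_def sum_divide_distrib[symmetric]
      using card_indep_subsets_pos[OF fS] by (simp add: I_def field_simps)
    then show "(\<Sum>v\<in>S. subset_weight p V S * Q S v) \<le> subset_weight p V S * n"
      using p by (simp add: sum_distrib_left[symmetric] mult_left_mono subset_weight_nonneg)
  qed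
  also have "\<dots> = n" using sum_subset_weight[OF finite_V, of p] by (simp flip: sum_distrib_right)
  finally have tot: "(\<Sum>(v, S)\<in>(SIGMA v:V. Pow (V - {v})). subset_weight p V (insert v S) * Q (insert v S) v) \<le> n" .
  have "(\<Sum>v\<in>V. \<Sum>S\<in>Pow (V - {v}). subset_weight p (V - {v}) S * (card (Y S v) / card (I S)))
    \<le> (\<Sum>v\<in>V. \<Sum>S\<in>Pow (V - {v}). 2 / p * (subset_weight p V (insert v S) * Q (insert v S) v))"
    by (intro sum_mono key)
  also have "\<dots> = 2 / p * (\<Sum>(v, S)\<in>(SIGMA v:V. Pow (V - {v})). subset_weight p V (insert v S) * Q (insert v S) v)"
    using finite_V by (simp add: sum_distrib_left sum.Sigma case_prod_unfold)
  also have "\<dots> \<le> 2 / p * n" using tot p by (intro mult_left_mono) auto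
  finally show ?thesis by (simp add: Y_def I_def)
qed

text \<open>A link set of v inside an independent set W is an r-subset of W having v among its at
  most d completions. So for every single W the sum over v is at most n^r d, whatever the sample is.
  The factor 1 / (1 - p) is the price of sampling from V instead of V - {v}.\<close>

lemma sum_links_le:
  fixes p :: real and n :: nat
  assumes p: "0 \<le> p" "p < 1" and n: "\<And>W. W \<in> indep_subsets E V \<Longrightarrow> card W \<le> n"
  shows "(\<Sum>v\<in>V. \<Sum>S\<in>Pow (V - {v}). subset_weight p (V - {v}) S *
      ((\<Sum>W\<in>indep_subsets E S. card {e \<in> link_sets E S v. e \<subseteq> W}) / card (indep_subsets E S)))
    \<le> n ^ r * d / (1 - p)"
proof -
  define I where "I = indep_subsets E"
  define Y where "Y S v = (\<Sum>W\<in>I S. card {e \<in> link_sets E S v. e \<subseteq> W})" for S v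
  have finS: "finite S" if "S \<subseteq> V" for S using that finite_V finite_subset by blast
  have count: "(\<Sum>v\<in>V. card {e \<in> link_sets E S v. e \<subseteq> W}) \<le> n ^ r * d"
    if S: "S \<subseteq> V" and W: "W \<in> I S" for S W
  proof -
    have WV: "W \<subseteq> V" "W \<in> indep_subsets E V" and WS: "W \<subseteq> S" using S W by (auto simp: I_def indep_subsets_def)
    have fW: "finite W" using WV finS by auto
    define Rs where "Rs = {R. R \<subseteq> W \<and> card R = r}"
    have fRs: "finite Rs" using fW by (simp add: Rs_def)
    have link: "{e \<in> link_sets E S v. e \<subseteq> W} \<subseteq> {R \<in> Rs. v \<notin> R \<and> insert v R \<in> E}" for v
    proof clarify
      fix e assume e: "e \<in> link_sets E S v" "e \<subseteq> W"
      then have "card (insert v e) = Suc r" "v \<notin> e" "finite e"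
        using edges fW finite_subset by (auto simp: link_sets_def)
      then show "e \<in> Rs \<and> v \<notin> e \<and> insert v e \<in> E" using e by (auto simp: Rs_def link_sets_def)
    qed
    have "(\<Sum>v\<in>V. card {e \<in> link_sets E S v. e \<subseteq> W}) \<le> (\<Sum>v\<in>V. card {R \<in> Rs. v \<notin> R \<and> insert v R \<in> E})"
      using link fRs by (intro sum_mono card_mono) auto
    also have "\<dots> = (\<Sum>v\<in>V. \<Sum>R\<in>Rs. if v \<notin> R \<and> insert v R \<in> E then 1 else 0)"
      using fRs by (simp add: sum.If_cases Int_def)
    also have "\<dots> = (\<Sum>R\<in>Rs. card {v \<in> V - R. insert v R \<in> E})"
      using finite_V by (subst sum.swap) (auto simp: sum.If_cases Int_def intro!: sum.cong arg_cong[where f = card])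
    also have "\<dots> \<le> of_nat (card Rs) * d"
      using WV by (intro sum_bounded_above codegree) (auto simp: Rs_def)
    also have "card Rs \<le> card W ^ r" unfolding Rs_def by (rule card_subsets_le_power[OF fW])
    also have "card W ^ r \<le> n ^ r" using n[OF WV(2)] by (rule power_mono) simp
    finally show ?thesis by simp
  qed
  define t where "t S v = subset_weight p V S * (Y S v / card (I S))" for S v
  have t0: "0 \<le> t S v" for S v
    using p by (simp add: t_def subset_weight_nonneg)
  have "(\<Sum>v\<in>V. \<Sum>S\<in>Pow (V - {v}). subset_weight p (V - {v}) S * (Y S v / card (I S)))
    = (\<Sum>v\<in>V. \<Sum>S\<in>Pow (V - {v}). 1 / (1 - p) * t S v)"
  proof (intro sum.cong refl)
    fix v S assume v: "v \<in> V" and S: "S \<in> Pow (V - {v})"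
    have "subset_weight p V S = (1 - p) * subset_weight p (V - {v}) S"
      using subset_weight_remove(2)[OF finite_V _ v] S by auto
    then show "subset_weight p (V - {v}) S * (Y S v / card (I S)) = 1 / (1 - p) * t S v"
      using p by (simp add: t_def)
  qed
  \<comment> \<open>Samples containing v are added with nonnegative terms, so that the range of S no
    longer depends on v and the sums can be exchanged.\<close>
  also have "\<dots> \<le> (\<Sum>v\<in>V. \<Sum>S\<in>Pow V. 1 / (1 - p) * t S v)"
    using p finite_V t0 by (intro sum_mono sum_mono2) auto
  also have "\<dots> = (\<Sum>S\<in>Pow V. \<Sum>v\<in>V. 1 / (1 - p) * t S v)" by (rule sum.swap)
  also have "\<dots> = 1 / (1 - p) * (\<Sum>S\<in>Pow V. \<Sum>v\<in>V. subset_weight p V S * (Y S v / card (I S)))"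
    by (simp only: sum_distrib_left t_def)
  also have "\<dots> \<le> 1 / (1 - p) * (\<Sum>S\<in>Pow V. subset_weight p V S * real (n ^ r * d))"
  proof (intro mult_left_mono sum_mono)
    fix S assume S: "S \<in> Pow V"
    then have fS: "finite S" using finS by auto
    have "(\<Sum>v\<in>V. Y S v) = (\<Sum>W\<in>I S. \<Sum>v\<in>V. card {e \<in> link_sets E S v. e \<subseteq> W})"
      unfolding Y_def by (rule sum.swap)
    also have "\<dots> \<le> of_nat (card (I S)) * (n ^ r * d)"
      using S by (intro sum_bounded_above count) auto
    finally have "real (\<Sum>v\<in>V. Y S v) \<le> real (card (I S) * (n ^ r * d))"
      by (simp only: of_nat_le_iff of_nat_id)
    then have "(\<Sum>v\<in>V. Y S v / card (I S)) \<le> real (n ^ r * d)"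
      unfolding sum_divide_distrib[symmetric]
      using card_indep_subsets_pos[OF fS] by (simp add: I_def field_simps)
    then show "(\<Sum>v\<in>V. subset_weight p V S * (Y S v / card (I S))) \<le> subset_weight p V S * real (n ^ r * d)"
      using p by (simp only: sum_distrib_left[symmetric]) (intro mult_left_mono subset_weight_nonneg, auto)
  qed (use p in auto)
  also have "\<dots> = n ^ r * d / (1 - p)"
    using sum_subset_weight[OF finite_V, of p] by (simp flip: sum_distrib_right)
  finally show ?thesis by (simp add: Y_def I_def)
qed

text \<open>For each v the total mass 1 is at most the mass of the samples that are not good for v
  plus the averages of the two terms of \<open>indep_subsets_link_inequality\<close>. Those averages
  are controlled only in their sum over all v, so the inequality is summed before it is
  estimated.\<close>

lemma order_inequality:
  fixes p y :: real and n :: nat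
  assumes p: "0 < p" "p < 1" and m: "1 \<le> p * card V" and y: "y > 0"
    and n: "\<And>W. W \<in> indep_subsets E V \<Longrightarrow> card W \<le> n"
  shows "real (card V) \<le>
      card V * (2 ^ Suc r * card V ^ (r - 1) * d ^ 2 * p ^ (r + 1) * (p * card V) ^ (r - 2)
        + (Suc r)\<^sup>2 * (card V ^ (r - 1) * d)\<^sup>2 * (card V ^ (r - 2) * d) * p ^ (3 * r - 1))
      + 2 powr y * (2 * n / p) + 2 ^ r / y * (n ^ r * d / (1 - p))"
proof -
  let ?w = "\<lambda>v. subset_weight p (V - {v})"
  define a where "a S v = card {W \<in> indep_subsets E S. \<forall>e\<in>link_sets E S v. \<not> e \<subseteq> W} / card (indep_subsets E S)" for S v
  define b where "b S v = (\<Sum>W\<in>indep_subsets E S. card {e \<in> link_sets E S v. e \<subseteq> W}) / card (indep_subsets E S)" for S v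
  define B :: real where "B = 2 ^ Suc r * card V ^ (r - 1) * d ^ 2 * p ^ (r + 1) * (p * card V) ^ (r - 2)
        + (Suc r)\<^sup>2 * (card V ^ (r - 1) * d)\<^sup>2 * (card V ^ (r - 2) * d) * p ^ (3 * r - 1)"
  have w0: "0 \<le> ?w v S" for v S using p by (intro subset_weight_nonneg) auto
  have finV: "finite (Pow (V - {v}))" for v using finite_V by simp
  have single: "1 \<le> B + (\<Sum>S\<in>Pow (V - {v}). 2 powr y * (?w v S * a S v) + 2 ^ r / y * (?w v S * b S v))"
    if v: "v \<in> V" for v
  proof -
    have pw: "1 \<le> (if good S v then 0 else 1) + (2 powr y * a S v + 2 ^ r / y * b S v)"
      if S: "S \<in> Pow (V - {v})" for S
    proof -
      have fS: "finite S" using S finite_V finite_subset by auto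
      have ab: "0 \<le> a S v" "0 \<le> b S v" by (simp_all add: a_def b_def sum_nonneg)
      show ?thesis
      proof (cases "good S v")
        case False
        then show ?thesis using ab y by simp
      next
        case True
        have "real (card (indep_subsets E S)) \<le>
          2 powr y * real (card {W \<in> indep_subsets E S. \<forall>e\<in>link_sets E S v. \<not> e \<subseteq> W})
          + 2 ^ r / y * real (\<Sum>W\<in>indep_subsets E S. card {e \<in> link_sets E S v. e \<subseteq> W})"
          using True r_ge_2 edges
          by (intro indep_subsets_link_inequality[OF fS _ _ y]) (auto simp: good_def)
        then have "card (indep_subsets E S) / card (indep_subsets E S) \<le>
          (2 powr y * real (card {W \<in> indep_subsets E S. \<forall>e\<in>link_sets E S v. \<not> e \<subseteq> W})
          + 2 ^ r / y * real (\<Sum>W\<in>indep_subsets E S. card {e \<in> link_sets E S v. e \<subseteq> W})) / card (indep_subsets E S)"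
          by (intro divide_right_mono) auto
        then show ?thesis
          using card_indep_subsets_pos[OF fS] True by (simp add: a_def b_def add_divide_distrib)
      qed
    qed
    have "1 = (\<Sum>S\<in>Pow (V - {v}). ?w v S * 1)"
      using sum_subset_weight[of "V - {v}" p] finite_V by simp
    also have "\<dots> \<le> (\<Sum>S\<in>Pow (V - {v}). ?w v S * ((if good S v then 0 else 1) + (2 powr y * a S v + 2 ^ r / y * b S v)))"
      using pw w0 by (intro sum_mono mult_left_mono) auto
    also have "\<dots> = (\<Sum>S\<in>Pow (V - {v}). if good S v then 0 else ?w v S)
      + (\<Sum>S\<in>Pow (V - {v}). 2 powr y * (?w v S * a S v) + 2 ^ r / y * (?w v S * b S v))"
      unfolding sum.distrib[symmetric] by (intro sum.cong) (auto simp: algebra_simps)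
    also have "(\<Sum>S\<in>Pow (V - {v}). if good S v then 0 else ?w v S)
      = (\<Sum>S | S \<subseteq> V - {v} \<and> \<not> good S v. ?w v S)"
      using finV by (intro sum.mono_neutral_cong_right) auto
    also have "\<dots> \<le> B"
      unfolding B_def using sum_not_good_le[OF v _ _ m] p by simp
    finally show ?thesis by simp
  qed
  have "real (card V) = (\<Sum>v\<in>V. 1)" by simp
  also have "\<dots> \<le> (\<Sum>v\<in>V. B + (\<Sum>S\<in>Pow (V - {v}). 2 powr y * (?w v S * a S v) + 2 ^ r / y * (?w v S * b S v)))"
    by (intro sum_mono single)
  also have "\<dots> = card V * B + (2 powr y * (\<Sum>v\<in>V. \<Sum>S\<in>Pow (V - {v}). ?w v S * a S v)
      + 2 ^ r / y * (\<Sum>v\<in>V. \<Sum>S\<in>Pow (V - {v}). ?w v S * b S v))"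
    by (simp add: sum.distrib sum_distrib_left)
  also have "\<dots> \<le> card V * B + (2 powr y * (2 * n / p) + 2 ^ r / y * (n ^ r * d / (1 - p)))"
    using sum_no_link_le[of p n] sum_links_le[of p n] p n y
    by (intro add_mono mult_left_mono order.refl) (simp_all add: a_def b_def)
  finally show ?thesis by (simp add: B_def)
qed

text \<open>The same inequality divided by N = \<open>card V\<close>, with the expected sample size
  m = p N as parameter. The condition 2 m \<le> N means p \<le> 1 / 2, so 1 / (1 - p) \<le> 2 is
  absorbed into \<open>2 ^ Suc r\<close>.\<close>

lemma order_inequality_scaled:
  fixes m y :: real and n :: nat
  assumes m: "1 \<le> m" "2 * m \<le> card V" and y: "y > 0"
    and n: "\<And>W. W \<in> indep_subsets E V \<Longrightarrow> card W \<le> n"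
  shows "1 \<le> 2 ^ Suc r * real d ^ 2 * m ^ (2 * r - 1) / real (card V) ^ 2
      + real (Suc r) ^ 2 * real d ^ 3 * m ^ (3 * r - 1) / real (card V) ^ 3
      + 2 powr y * (2 * real n / m) + 2 ^ Suc r / y * (real n ^ r * real d / card V)"
proof -
  define N where "N = real (card V)"
  define p where "p = m / N"
  \<comment> \<open>Writing r = q + 2 removes the truncated subtractions from the exponents.\<close>
  obtain q where q: "r = Suc (Suc q)" using r_ge_2 by (metis add_2_eq_Suc le_Suc_ex)
  have N: "N > 0" "2 * m \<le> N" using m by (auto simp: N_def)
  have p: "0 < p" "p \<le> 1 / 2" "p * N = m" using m N by (auto simp: p_def field_simps)
  define B1 where "B1 = 2 ^ Suc r * N ^ (r - 1) * real d ^ 2 * p ^ (r + 1) * (p * N) ^ (r - 2)"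
  define B2 where "B2 = real (Suc r) ^ 2 * (N ^ (r - 1) * real d)\<^sup>2 * (N ^ (r - 2) * real d) * p ^ (3 * r - 1)"
  have "p ^ (r + 1) = p ^ (q + 1) * p ^ 2" by (simp add: q power2_eq_square)
  moreover have "r - 1 = q + 1" "r - 2 = q" by (simp_all add: q)
  ultimately have "B1 = 2 ^ Suc r * real d ^ 2 * ((N ^ (q + 1) * p ^ (q + 1)) * (p * N) ^ q * p ^ 2)"
    unfolding B1_def by (simp only: mult_ac)
  also have "(N ^ (q + 1) * p ^ (q + 1)) * (p * N) ^ q = m ^ (2 * q + 1)"
  proof -
    have "N ^ (q + 1) * p ^ (q + 1) = m ^ (q + 1)"
      unfolding p(3)[symmetric] by (simp only: power_mult_distrib mult.commute)
    moreover have "2 * q + 1 = (q + 1) + q" by simp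
    ultimately show ?thesis unfolding p(3) by (simp only: power_add)
  qed
  also have "m ^ (2 * q + 1) * p ^ 2 = m ^ (2 * r - 1) / N ^ 2"
  proof -
    have "2 * r - 1 = (2 * q + 1) + 2" by (simp add: q)
    then show ?thesis by (simp only: power_add p_def power_divide times_divide_eq_right)
  qed
  finally have B1: "B1 = 2 ^ Suc r * real d ^ 2 * m ^ (2 * r - 1) / N ^ 2" by simp
  have "B2 = real (Suc r) ^ 2 * real d ^ 3 * ((p * N) ^ (3 * q + 2) * p ^ 3)"
  proof -
    have "3 * r - 1 = (3 * q + 2) + 3" by (simp add: q)
    then have 1: "p ^ (3 * r - 1) = p ^ (3 * q + 2) * p ^ 3" by (simp only: power_add)
    have "3 * q + 2 = (q + 1) + (q + 1) + q" by simp
    then have 2: "N ^ (3 * q + 2) = N ^ (q + 1) * N ^ (q + 1) * N ^ q" by (simp only: power_add)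
    have "r - 1 = q + 1" "r - 2 = q" by (simp_all add: q)
    then have "B2 = real (Suc r) ^ 2 * real d ^ 3 * ((N ^ (q + 1) * N ^ (q + 1) * N ^ q) * p ^ (3 * r - 1))"
      unfolding B2_def by (simp only: power2_eq_square power3_eq_cube mult_ac)
    also have "\<dots> = real (Suc r) ^ 2 * real d ^ 3 * ((p * N) ^ (3 * q + 2) * p ^ 3)"
      unfolding 1 2[symmetric] power_mult_distrib by (simp only: mult_ac)
    finally show ?thesis .
  qed
  also have "\<dots> = real (Suc r) ^ 2 * real d ^ 3 * m ^ (3 * r - 1) / N ^ 3"
  proof -
    have "3 * r - 1 = (3 * q + 2) + 3" by (simp add: q)
    then have "m ^ (3 * r - 1) = m ^ (3 * q + 2) * m ^ 3" by (simp only: power_add)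
    then show ?thesis unfolding p(3) by (simp add: p_def power_divide)
  qed
  finally have B2: "B2 = real (Suc r) ^ 2 * real d ^ 3 * m ^ (3 * r - 1) / N ^ 3" .
  have "N \<le> N * (B1 + B2) + 2 powr y * (2 * real n / p) + 2 ^ r / y * (real n ^ r * real d / (1 - p))"
    using order_inequality[of p y n] p m y n unfolding B1_def B2_def N_def by simp
  also have "2 ^ r / y * (real n ^ r * real d / (1 - p)) \<le> 2 ^ r / y * (real n ^ r * real d * 2)"
  proof -
    have "n ^ r * d / (1 - p) \<le> n ^ r * d / (1 / 2)"
      using p by (intro divide_left_mono) auto
    then show ?thesis using y by (intro mult_left_mono) auto
  qed
  also have "2 * real n / p = N * (2 * real n / m)" by (simp add: p_def)
  finally have "N \<le> N * (B1 + B2 + 2 powr y * (2 * real n / m) + 2 ^ Suc r / y * (real n ^ r * real d / N))"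
    using N by (simp add: algebra_simps)
  then have "1 \<le> B1 + B2 + 2 powr y * (2 * real n / m) + 2 ^ Suc r / y * (real n ^ r * real d / N)"
    using N mult_le_cancel_left_pos[of N 1] by simp
  then show ?thesis unfolding B1 B2 N_def .
qed

end

section \<open>Parameters for the upper bound\<close>

text \<open>Up to logarithms the triangle term is n to the power 3 + (1 + \<delta>) (3 r - 1) - 3 (r
  + 1), and \<delta> = 1 / (3 r) makes this exactly -\<delta>; the overlap exponent is no larger.
  The choice of y means 2^y = n^(\<delta> / 2), half of the gain m / n = n^\<delta>. Finally C =
  2^(r + 3) / \<delta> brings the last term down to (ln 2) / 2.\<close>

lemma upper_asymptotics:
  fixes r :: nat
  assumes r: "r \<ge> 2"
  defines "\<delta> \<equiv> 1 / (3 * real r)" and "C \<equiv> 2 ^ (r + 3) * (3 * real r)"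
  shows "\<forall>\<^sub>F n in sequentially. \<forall>N::real. C * real n ^ Suc r / ln n \<le> N \<longrightarrow>
    (let m = n powr (1 + \<delta>); y = \<delta> * ln n / (2 * ln 2) in
      1 \<le> m \<and> 2 * m \<le> N \<and> y > 0 \<and>
      2 ^ Suc r * real n ^ 2 * m ^ (2 * r - 1) / N ^ 2
      + real (Suc r) ^ 2 * real n ^ 3 * m ^ (3 * r - 1) / N ^ 3
      + 2 powr y * (2 * real n / m) + 2 ^ Suc r / y * (real n ^ r * real n / N) < 1)"
proof -
  have d: "0 < \<delta>" "\<delta> \<le> 1 / 6" using r by (auto simp: \<delta>_def field_simps)
  have C: "C \<ge> 1"
  proof -
    have "(1::real) * 1 \<le> 2 ^ (r + 3) * (3 * real r)"
      using r by (intro mult_mono one_le_power) auto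
    then show ?thesis by (simp add: C_def)
  qed
  have e1: "\<forall>\<^sub>F n::nat in sequentially. 2 ^ Suc r * (ln n ^ 2 * n powr (- \<delta>)) < 1 / 8"
  proof -
    have "(\<lambda>n::nat. 2 ^ Suc r * (ln n ^ 2 * n powr (- \<delta>))) \<longlonglongrightarrow> 0" using d by real_asymp
    then show ?thesis by (rule order_tendstoD) simp
  qed
  have e2: "\<forall>\<^sub>F n::nat in sequentially. real (Suc r) ^ 2 * (ln n ^ 3 * n powr (- \<delta>)) < 1 / 8"
  proof -
    have "(\<lambda>n::nat. ln n ^ 3 * n powr (- \<delta>)) \<longlonglongrightarrow> 0" using d by real_asymp
    from tendsto_mult_right_zero[OF this] show ?thesis by (rule order_tendstoD) simp
  qed
  have e3: "\<forall>\<^sub>F n::nat in sequentially. 2 * n powr (- \<delta> / 2) < 1 / 8"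
  proof -
    have "(\<lambda>n::nat. 2 * n powr (- \<delta> / 2)) \<longlonglongrightarrow> 0" using d by real_asymp
    then show ?thesis by (rule order_tendstoD) simp
  qed
  have e4: "\<forall>\<^sub>F n::nat in sequentially. 2 * n powr (1 + \<delta>) \<le> n powr 2 / ln n"
    using d by real_asymp
  have e5: "\<forall>\<^sub>F n::nat in sequentially. 3 \<le> n" by real_asymp
  show ?thesis
    using e1 e2 e3 e4 e5
  proof eventually_elim
    case (elim n)
    define l where "l = ln (real n)"
    have n: "real n \<ge> 3" "real n > 0" "real n \<ge> 1" using elim by auto
    have l: "l \<ge> 1"
      unfolding l_def using n by (intro ln_ge_1) auto
    define m where "m = n powr (1 + \<delta>)"
    define y where "y = \<delta> * l / (2 * ln 2)"
    have y: "y > 0" using d l by (simp add: y_def)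
    have "1 \<le> m" using n d by (simp add: m_def ge_one_powr_ge_zero)
    have pw: "real n ^ j = n powr j" for j :: nat using n by (simp add: powr_realpow)
    have mp: "m ^ j = n powr ((1 + \<delta>) * j)" for j :: nat
      using n by (simp add: m_def powr_powr flip: powr_realpow)
    have "2 powr y = n powr (\<delta> / 2)"
      using n by (simp add: powr_def y_def l_def)
    then have t3: "2 powr y * (2 * real n / m) < 1 / 8"
    proof -
      have "n powr (\<delta> / 2) * (n powr 1 / n powr (1 + \<delta>)) = n powr (- \<delta> / 2)"
        by (simp only: powr_add[symmetric] powr_diff[symmetric]) simp
      moreover have "2 powr y * (2 * real n / m) = 2 * (n powr (\<delta> / 2) * (n powr 1 / n powr (1 + \<delta>)))"
        using \<open>2 powr y = n powr (\<delta> / 2)\<close> n by (simp add: m_def)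
      ultimately show ?thesis using elim(3) by simp
    qed
    have N: "1 \<le> m \<and> 2 * m \<le> N \<and> y > 0 \<and> 2 ^ Suc r * real n ^ 2 * m ^ (2 * r - 1) / N ^ 2
      + real (Suc r) ^ 2 * real n ^ 3 * m ^ (3 * r - 1) / N ^ 3
      + 2 powr y * (2 * real n / m) + 2 ^ Suc r / y * (real n ^ r * real n / N) < 1"
      if NX: "C * real n ^ Suc r / l \<le> N" for N
    proof -
      \<comment> \<open>N occurs only in denominators, so the terms can be evaluated at a lower
        bound for N. The overlap and triangle terms have a power of n to spare and need only N \<ge>
        X; the constant C is used in the last term.\<close>
      define X where "X = n powr (real r + 1) / l"
      have X0: "X > 0" using n l by (simp add: X_def)
      have CX: "C * X \<le> N" using NX pw[of "Suc r"] by (simp add: X_def add.commute)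
      then have XN: "X \<le> N" using C X0 by (smt (verit) mult_le_cancel_right1)
      have "n powr 2 / l \<le> X"
        unfolding X_def using n l r by (intro divide_right_mono powr_mono) auto
      then have two: "2 * m \<le> N" using elim XN by (simp add: m_def l_def)
      have "2 ^ Suc r * real n ^ 2 * m ^ (2 * r - 1) / N ^ 2 \<le> 2 ^ Suc r * real n ^ 2 * m ^ (2 * r - 1) / X ^ 2"
        using X0 XN \<open>1 \<le> m\<close> by (intro divide_left_mono power_mono mult_nonneg_nonneg mult_pos_pos) auto
      also have "\<dots> = 2 ^ Suc r * (l ^ 2 * (n powr 2 * n powr ((1 + \<delta>) * (2 * r - 1)) / (n powr (2 * (real r + 1)))))"
      proof -
        have "(n powr (real r + 1)) ^ 2 = n powr (2 * (real r + 1))"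
          using n by (simp add: powr_powr mult.commute flip: powr_realpow)
        then show ?thesis using mp[of "2 * r - 1"] pw[of 2] r l by (simp add: X_def power_divide of_nat_diff)
      qed
      also have "n powr 2 * n powr ((1 + \<delta>) * (2 * r - 1)) / (n powr (2 * (real r + 1))) =
        n powr (2 + (1 + \<delta>) * (2 * r - 1) - 2 * (real r + 1))"
        by (simp only: powr_add[symmetric] powr_diff[symmetric])
      also have "n powr (2 + (1 + \<delta>) * (2 * r - 1) - 2 * (real r + 1)) \<le> n powr (- \<delta>)"
        using n r by (intro powr_mono) (auto simp: \<delta>_def of_nat_diff field_simps)
      finally have t1: "2 ^ Suc r * real n ^ 2 * m ^ (2 * r - 1) / N ^ 2 < 1 / 8"
        using elim l by (simp add: l_def mult_left_mono)
      have "real (Suc r) ^ 2 * real n ^ 3 * m ^ (3 * r - 1) / N ^ 3 \<le> real (Suc r) ^ 2 * real n ^ 3 * m ^ (3 * r - 1) / X ^ 3"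
        using X0 XN \<open>1 \<le> m\<close> by (intro divide_left_mono power_mono mult_nonneg_nonneg mult_pos_pos) auto
      also have "\<dots> = real (Suc r) ^ 2 * (l ^ 3 * (n powr 3 * n powr ((1 + \<delta>) * (3 * r - 1)) / (n powr (3 * (real r + 1)))))"
      proof -
        have "(n powr (real r + 1)) ^ 3 = n powr (3 * (real r + 1))"
          using n by (simp add: powr_powr mult.commute flip: powr_realpow)
        then show ?thesis using mp[of "3 * r - 1"] pw[of 3] r l by (simp add: X_def power_divide of_nat_diff)
      qed
      also have "n powr 3 * n powr ((1 + \<delta>) * (3 * r - 1)) / (n powr (3 * (real r + 1))) =
        n powr (3 + (1 + \<delta>) * (3 * r - 1) - 3 * (real r + 1))"
        by (simp only: powr_add[symmetric] powr_diff[symmetric])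
      also have "3 + (1 + \<delta>) * (3 * r - 1) - 3 * (real r + 1) = - \<delta>"
        using r by (auto simp: \<delta>_def of_nat_diff field_simps)
      also have "real (Suc r) ^ 2 * (l ^ 3 * n powr (- \<delta>)) < 1 / 8"
        using elim(2) by (simp only: l_def)
      finally have t2: "real (Suc r) ^ 2 * real n ^ 3 * m ^ (3 * r - 1) / N ^ 3 < 1 / 8" .
      have "C * X > 0" "N > 0" using C X0 XN by auto
      then have "2 ^ Suc r / y * (real n ^ r * real n / N) \<le> 2 ^ Suc r / y * (real n ^ r * real n / (C * X))"
        using CX y mult_pos_pos[OF \<open>N > 0\<close> \<open>C * X > 0\<close>] by (intro mult_left_mono divide_left_mono) auto
      also have "\<dots> = 2 ^ Suc r / y * (l / C)"
      proof -
        have P: "real n ^ r * real n = n powr (real r + 1)" using pw[of "Suc r"] by (simp add: mult_ac add_ac)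
        have "n powr (real r + 1) > 0" using n by simp
        then have "n powr (real r + 1) / (C * X) = l / C" using C l by (simp add: X_def)
        then show ?thesis by (simp only: P)
      qed
      also have "\<dots> = 2 ^ Suc r * 2 * ln 2 / (\<delta> * C)" using l d by (simp add: y_def)
      also have "\<dots> = ln 2 / 2" using r by (simp add: \<delta>_def C_def power_add)
      also have "\<dots> < 1 / 2" using ln_2_less_1 by simp
      finally show ?thesis using t1 t2 t3 two y \<open>1 \<le> m\<close> by linarith
    qed
    show ?case using N unfolding Let_def m_def y_def l_def by blast
  qed
qed

section \<open>Upper bound for F-free hypergraphs\<close>

text \<open>An edge e inside the common neighbourhood of R is disjoint from R, and each of its
  vertices completes R to an edge. Hence R as the v's and e as the w's, in any order, would form a
  copy of F.\<close>

lemma F_free_link_independent: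
  fixes H :: "'a hypergraph"
  assumes k: "k \<ge> 2" and H: "uniform_hypergraph k H" "\<not> contains_copy (F_graph k) H"
    and R: "R \<subseteq> verts H" "card R = k - 1"
  shows "independent_set H {w \<in> verts H - R. insert w R \<in> edges H}"
proof -
  have fin: "finite R" using H R finite_subset by (auto simp: uniform_hypergraph_def)
  have "\<not> e \<subseteq> {w \<in> verts H - R. insert w R \<in> edges H}" if e: "e \<in> edges H" for e
  proof
    assume sub: "e \<subseteq> {w \<in> verts H - R. insert w R \<in> edges H}"
    have ce: "card e = k" "finite e" using H e finite_subset by (auto simp: uniform_hypergraph_def)
    obtain g where g: "bij_betw g {1..k-1} R"
      using fin R finite_same_card_bij[of "{1..k-1}" R] by auto
    obtain h where h: "bij_betw h {1..k} e"
      using ce finite_same_card_bij[of "{1..k}" e] by auto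
    define f where "f = case_sum g h"
    have fl: "f ` Inl ` A = g ` A" and fr: "f ` Inr ` A = h ` A" for A
      by (auto simp: f_def image_image)
    have imgs: "g ` {1..k-1} = R" "h ` {1..k} = e" using g h by (auto simp: bij_betw_def)
    have disj: "R \<inter> e = {}" using sub by auto
    have "inj_on f (verts (F_graph k))"
    proof (rule inj_onI)
      fix a b assume ab: "a \<in> verts (F_graph k)" "b \<in> verts (F_graph k)" "f a = f b"
      have inj: "inj_on g {1..k-1}" "inj_on h {1..k}" using g h by (simp_all add: bij_betw_def)
      have l: "f x \<in> R" "i \<in> {1..k-1}" if "x \<in> verts (F_graph k)" "x = Inl i" for x i
        using that imgs(1) by (auto simp: F_graph_def f_def)
      have r: "f x \<in> e" "i \<in> {1..k}" if "x \<in> verts (F_graph k)" "x = Inr i" for x i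
        using that imgs(2) by (auto simp: F_graph_def f_def)
      show "a = b"
      proof (cases a; cases b)
        fix i j assume "a = Inl i" "b = Inl j"
        then show ?thesis using ab l[of a i] l[of b j] inj by (simp add: f_def inj_on_eq_iff)
      next
        fix i j assume "a = Inr i" "b = Inr j"
        then show ?thesis using ab r[of a i] r[of b j] inj by (simp add: f_def inj_on_eq_iff)
      next
        fix i j assume "a = Inl i" "b = Inr j"
        then show ?thesis using ab l(1)[of a i] r(1)[of b j] disj by auto
      next
        fix i j assume "a = Inr i" "b = Inl j"
        then show ?thesis using ab r(1)[of a i] l(1)[of b j] disj by auto
      qed
    qed
    moreover have "f ` verts (F_graph k) \<subseteq> verts H"
      using R sub imgs by (auto simp: F_graph_def image_Un fl fr)
    moreover have "f ` e' \<in> edges H" if e': "e' \<in> edges (F_graph k)" for e'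
    proof -
      consider i where "i \<in> {1..k-1}" "e' = Inl ` {1..k-1} \<union> {Inr i}" | "e' = Inr ` {1..k}"
        using e' unfolding F_graph_def snd_conv by blast
      then show ?thesis
      proof cases
        case 1
        then have "h i \<in> e" using imgs(2) by auto
        moreover have "f ` e' = insert (h i) R"
          using 1 imgs by (simp add: image_Un fl) (simp add: f_def)
        ultimately show ?thesis using sub by auto
      next
        case 2
        then show ?thesis using e imgs by (simp add: fr)
      qed
    qed
    ultimately have "contains_copy (F_graph k) H" unfolding contains_copy_def by blast
    then show False using H by blast
  qed
  then show ?thesis by (auto simp: independent_set_def)
qed

lemma independent_set_mono:
  "independent_set H S \<Longrightarrow> T \<subseteq> S \<Longrightarrow> independent_set H T"
  unfolding independent_set_def by blast

lemma exists_independent_set_card: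
  assumes "independent_set H S" "n \<le> card S"
  shows "\<exists>T. independent_set H T \<and> card T = n"
  using assms by (meson independent_set_mono obtain_subset_with_card_n)

lemma F_free_large_independent_set:
  fixes k :: nat
  assumes k: "k \<ge> 3"
  shows "\<exists>C>0. \<forall>\<^sub>F n in sequentially. \<forall>H :: 'a hypergraph.
    uniform_hypergraph k H \<and> \<not> contains_copy (F_graph k) H \<and> C * real n ^ k / ln n \<le> card (verts H)
    \<longrightarrow> (\<exists>S. independent_set H S \<and> card S = n)"
proof -
  define r where "r = k - 1"
  have r: "r \<ge> 2" "k = Suc r" using k by (auto simp: r_def)
  define C :: real where "C = 2 ^ (r + 3) * (3 * real r)"
  have C: "C > 0" using r by (simp add: C_def)
  have "\<forall>\<^sub>F n in sequentially. \<forall>H :: 'a hypergraph.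
    uniform_hypergraph k H \<and> \<not> contains_copy (F_graph k) H \<and> C * real n ^ k / ln n \<le> card (verts H)
    \<longrightarrow> (\<exists>S. independent_set H S \<and> card S = n)"
    using upper_asymptotics[OF r(1)]
  proof eventually_elim
    case (elim n)
    show ?case
    proof (intro allI impI, rule ccontr)
      fix H :: "'a hypergraph"
      assume H: "uniform_hypergraph k H \<and> \<not> contains_copy (F_graph k) H \<and> C * real n ^ k / ln n \<le> card (verts H)"
      assume "\<nexists>S. independent_set H S \<and> card S = n"
      \<comment> \<open>Subsets of independent sets are independent, so excluding the size n
        excludes all larger sizes as well. This bounds the codegrees and the random independent sets
        alike.\<close>
      then have small: "card S \<le> n" if "independent_set H S" for S
        using exists_independent_set_card[OF that, of n] nat_le_linear by blast
      interpret bounded_codegree "verts H" "edges H" r n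
      proof
        fix R assume "R \<subseteq> verts H" "card R = r"
        then show "card {w \<in> verts H - R. insert w R \<in> edges H} \<le> n"
          using F_free_link_independent[of k H R] H k by (intro small) (auto simp: r_def)
      qed (use H r in \<open>auto simp: uniform_hypergraph_def\<close>)
      define m where "m = n powr (1 + 1 / (3 * real r))"
      define y where "y = 1 / (3 * real r) * ln n / (2 * ln 2)"
      have indep: "card W \<le> n" if "W \<in> indep_subsets (edges H) (verts H)" for W
        using that by (intro small) (auto simp: indep_subsets_def independent_set_def)
      have "1 \<le> m \<and> 2 * m \<le> card (verts H) \<and> y > 0 \<and>
        2 ^ Suc r * real n ^ 2 * m ^ (2 * r - 1) / real (card (verts H)) ^ 2
        + real (Suc r) ^ 2 * real n ^ 3 * m ^ (3 * r - 1) / real (card (verts H)) ^ 3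
        + 2 powr y * (2 * real n / m) + 2 ^ Suc r / y * (real n ^ r * real n / card (verts H)) < 1"
        using elim[rule_format, of "card (verts H)"] H unfolding r(2) C_def m_def y_def Let_def by simp
      then show False using order_inequality_scaled[of m y n] indep by simp
    qed
  qed
  then show ?thesis using C by blast
qed

section \<open>Random lists\<close>

definition list_weight :: "('a \<Rightarrow> real) \<Rightarrow> 'a list \<Rightarrow> real" where
  "list_weight P xs = prod_list (map P xs)"

definition lists_of_length :: "'a set \<Rightarrow> nat \<Rightarrow> 'a list set" where
  "lists_of_length \<Omega> b = {xs. set xs \<subseteq> \<Omega> \<and> length xs = b}"

lemma finite_lists_of_length: "finite \<Omega> \<Longrightarrow> finite (lists_of_length \<Omega> b)"
  unfolding lists_of_length_def by (rule finite_lists_length_eq)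

lemma list_weight_nonneg:
  assumes "\<And>c. c \<in> \<Omega> \<Longrightarrow> 0 \<le> P c" "xs \<in> lists_of_length \<Omega> b"
  shows "0 \<le> list_weight P xs"
  using assms unfolding list_weight_def lists_of_length_def
  by (intro prod_list_nonneg) auto

lemma sum_lists_of_length_Suc:
  assumes "finite \<Omega>"
  shows "sum F (lists_of_length \<Omega> (Suc b)) = (\<Sum>xs\<in>lists_of_length \<Omega> b. \<Sum>c\<in>\<Omega>. F (xs @ [c]))"
proof -
  have bij: "bij_betw (\<lambda>(xs, c). xs @ [c]) (lists_of_length \<Omega> b \<times> \<Omega>) (lists_of_length \<Omega> (Suc b))"
  proof (rule bij_betw_byWitness[where f' = "\<lambda>xs. (butlast xs, last xs)"])
    show "(\<lambda>xs. (butlast xs, last xs)) ` lists_of_length \<Omega> (Suc b) \<subseteq> lists_of_length \<Omega> b \<times> \<Omega>"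
    proof (rule image_subsetI)
      fix xs assume xs: "xs \<in> lists_of_length \<Omega> (Suc b)"
      then have "xs \<noteq> []" by (auto simp: lists_of_length_def)
      then show "(butlast xs, last xs) \<in> lists_of_length \<Omega> b \<times> \<Omega>"
        using xs by (auto simp: lists_of_length_def dest: in_set_butlastD)
    qed
  next
    show "\<forall>xs\<in>lists_of_length \<Omega> (Suc b). (\<lambda>(xs, c). xs @ [c]) (butlast xs, last xs) = xs"
    proof
      fix xs assume "xs \<in> lists_of_length \<Omega> (Suc b)"
      then have "xs \<noteq> []" by (auto simp: lists_of_length_def)
      then show "(\<lambda>(xs, c). xs @ [c]) (butlast xs, last xs) = xs" by simp
    qed
  qed (auto simp: lists_of_length_def)
  show ?thesis
    using sum.reindex_bij_betw[OF bij, of F] assms finite_lists_of_length[OF assms]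
    by (simp add: sum.cartesian_product case_prod_unfold)
qed

text \<open>Each factor may depend on the entries before it. Summing out the last entry first leaves
  a sum conditioned on the prefix, which is at most \<gamma>; this is why lists grow at the
  end.\<close>

lemma sum_list_weight_prod_le:
  assumes \<Omega>: "finite \<Omega>" and P: "\<And>c. c \<in> \<Omega> \<Longrightarrow> 0 \<le> P c" and g: "\<And>ys c. 0 \<le> g ys c"
    and step: "\<And>ys. set ys \<subseteq> \<Omega> \<Longrightarrow> (\<Sum>c\<in>\<Omega>. P c * g ys c) \<le> \<gamma>"
  shows "(\<Sum>xs\<in>lists_of_length \<Omega> b. list_weight P xs * (\<Prod>i<b. g (take i xs) (xs ! i))) \<le> \<gamma> ^ b"
proof (induction b)
  case 0
  have "lists_of_length \<Omega> 0 = {[]}" by (auto simp: lists_of_length_def)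
  then show ?case by (simp add: list_weight_def)
next
  case (Suc b)
  define G where "G xs = list_weight P xs * (\<Prod>i<b. g (take i xs) (xs ! i))" for xs
  have "0 \<le> (\<Sum>c\<in>\<Omega>. P c * g [] c)" using P g by (intro sum_nonneg) auto
  then have \<gamma>: "0 \<le> \<gamma>" using step[of "[]"] by simp
  have G: "0 \<le> G xs" if "xs \<in> lists_of_length \<Omega> b" for xs
    unfolding G_def using list_weight_nonneg[OF P that] g by (intro mult_nonneg_nonneg prod_nonneg) auto
  have snoc: "list_weight P (xs @ [c]) * (\<Prod>i<Suc b. g (take i (xs @ [c])) ((xs @ [c]) ! i))
    = G xs * (P c * g xs c)" if "xs \<in> lists_of_length \<Omega> b" for xs c
  proof -
    have len: "length xs = b" using that by (simp add: lists_of_length_def)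
    have "(\<Prod>i<b. g (take i (xs @ [c])) ((xs @ [c]) ! i)) = (\<Prod>i<b. g (take i xs) (xs ! i))"
      using len by (intro prod.cong) (auto simp: nth_append)
    then show ?thesis using len by (simp add: G_def list_weight_def nth_append)
  qed
  have "(\<Sum>xs\<in>lists_of_length \<Omega> (Suc b). list_weight P xs * (\<Prod>i<Suc b. g (take i xs) (xs ! i)))
    = (\<Sum>xs\<in>lists_of_length \<Omega> b. \<Sum>c\<in>\<Omega>. G xs * (P c * g xs c))"
    unfolding sum_lists_of_length_Suc[OF \<Omega>] using snoc by (intro sum.cong) auto
  also have "\<dots> = (\<Sum>xs\<in>lists_of_length \<Omega> b. G xs * (\<Sum>c\<in>\<Omega>. P c * g xs c))"
    by (simp add: sum_distrib_left)
  also have "\<dots> \<le> (\<Sum>xs\<in>lists_of_length \<Omega> b. G xs * \<gamma>)"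
    using step G by (intro sum_mono mult_left_mono) (auto simp: lists_of_length_def)
  also have "\<dots> \<le> \<gamma> ^ b * \<gamma>"
    unfolding sum_distrib_right[symmetric] using Suc.IH \<gamma> by (intro mult_right_mono) (simp_all add: G_def)
  finally show ?case by (simp add: mult.commute)
qed

lemma sum_list_weight:
  assumes "finite \<Omega>" "(\<Sum>c\<in>\<Omega>. P c) = 1"
  shows "(\<Sum>xs\<in>lists_of_length \<Omega> b. list_weight P xs) = 1"
proof (induction b)
  case 0
  have "lists_of_length \<Omega> 0 = {[]}" by (auto simp: lists_of_length_def)
  then show ?case by (simp add: list_weight_def)
next
  case (Suc b)
  then show ?case
    using assms by (simp add: sum_lists_of_length_Suc list_weight_def flip: sum_distrib_left)
qed

text \<open>The increment \<open>h\<close> may depend on the past, so this is Markov's inequality for an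
  exponential supermartingale.\<close>

lemma list_weight_tail:
  fixes h :: "'a list \<Rightarrow> 'a \<Rightarrow> real"
  assumes \<Omega>: "finite \<Omega>" and P: "\<And>c. c \<in> \<Omega> \<Longrightarrow> 0 \<le> P c"
    and step: "\<And>ys. set ys \<subseteq> \<Omega> \<Longrightarrow> (\<Sum>c\<in>\<Omega>. P c * exp (h ys c)) \<le> 1 + a"
  shows "(\<Sum>xs | xs \<in> lists_of_length \<Omega> b \<and> t \<le> (\<Sum>i<b. h (take i xs) (xs ! i)). list_weight P xs)
    \<le> exp (real b * a - t)"
proof -
  have fin: "finite (lists_of_length \<Omega> b)" using \<Omega> by (rule finite_lists_of_length)
  have w: "0 \<le> list_weight P xs" if "xs \<in> lists_of_length \<Omega> b" for xs
    using list_weight_nonneg[OF P that] .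
  have "(\<Sum>xs | xs \<in> lists_of_length \<Omega> b \<and> t \<le> (\<Sum>i<b. h (take i xs) (xs ! i)). list_weight P xs)
    \<le> (\<Sum>xs | xs \<in> lists_of_length \<Omega> b \<and> t \<le> (\<Sum>i<b. h (take i xs) (xs ! i)).
        list_weight P xs * exp ((\<Sum>i<b. h (take i xs) (xs ! i)) - t))"
  proof (rule sum_mono)
    fix xs assume "xs \<in> {xs \<in> lists_of_length \<Omega> b. t \<le> (\<Sum>i<b. h (take i xs) (xs ! i))}"
    then have "list_weight P xs * 1 \<le> list_weight P xs * exp ((\<Sum>i<b. h (take i xs) (xs ! i)) - t)"
      using w by (intro mult_left_mono) auto
    then show "list_weight P xs \<le> list_weight P xs * exp ((\<Sum>i<b. h (take i xs) (xs ! i)) - t)" by simp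
  qed
  also have "\<dots> \<le> (\<Sum>xs\<in>lists_of_length \<Omega> b. list_weight P xs * exp ((\<Sum>i<b. h (take i xs) (xs ! i)) - t))"
    using fin w by (intro sum_mono2) auto
  also have "\<dots> = exp (- t) * (\<Sum>xs\<in>lists_of_length \<Omega> b. list_weight P xs * (\<Prod>i<b. exp (h (take i xs) (xs ! i))))"
    by (simp add: sum_distrib_left exp_diff exp_minus exp_sum field_simps)
  also have "\<dots> \<le> exp (- t) * exp a ^ b"
  proof (intro mult_left_mono sum_list_weight_prod_le[OF \<Omega> P])
    fix ys assume "set ys \<subseteq> \<Omega>"
    then show "(\<Sum>c\<in>\<Omega>. P c * exp (h ys c)) \<le> exp a"
      using step[of ys] exp_ge_add_one_self[of a] by linarith
  qed auto
  also have "\<dots> = exp (real b * a - t)"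
    by (simp add: exp_diff exp_minus field_simps flip: exp_of_nat_mult)
  finally show ?thesis .
qed

text \<open>The entries are independent and identically distributed, so an estimate about earlier
  entries holds equally for later ones.\<close>

lemma sum_list_weight_rev:
  assumes "finite \<Omega>"
  shows "(\<Sum>xs | xs \<in> lists_of_length \<Omega> b \<and> Q (rev xs). list_weight P xs)
    = (\<Sum>xs | xs \<in> lists_of_length \<Omega> b \<and> Q xs. list_weight P xs)"
proof -
  have "bij_betw rev {xs \<in> lists_of_length \<Omega> b. Q (rev xs)} {xs \<in> lists_of_length \<Omega> b. Q xs}"
    by (rule bij_betw_byWitness[where f' = rev]) (auto simp: lists_of_length_def)
  moreover have "list_weight P (rev xs) = list_weight P xs" for xs
    unfolding list_weight_def by (induction xs) auto
  ultimately show ?thesis using sum.reindex_bij_betw[of rev _ _ "list_weight P"] by simp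
qed

section \<open>Hypergraphs from colored blocks\<close>

text \<open>Each entry of \<open>xs\<close> encodes a block together with its coloring: color 0
  marks the vertices outside the block. As \<open>card e = k\<close>, having the image
  \<open>{1..k}\<close> says at once that e lies in the block and is rainbow.\<close>

definition block_graph :: "nat \<Rightarrow> 'a set \<Rightarrow> ('a \<Rightarrow> nat) list \<Rightarrow> 'a hypergraph" where
  "block_graph k V xs = (V, {e. e \<subseteq> V \<and> card e = k \<and> (\<exists>i<length xs. (xs ! i) ` e = {1..k} \<and>
     (\<forall>j<length xs. j \<noteq> i \<longrightarrow> card {v \<in> e. (xs ! j) v \<noteq> 0} < k - 1))})"

lemma uniform_block_graph: "finite V \<Longrightarrow> uniform_hypergraph k (block_graph k V xs)"
  by (auto simp: uniform_hypergraph_def block_graph_def)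

text \<open>The \<open>k - 1\<close> edges through \<open>v\<^sub>1, \<dots>, v\<^sub>k\<^sub>-\<^sub>1\<close> come from one block, in which all
  \<open>w\<^sub>i\<close> with \<open>i < k\<close> have the missing color. The edge \<open>{w\<^sub>1, \<dots>, w\<^sub>k}\<close> has \<open>k - 1\<close> vertices in
  that block, so it would have to come from the same block, where it is not rainbow.\<close>

lemma F_free_block_graph:
  assumes k: "k \<ge> 3" and V: "finite V"
  shows "\<not> contains_copy (F_graph k) (block_graph k V xs)"
proof
  assume "contains_copy (F_graph k) (block_graph k V xs)"
  then obtain f where f: "inj_on f (verts (F_graph k))"
    and edges: "\<And>e. e \<in> edges (F_graph k) \<Longrightarrow> f ` e \<in> edges (block_graph k V xs)"
    unfolding contains_copy_def by blast
  define origin where "origin i e \<longleftrightarrow> i < length xs \<and> (xs ! i) ` e = {1..k} \<and>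
     (\<forall>j<length xs. j \<noteq> i \<longrightarrow> card {v \<in> e. (xs ! j) v \<noteq> 0} < k - 1)" for i e
  have E: "e \<subseteq> V \<and> card e = k \<and> (\<exists>i. origin i e)" if "e \<in> edges (block_graph k V xs)" for e
    using that by (auto simp: block_graph_def origin_def)
  define R where "R = f ` Inl ` {1..k-1}"
  define w where "w i = f (Inr i)" for i
  have winj: "inj_on w {1..k}"
    using f unfolding w_def F_graph_def inj_on_def by auto
  have wR: "w i \<notin> R" if "i \<in> {1..k}" for i
  proof
    assume "w i \<in> R"
    then obtain j where "j \<in> {1..k-1}" "f (Inr i) = f (Inl j)" by (auto simp: R_def w_def)
    then show False using inj_onD[OF f, of "Inr i" "Inl j"] that by (auto simp: F_graph_def)
  qed
  have cR: "card R = k - 1"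
  proof -
    have "inj_on f (Inl ` {1..k-1})" using f by (rule inj_on_subset) (auto simp: F_graph_def)
    then show ?thesis by (simp add: R_def card_image)
  qed
  have finR: "finite R" by (simp add: R_def)
  have e1: "insert (w i) R \<in> edges (block_graph k V xs)" if "i \<in> {1..k-1}" for i
  proof -
    have "Inl ` {1..k-1} \<union> {Inr i} \<in> edges (F_graph k)"
      using that unfolding F_graph_def snd_conv by blast
    from edges[OF this] show ?thesis by (simp add: R_def w_def image_Un)
  qed
  have e2: "w ` {1..k} \<in> edges (block_graph k V xs)"
  proof -
    have "Inr ` {1..k} \<in> edges (F_graph k)" unfolding F_graph_def snd_conv by blast
    from edges[OF this] show ?thesis by (simp add: w_def image_image)
  qed
  have fin: "finite e" "inj_on (xs ! i) e" "\<And>v. v \<in> e \<Longrightarrow> (xs ! i) v \<noteq> 0"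
    if "e \<in> edges (block_graph k V xs)" "origin i e" for e i
  proof -
    show "finite e" using E[OF that(1)] V finite_subset by blast
    then show "inj_on (xs ! i) e" using that E[OF that(1)] by (intro eq_card_imp_inj_on) (auto simp: origin_def)
    fix v assume "v \<in> e"
    then have "(xs ! i) v \<in> {1..k}" using that by (auto simp: origin_def)
    then show "(xs ! i) v \<noteq> 0" by simp
  qed
  have one: "(1::nat) \<in> {1..k-1}" "(2::nat) \<in> {1..k-1}" using k by auto
  obtain \<beta> where \<beta>: "origin \<beta> (insert (w 1) R)" using E[OF e1[OF one(1)]] by blast
  have \<beta>R: "(xs ! \<beta>) v \<noteq> 0" if "v \<in> R" for v using fin(3)[OF e1[OF one(1)] \<beta>] that by blast
  have origin\<beta>: "origin \<beta> (insert (w i) R)" if i: "i \<in> {1..k-1}" for i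
  proof -
    obtain \<gamma> where \<gamma>: "origin \<gamma> (insert (w i) R)" using E[OF e1[OF i]] by blast
    have "k - 1 \<le> card {v \<in> insert (w i) R. (xs ! \<beta>) v \<noteq> 0}"
      unfolding cR[symmetric] using \<beta>R finR by (intro card_mono) auto
    then have "\<beta> = \<gamma>" using \<gamma> \<beta> unfolding origin_def by (meson not_le)
    then show ?thesis using \<gamma> by simp
  qed
  have color: "{1..k} = insert ((xs ! \<beta>) (w i)) ((xs ! \<beta>) ` R) \<and> (xs ! \<beta>) (w i) \<notin> (xs ! \<beta>) ` R"
    if i: "i \<in> {1..k-1}" for i
  proof -
    have "inj_on (xs ! \<beta>) (insert (w i) R)" using fin(2)[OF e1[OF i] origin\<beta>[OF i]] .
    moreover have "w i \<notin> R" using wR i by auto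
    ultimately show ?thesis using origin\<beta>[OF i] by (auto simp: origin_def)
  qed
  have same: "(xs ! \<beta>) (w 1) = (xs ! \<beta>) (w 2)"
    using color[OF one(1)] color[OF one(2)] by blast
  obtain \<gamma> where \<gamma>: "origin \<gamma> (w ` {1..k})" using E[OF e2] by blast
  have "w ` {1..k-1} \<subseteq> {v \<in> w ` {1..k}. (xs ! \<beta>) v \<noteq> 0}"
    using fin(3)[OF e1 origin\<beta>] by auto
  then have "card (w ` {1..k-1}) \<le> card {v \<in> w ` {1..k}. (xs ! \<beta>) v \<noteq> 0}"
    by (intro card_mono) auto
  moreover have "card (w ` {1..k-1}) = k - 1"
    using card_image[OF inj_on_subset[OF winj]] k by simp
  ultimately have "\<gamma> = \<beta>" using \<gamma> \<beta> unfolding origin_def by (metis not_le)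
  then have "inj_on (xs ! \<beta>) (w ` {1..k})" using fin(2)[OF e2 \<gamma>] by simp
  moreover have "w 1 \<in> w ` {1..k}" "w 2 \<in> w ` {1..k}" using k by auto
  ultimately have "w 1 = w 2" using same inj_onD by metis
  then show False using inj_onD[OF winj, of 1 2] k by simp
qed

section \<open>Random blocks\<close>

locale random_blocks =
  fixes V :: "'a set" and k :: nat and x :: real
  assumes finite_V: "finite V" and k_ge_3: "3 \<le> k" and x_nonneg: "0 \<le> x" and x_le_1: "x \<le> 1"
begin

text \<open>A vertex joins the block with probability x and then receives one of the k colors
  uniformly.\<close>

definition color_weight :: "nat \<Rightarrow> real" where
  "color_weight i = (if i = 0 then 1 - x else x / k)"

definition blocks :: "('a \<Rightarrow> nat) set" where
  "blocks = V \<rightarrow>\<^sub>E {..k}"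

definition block_weight :: "('a \<Rightarrow> nat) \<Rightarrow> real" where
  "block_weight c = (\<Prod>v\<in>V. color_weight (c v))"

definition support :: "'a set \<Rightarrow> ('a \<Rightarrow> nat) \<Rightarrow> 'a set" where
  "support I c = {v \<in> I. c v \<noteq> 0}"

lemma finite_blocks: "finite blocks"
  unfolding blocks_def using finite_V by (intro finite_PiE) auto

lemma color_weight_nonneg: "0 \<le> color_weight i"
  using x_nonneg x_le_1 by (simp add: color_weight_def)

lemma block_weight_nonneg: "0 \<le> block_weight c"
  unfolding block_weight_def using color_weight_nonneg by (intro prod_nonneg) auto

lemma sum_color_weight:
  "(\<Sum>i\<le>k. color_weight i * (if i = 0 then a else b)) = (1 - x) * a + x * b"
proof -
  have "{..k} = insert 0 {1..k}" by auto
  then have "(\<Sum>i\<le>k. color_weight i * (if i = 0 then a else b))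
    = (1 - x) * a + (\<Sum>i\<in>{1..k}. x / k * b)"
    by (simp add: color_weight_def)
  then show ?thesis using k_ge_3 by simp
qed

lemma sum_block_weight_prod:
  "(\<Sum>c\<in>blocks. block_weight c * (\<Prod>v\<in>V. f v (c v))) = (\<Prod>v\<in>V. \<Sum>i\<le>k. color_weight i * f v i)"
  unfolding blocks_def block_weight_def
  using finite_V by (subst prod_sum_PiE) (auto simp: prod.distrib)

lemma sum_block_weight: "(\<Sum>c\<in>blocks. block_weight c) = 1"
  using sum_block_weight_prod[of "\<lambda>_ _. 1"] sum_color_weight[of 1 1] by simp

text \<open>The indicator of \<open>T\<close> lying in the support and the power of \<open>z\<close> are both products over the
  vertices.\<close>

lemma sum_support_weight:
  assumes "T \<subseteq> I" "I \<subseteq> V"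
  shows "(\<Sum>c | c \<in> blocks \<and> T \<subseteq> support I c. block_weight c * z ^ card (support I c))
    = (x * z) ^ card T * (1 + (z - 1) * x) ^ (card I - card T)"
proof -
  define f where "f v i = (if v \<in> I then if i = 0 then if v \<in> T then 0 else 1 else z else 1)"
    for v and i :: nat
  have fin: "finite I" "finite T"
    using finite_subset[OF assms(2) finite_V] finite_subset[OF assms(1)] by simp_all
  have f: "(\<Prod>v\<in>V. f v (c v)) = (if T \<subseteq> support I c then z ^ card (support I c) else 0)" for c
  proof -
    have "(\<Prod>v\<in>V. f v (c v)) = (\<Prod>v\<in>I. f v (c v))"
      using assms finite_V by (intro prod.mono_neutral_right) (auto simp: f_def)
    also have "\<dots> = (if T \<subseteq> support I c then z ^ card (support I c) else 0)"
    proof (cases "T \<subseteq> support I c")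
      case True
      have "(\<Prod>v\<in>I. f v (c v)) = (\<Prod>v\<in>support I c. z)"
        using fin True by (intro prod.mono_neutral_cong_right) (auto simp: f_def support_def)
      then show ?thesis using True by simp
    next
      case False
      then obtain v where "v \<in> T" "c v = 0" using assms by (auto simp: support_def)
      then have "v \<in> I" "f v (c v) = 0" using assms by (auto simp: f_def)
      then have "\<exists>v\<in>I. f v (c v) = 0" by blast
      then show ?thesis using False fin by (simp add: prod_zero_iff)
    qed
    finally show ?thesis .
  qed
  have "(\<Sum>c | c \<in> blocks \<and> T \<subseteq> support I c. block_weight c * z ^ card (support I c))
    = (\<Sum>c\<in>blocks. block_weight c * (\<Prod>v\<in>V. f v (c v)))"
    using finite_blocks by (intro sum.mono_neutral_cong_left) (auto simp: f)
  also have "\<dots> = (\<Prod>v\<in>V. \<Sum>i\<le>k. color_weight i * f v i)" by (rule sum_block_weight_prod)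
  also have "\<dots> = (\<Prod>v\<in>V. if v \<in> T then x * z else if v \<in> I then 1 + (z - 1) * x else 1)"
  proof (rule prod.cong)
    fix v
    have "(\<Sum>i\<le>k. color_weight i * f v i) =
      (\<Sum>i\<le>k. color_weight i * (if i = 0 then (if v \<in> I \<and> v \<in> T then 0 else 1) else if v \<in> I then z else 1))"
      by (intro sum.cong) (auto simp: f_def)
    then show "(\<Sum>i\<le>k. color_weight i * f v i) = (if v \<in> T then x * z else if v \<in> I then 1 + (z - 1) * x else 1)"
      using assms unfolding sum_color_weight by (auto simp: algebra_simps)
  qed simp
  also have "\<dots> = (\<Prod>v\<in>I. if v \<in> T then x * z else 1 + (z - 1) * x)"
    using assms finite_V by (intro prod.mono_neutral_cong_right) auto
  also have "\<dots> = (x * z) ^ card T * (1 + (z - 1) * x) ^ card (I - T)"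
    using assms fin by (subst prod.If_cases) (auto simp: Int_absorb1 Int_absorb2 Diff_eq)
  finally show ?thesis using assms fin by (simp add: card_Diff_subset)
qed

lemma sum_support_superset:
  assumes "T \<subseteq> V"
  shows "(\<Sum>c | c \<in> blocks \<and> T \<subseteq> support V c. block_weight c) = x ^ card T"
  using sum_support_weight[OF assms order.refl, of 1] by simp

text \<open>A union bound over the j-subsets of I that may lie in the support. With z = 1 it bounds
  probabilities, with z = e it bounds exponential moments of the intersection size; j = 0 gives the
  unrestricted moment.\<close>

lemma sum_large_support_le:
  assumes I: "I \<subseteq> V" and z: "1 \<le> z"
  shows "(\<Sum>c | c \<in> blocks \<and> j \<le> card (support I c). block_weight c * z ^ card (support I c))
    \<le> (card I * x * z) ^ j * (1 + (z - 1) * x) ^ card I"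
proof -
  define Ts where "Ts = {T. T \<subseteq> I \<and> card T = j}"
  have fin: "finite I" using I finite_V finite_subset by blast
  have finTs: "finite Ts" using fin by (simp add: Ts_def)
  have w: "0 \<le> block_weight c * z ^ card (support I c)" for c
    using z block_weight_nonneg by simp
  have base: "1 \<le> 1 + (z - 1) * x" using z x_nonneg by simp
  have "(\<Sum>c | c \<in> blocks \<and> j \<le> card (support I c). block_weight c * z ^ card (support I c))
    = (\<Sum>c | c \<in> blocks \<and> (\<exists>T\<in>Ts. T \<subseteq> support I c). block_weight c * z ^ card (support I c))"
  proof (rule sum.cong)
    have "j \<le> card (support I c) \<longleftrightarrow> (\<exists>T\<in>Ts. T \<subseteq> support I c)" for c
    proof
      assume "j \<le> card (support I c)"
      then obtain T where "T \<subseteq> support I c" "card T = j" by (meson obtain_subset_with_card_n)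
      then show "\<exists>T\<in>Ts. T \<subseteq> support I c" by (auto simp: Ts_def support_def)
    next
      assume "\<exists>T\<in>Ts. T \<subseteq> support I c"
      then obtain T where "card T = j" "T \<subseteq> support I c" by (auto simp: Ts_def)
      moreover have "finite (support I c)" using fin by (simp add: support_def)
      ultimately show "j \<le> card (support I c)" using card_mono by blast
    qed
    then show "{c \<in> blocks. j \<le> card (support I c)} = {c \<in> blocks. \<exists>T\<in>Ts. T \<subseteq> support I c}" by simp
  qed simp
  also have "\<dots> \<le> (\<Sum>T\<in>Ts. \<Sum>c | c \<in> blocks \<and> T \<subseteq> support I c. block_weight c * z ^ card (support I c))"
    using finite_blocks finTs w by (intro sum_Bex_le) auto
  also have "\<dots> = (\<Sum>T\<in>Ts. (x * z) ^ j * (1 + (z - 1) * x) ^ (card I - j))"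
    using I by (intro sum.cong refl) (auto simp: Ts_def sum_support_weight)
  also have "\<dots> = card Ts * ((x * z) ^ j * (1 + (z - 1) * x) ^ (card I - j))" by simp
  also have "\<dots> \<le> real (card I) ^ j * ((x * z) ^ j * (1 + (z - 1) * x) ^ card I)"
  proof (rule mult_mono)
    show "(x * z) ^ j * (1 + (z - 1) * x) ^ (card I - j) \<le> (x * z) ^ j * (1 + (z - 1) * x) ^ card I"
      using base x_nonneg z by (intro mult_left_mono power_increasing) auto
    show "real (card Ts) \<le> real (card I) ^ j"
      unfolding Ts_def using card_subsets_le_power[OF fin] by (simp flip: of_nat_power)
  qed (use base x_nonneg z in auto)
  finally show ?thesis by (simp add: power_mult_distrib mult_ac)
qed

text \<open>For a fixed \<open>I\<close>, a candidate block would contribute an edge inside \<open>I\<close>; it is killed if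
  that edge has \<open>k - 1\<close> vertices in another block.\<close>

definition candidate :: "'a set \<Rightarrow> ('a \<Rightarrow> nat) \<Rightarrow> bool" where
  "candidate I c \<longleftrightarrow> card (support I c) = k \<and> c ` support I c = {1..k}"

text \<open>For each k-set T one bijective coloring \<open>\<phi> T\<close> is fixed. The events
  that the block meets I exactly in T with this coloring are disjoint, and dropping the other
  colorings costs only a constant factor depending on k.\<close>

lemma sum_candidate_ge:
  assumes I: "I \<subseteq> V"
  shows "(card I choose k) * ((x / k) ^ k * (1 - x) ^ card I) \<le> (\<Sum>c | c \<in> blocks \<and> candidate I c. block_weight c)"
proof -
  define Ts where "Ts = {T. T \<subseteq> I \<and> card T = k}"
  have fin: "finite I" using I finite_V finite_subset by blast
  have finTs: "finite Ts" using fin by (simp add: Ts_def)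
  have "\<exists>\<phi>. bij_betw \<phi> T {1..k}" if "T \<in> Ts" for T
  proof -
    have "finite T" "card T = card {1..k}" using that fin finite_subset by (auto simp: Ts_def)
    then show ?thesis by (intro finite_same_card_bij) auto
  qed
  then obtain \<phi> where \<phi>: "\<And>T. T \<in> Ts \<Longrightarrow> bij_betw (\<phi> T) T {1..k}" by metis
  define A where "A T = {c \<in> blocks. \<forall>v\<in>I. c v = (if v \<in> T then \<phi> T v else 0)}" for T
  have finA: "finite (A T)" for T using finite_blocks by (simp add: A_def)
  have pos: "\<phi> T v \<noteq> 0 \<and> \<phi> T v \<le> k" if "T \<in> Ts" "v \<in> T" for T v
    using bij_betwE[OF \<phi>[OF that(1)]] that(2) by fastforce
  have supp: "support I c = T" if "c \<in> A T" "T \<in> Ts" for c T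
    using that pos[OF that(2)] by (auto simp: A_def support_def Ts_def split: if_splits)
  have weight: "sum block_weight (A T) = (x / k) ^ k * (1 - x) ^ (card I - k)" if T: "T \<in> Ts" for T
  proof -
    have TI: "T \<subseteq> I" "card T = k" "finite T" using T fin finite_subset by (auto simp: Ts_def)
    define f where "f v i = (if v \<in> I then if i = (if v \<in> T then \<phi> T v else 0) then 1 else 0 else 1 :: real)"
      for v and i :: nat
    have f: "(\<Prod>v\<in>V. f v (c v)) = (if \<forall>v\<in>I. c v = (if v \<in> T then \<phi> T v else 0) then 1 else 0)" for c
    proof (cases "\<forall>v\<in>I. c v = (if v \<in> T then \<phi> T v else 0)")
      case True
      then have "f v (c v) = 1" for v by (simp add: f_def)
      then show ?thesis by (subst if_P[OF True]) simp
    next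
      case False
      then obtain v where v: "v \<in> I" "c v \<noteq> (if v \<in> T then \<phi> T v else 0)" by blast
      then have "f v (c v) = 0" "v \<in> V" using I by (auto simp: f_def)
      then have "(\<Prod>v\<in>V. f v (c v)) = 0" using finite_V by (meson prod_zero)
      then show ?thesis by (subst if_not_P[OF False])
    qed
    have "sum block_weight (A T) = (\<Sum>c\<in>blocks. block_weight c * (\<Prod>v\<in>V. f v (c v)))"
      unfolding f A_def using finite_blocks
      by (subst sum.inter_filter) (auto intro!: sum.cong)
    also have "\<dots> = (\<Prod>v\<in>V. \<Sum>i\<le>k. color_weight i * f v i)" by (rule sum_block_weight_prod)
    also have "\<dots> = (\<Prod>v\<in>V. if v \<in> T then x / k else if v \<in> I then 1 - x else 1)"
    proof (rule prod.cong)
      fix v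
      show "(\<Sum>i\<le>k. color_weight i * f v i) = (if v \<in> T then x / k else if v \<in> I then 1 - x else 1)"
      proof (cases "v \<in> I")
        case True
        define j where "j = (if v \<in> T then \<phi> T v else 0)"
        have "j \<le> k" using pos[OF T] by (simp add: j_def)
        have "(\<Sum>i\<le>k. color_weight i * f v i) = (\<Sum>i\<le>k. if i = j then color_weight i else 0)"
          using True by (intro sum.cong) (auto simp: f_def j_def)
        also have "\<dots> = color_weight j" using \<open>j \<le> k\<close> by simp
        finally show ?thesis
          using True pos[OF T, of v] by (cases "v \<in> T") (auto simp: color_weight_def j_def)
      next
        case False
        then have "(\<Sum>i\<le>k. color_weight i * f v i) = 1"
          using sum_color_weight[of 1 1] by (simp add: f_def)
        then show ?thesis using False TI by auto
      qed
    qed simp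
    also have "\<dots> = (\<Prod>v\<in>I. if v \<in> T then x / k else 1 - x)"
      using I TI finite_V by (intro prod.mono_neutral_cong_right) auto
    also have "\<dots> = (x / k) ^ card T * (1 - x) ^ card (I - T)"
      using fin TI by (subst prod.If_cases) (auto simp: Int_absorb1 Int_absorb2 Diff_eq)
    finally show ?thesis using TI by (simp add: card_Diff_subset)
  qed
  have "(card I choose k) * ((x / k) ^ k * (1 - x) ^ card I) \<le> (card I choose k) * ((x / k) ^ k * (1 - x) ^ (card I - k))"
    using x_nonneg x_le_1 by (intro mult_left_mono power_decreasing) auto
  also have "\<dots> = (\<Sum>T\<in>Ts. sum block_weight (A T))"
    using fin by (simp add: weight) (simp add: Ts_def n_subsets)
  also have "\<dots> = sum block_weight (\<Union>T\<in>Ts. A T)"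
  proof (rule sum.UNION_disjoint[symmetric])
    show "\<forall>T\<in>Ts. \<forall>T'\<in>Ts. T \<noteq> T' \<longrightarrow> A T \<inter> A T' = {}" using supp by blast
  qed (use finTs finA in auto)
  also have "\<dots> \<le> (\<Sum>c | c \<in> blocks \<and> candidate I c. block_weight c)"
  proof (intro sum_mono2)
    show "(\<Union>T\<in>Ts. A T) \<subseteq> {c \<in> blocks. candidate I c}"
    proof
      fix c assume "c \<in> (\<Union>T\<in>Ts. A T)"
      then obtain T where T: "T \<in> Ts" "c \<in> A T" by blast
      have "c ` T = \<phi> T ` T" using T by (intro image_cong) (auto simp: A_def Ts_def)
      then show "c \<in> {c \<in> blocks. candidate I c}"
        using T supp[OF T(2,1)] \<phi>[OF T(1)] by (auto simp: candidate_def A_def Ts_def bij_betw_def)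
    qed
  qed (use finite_blocks block_weight_nonneg in auto)
  finally show ?thesis .
qed

section \<open>Edges lost to other blocks\<close>

definition covered :: "'a set \<Rightarrow> ('a \<Rightarrow> nat) list \<Rightarrow> 'a set set" where
  "covered I xs = {T. T \<subseteq> I \<and> card T = k - 1 \<and> (\<exists>c\<in>set xs. T \<subseteq> support I c)}"

definition killed :: "'a set \<Rightarrow> ('a \<Rightarrow> nat) list \<Rightarrow> ('a \<Rightarrow> nat) \<Rightarrow> bool" where
  "killed I xs c \<longleftrightarrow> k \<le> card (support I c) \<and> (\<exists>T\<in>covered I xs. T \<subseteq> support I c)"

lemma finite_covered: "finite I \<Longrightarrow> finite (covered I xs)"
  by (simp add: covered_def)

text \<open>A killed block contains a covered (k - 1)-set and, having k vertices in I, one more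
  vertex of I. The extra vertex turns x^(k - 1) into x^k: if few of the (k - 1)-sets are covered,
  being killed is rarer than being a candidate.\<close>

lemma sum_killed_le:
  assumes I: "I \<subseteq> V"
  shows "(\<Sum>c | c \<in> blocks \<and> killed I xs c. block_weight c) \<le> card (covered I xs) * card I * x ^ k"
proof -
  have fin: "finite I" using I finite_V finite_subset by blast
  define Idx where "Idx = (SIGMA T:covered I xs. I - T)"
  have finIdx: "finite Idx" unfolding Idx_def using fin finite_covered by auto
  have "{c \<in> blocks. killed I xs c} \<subseteq> {c \<in> blocks. \<exists>i\<in>Idx. insert (snd i) (fst i) \<subseteq> support V c}"
  proof
    fix c assume "c \<in> {c \<in> blocks. killed I xs c}"
    then have c: "c \<in> blocks" "killed I xs c" by auto
    then obtain T where T: "T \<in> covered I xs" "T \<subseteq> support I c" "k \<le> card (support I c)"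
      by (auto simp: killed_def)
    have "finite T" using T fin finite_subset by (auto simp: covered_def)
    then have "\<not> support I c \<subseteq> T"
      using card_mono[of T "support I c"] T k_ge_3 by (auto simp: covered_def)
    then obtain v where v: "v \<in> support I c" "v \<notin> T" by blast
    then have "(T, v) \<in> Idx" using T by (auto simp: Idx_def support_def)
    moreover have "insert v T \<subseteq> support V c" using v T I by (auto simp: support_def)
    ultimately have "\<exists>i\<in>Idx. insert (snd i) (fst i) \<subseteq> support V c"
      by (intro bexI[of _ "(T, v)"]) auto
    then show "c \<in> {c \<in> blocks. \<exists>i\<in>Idx. insert (snd i) (fst i) \<subseteq> support V c}"
      using c by blast
  qed
  then have "(\<Sum>c | c \<in> blocks \<and> killed I xs c. block_weight c)
    \<le> (\<Sum>c | c \<in> blocks \<and> (\<exists>i\<in>Idx. insert (snd i) (fst i) \<subseteq> support V c). block_weight c)"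
    using finite_blocks block_weight_nonneg by (intro sum_mono2) auto
  also have "\<dots> \<le> (\<Sum>i\<in>Idx. \<Sum>c | c \<in> blocks \<and> insert (snd i) (fst i) \<subseteq> support V c. block_weight c)"
    using finite_blocks finIdx block_weight_nonneg by (intro sum_Bex_le) auto
  also have "\<dots> = (\<Sum>i\<in>Idx. x ^ k)"
  proof (rule sum.cong)
    fix i assume "i \<in> Idx"
    then obtain T v where i: "i = (T, v)" "T \<subseteq> I" "card T = k - 1" "v \<in> I" "v \<notin> T"
      by (auto simp: Idx_def covered_def)
    have "finite T" using i fin finite_subset by blast
    then have "card (insert v T) = k" using i k_ge_3 by simp
    moreover have "insert v T \<subseteq> V" using i I by auto
    ultimately show "(\<Sum>c | c \<in> blocks \<and> insert (snd i) (fst i) \<subseteq> support V c. block_weight c) = x ^ k"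
      using sum_support_superset[of "insert v T"] i by simp
  qed simp
  also have "\<dots> = card Idx * x ^ k" by simp
  also have "card Idx \<le> card (covered I xs) * card I"
  proof -
    have "card Idx = (\<Sum>T\<in>covered I xs. card (I - T))"
      unfolding Idx_def using fin finite_covered by simp
    also have "\<dots> \<le> of_nat (card (covered I xs)) * card I"
      using fin by (intro sum_bounded_above card_mono) auto
    finally show ?thesis by simp
  qed
  finally show ?thesis using x_nonneg by (simp add: mult_right_mono flip: of_nat_mult)
qed

definition near_hit :: "'a set \<Rightarrow> ('a \<Rightarrow> nat) \<Rightarrow> real" where
  "near_hit I c = (if k - 1 \<le> card (support I c) then 1 else 0)"

definition overhang :: "'a set \<Rightarrow> ('a \<Rightarrow> nat) \<Rightarrow> real" where
  "overhang I c = (if k \<le> card (support I c) then real (card (support I c)) else 0)"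

text \<open>A block with exactly k - 1 vertices in I covers one set. With a \<ge> k vertices it
  covers at most a^(k - 1) \<le> S^(k - 2) a sets; keeping a single factor a in
  \<open>overhang\<close> leaves an increment with a manageable exponential moment.\<close>

lemma card_covered_le:
  assumes fin: "finite I" and S: "\<And>c. c \<in> set xs \<Longrightarrow> real (card (support I c)) \<le> S"
  shows "real (card (covered I xs)) \<le> (\<Sum>i<length xs. near_hit I (xs ! i)) + S ^ (k - 2) * (\<Sum>i<length xs. overhang I (xs ! i))"
proof -
  define B where "B i = {T. T \<subseteq> support I (xs ! i) \<and> card T = k - 1}" for i
  have finS: "finite (support I c)" for c using fin by (simp add: support_def)
  have "covered I xs \<subseteq> (\<Union>i<length xs. B i)"
  proof
    fix T assume "T \<in> covered I xs"
    then obtain c where "c \<in> set xs" "T \<subseteq> support I c" "card T = k - 1" by (auto simp: covered_def)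
    then show "T \<in> (\<Union>i<length xs. B i)" by (auto simp: B_def in_set_conv_nth)
  qed
  then have "card (covered I xs) \<le> card (\<Union>i<length xs. B i)"
    using finS by (intro card_mono) (auto simp: B_def)
  also have "\<dots> \<le> (\<Sum>i<length xs. card (B i))" by (intro card_UN_le) auto
  finally have "real (card (covered I xs)) \<le> (\<Sum>i<length xs. real (card (B i)))"
    by (simp flip: of_nat_sum)
  also have "\<dots> \<le> (\<Sum>i<length xs. near_hit I (xs ! i) + S ^ (k - 2) * overhang I (xs ! i))"
  proof (rule sum_mono)
    fix i assume "i \<in> {..<length xs}"
    define a where "a = card (support I (xs ! i))"
    have aS: "real a \<le> S" using S \<open>i \<in> {..<length xs}\<close> by (auto simp: a_def)
    have cB: "card (B i) = a choose (k - 1)" unfolding B_def a_def using finS by (rule n_subsets)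
    consider "a < k - 1" | "a = k - 1" | "k \<le> a" using k_ge_3 by linarith
    then show "real (card (B i)) \<le> near_hit I (xs ! i) + S ^ (k - 2) * overhang I (xs ! i)"
    proof cases
      case 1
      then show ?thesis using cB k_ge_3 by (simp add: near_hit_def overhang_def binomial_eq_0 flip: a_def)
    next
      case 2
      then show ?thesis using cB k_ge_3 by (simp add: near_hit_def overhang_def flip: a_def)
    next
      case 3
      have "a choose (k - 1) \<le> a ^ (k - 1)" using 3 by (intro binomial_le_pow) auto
      also have "\<dots> = a ^ (k - 2) * a"
      proof -
        have "k - 1 = Suc (k - 2)" using k_ge_3 by simp
        then show ?thesis by (simp add: mult.commute)
      qed
      finally have "real (card (B i)) \<le> real a ^ (k - 2) * real a"
        unfolding cB by (simp flip: of_nat_power of_nat_mult)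
      also have "\<dots> \<le> S ^ (k - 2) * real a" using aS by (intro mult_right_mono power_mono) auto
      finally show ?thesis using 3 by (simp add: near_hit_def overhang_def flip: a_def)
    qed
  qed
  finally show ?thesis by (simp add: sum.distrib sum_distrib_left)
qed

text \<open>If a candidate at position i yields no edge, some other block j holds k - 1 of its
  vertices. For j < i that block is in the prefix of \<open>xs\<close>; for j > i it is in the
  prefix of \<open>rev xs\<close> before position \<open>length xs - 1 - i\<close>.\<close>

lemma candidates_le_killed:
  assumes I: "I \<subseteq> V" and no_edge: "\<And>e. e \<in> edges (block_graph k V xs) \<Longrightarrow> \<not> e \<subseteq> I"
  shows "card {i. i < length xs \<and> candidate I (xs ! i)}
    \<le> card {i. i < length xs \<and> killed I (take i xs) (xs ! i)}
      + card {i. i < length xs \<and> killed I (take i (rev xs)) (rev xs ! i)}"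
    (is "card ?C \<le> card ?A + card ?B")
proof -
  let ?b = "length xs"
  have "?C \<subseteq> ?A \<union> (\<lambda>i. ?b - 1 - i) ` ?B"
  proof
    fix i assume "i \<in> ?C"
    then have i: "i < ?b" "candidate I (xs ! i)" by auto
    define e where "e = support I (xs ! i)"
    have e: "e \<subseteq> I" "card e = k" "(xs ! i) ` e = {1..k}"
      using i by (auto simp: e_def candidate_def support_def)
    have "e \<notin> edges (block_graph k V xs)" using no_edge e by blast
    then have "\<not> (\<forall>j<?b. j \<noteq> i \<longrightarrow> card {v \<in> e. (xs ! j) v \<noteq> 0} < k - 1)"
      using e I i(1) unfolding block_graph_def snd_conv mem_Collect_eq by blast
    then obtain j where j: "j < ?b" "j \<noteq> i" "k - 1 \<le> card {v \<in> e. (xs ! j) v \<noteq> 0}"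
      by (meson not_le)
    obtain T where T: "T \<subseteq> {v \<in> e. (xs ! j) v \<noteq> 0}" "card T = k - 1"
      using obtain_subset_with_card_n[OF j(3)] by metis
    have Tj: "T \<subseteq> support I (xs ! j)" "T \<subseteq> e" "T \<subseteq> I" using T e by (auto simp: support_def)
    show "i \<in> ?A \<union> (\<lambda>i. ?b - 1 - i) ` ?B"
    proof (cases "j < i")
      case True
      then have "xs ! j \<in> set (take i xs)"
        using i by (auto simp: in_set_conv_nth intro!: exI[of _ j])
      then have "T \<in> covered I (take i xs)" using T Tj by (auto simp: covered_def)
      then have "killed I (take i xs) (xs ! i)" using Tj e by (auto simp: killed_def e_def)
      then show ?thesis using i by blast
    next
      case False
      define i' where "i' = ?b - 1 - i"
      have i': "i' < ?b" "?b - 1 - i' = i" using i by (auto simp: i'_def)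
      have "take i' (rev xs) = rev (drop (Suc i) xs)"
        using i by (simp add: take_rev i'_def)
      moreover have "xs ! j \<in> set (drop (Suc i) xs)"
        using False j i by (auto simp: in_set_conv_nth intro!: exI[of _ "j - Suc i"])
      ultimately have "xs ! j \<in> set (take i' (rev xs))" by simp
      then have "T \<in> covered I (take i' (rev xs))" using T Tj by (auto simp: covered_def)
      moreover have "rev xs ! i' = xs ! i" using i' i by (simp add: rev_nth)
      ultimately have "killed I (take i' (rev xs)) (rev xs ! i')" using Tj e by (auto simp: killed_def e_def)
      then show ?thesis using i' by (intro UnI2 image_eqI[of _ _ i']) auto
    qed
  qed
  then have "card ?C \<le> card (?A \<union> (\<lambda>i. ?b - 1 - i) ` ?B)" by (intro card_mono) auto
  also have "\<dots> \<le> card ?A + card ((\<lambda>i. ?b - 1 - i) ` ?B)" by (rule card_Un_le)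
  also have "\<dots> \<le> card ?A + card ?B" by (intro add_left_mono card_image_le) auto
  finally show ?thesis .
qed

section \<open>Tail bounds for lists of random blocks\<close>

lemma sum_block_weight_indicator:
  "(\<Sum>c\<in>blocks. block_weight c * (1 + (if Q c then f c else 0)))
    = 1 + (\<Sum>c | c \<in> blocks \<and> Q c. block_weight c * f c)"
proof -
  have "(\<Sum>c\<in>blocks. block_weight c * (1 + (if Q c then f c else 0)))
    = (\<Sum>c\<in>blocks. block_weight c) + (\<Sum>c\<in>blocks. if Q c then block_weight c * f c else 0)"
    unfolding sum.distrib[symmetric] by (intro sum.cong) (auto simp: algebra_simps)
  then show ?thesis using finite_blocks by (simp add: sum_block_weight sum.inter_filter)
qed

definition list_prob :: "nat \<Rightarrow> (('a \<Rightarrow> nat) list \<Rightarrow> bool) \<Rightarrow> real" where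
  "list_prob b Q = (\<Sum>xs | xs \<in> lists_of_length blocks b \<and> Q xs. list_weight block_weight xs)"

text \<open>Off the event \<open>Q\<close> the increment is at most 0. So the conditional mean of
  exp h exceeds 1 by at most the weighted mass of \<open>Q\<close>, which is all that has to be
  estimated in each application.\<close>

lemma list_prob_tail:
  fixes h :: "('a \<Rightarrow> nat) list \<Rightarrow> ('a \<Rightarrow> nat) \<Rightarrow> real"
  assumes h: "\<And>ys c. exp (h ys c) \<le> 1 + (if Q ys c then f c else 0)"
    and a: "\<And>ys. (\<Sum>c | c \<in> blocks \<and> Q ys c. block_weight c * f c) \<le> a"
  shows "list_prob b (\<lambda>xs. t \<le> (\<Sum>i<b. h (take i xs) (xs ! i))) \<le> exp (real b * a - t)"
  unfolding list_prob_def
proof (rule list_weight_tail[OF finite_blocks])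
  fix ys
  have "(\<Sum>c\<in>blocks. block_weight c * exp (h ys c)) \<le> (\<Sum>c\<in>blocks. block_weight c * (1 + (if Q ys c then f c else 0)))"
    using h block_weight_nonneg by (intro sum_mono mult_left_mono) auto
  then show "(\<Sum>c\<in>blocks. block_weight c * exp (h ys c)) \<le> 1 + a"
    using a[of ys] unfolding sum_block_weight_indicator by simp
qed (rule block_weight_nonneg)

lemma prob_near_hit:
  assumes I: "I \<subseteq> V"
  shows "list_prob b (\<lambda>xs. t \<le> (\<Sum>i<b. near_hit I (xs ! i))) \<le> exp (real b * (2 * (card I * x) ^ (k - 1)) - t)"
proof (rule list_prob_tail[where Q = "\<lambda>_ c. k - 1 \<le> card (support I c)" and f = "\<lambda>_. 2"])
  show "(\<Sum>c | c \<in> blocks \<and> k - 1 \<le> card (support I c). block_weight c * 2) \<le> 2 * (card I * x) ^ (k - 1)"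
    using sum_large_support_le[OF I, of 1 "k - 1"] by (simp flip: sum_distrib_right)
qed (use exp_le in \<open>auto simp: near_hit_def\<close>)

lemma one_add_power_le_exp: "0 \<le> z \<Longrightarrow> (1 + z) ^ n \<le> exp (real n * z)" for z :: real
  using exp_ge_add_one_self[of z] power_mono[of "1 + z" "exp z" n] by (simp add: exp_of_nat_mult)

lemma prob_overhang:
  assumes I: "I \<subseteq> V"
  shows "list_prob b (\<lambda>xs. t \<le> (\<Sum>i<b. overhang I (xs ! i)))
    \<le> exp (real b * ((3 * card I * x) ^ k * exp (2 * card I * x)) - t)"
proof (rule list_prob_tail[where Q = "\<lambda>_ c. k \<le> card (support I c)" and f = "\<lambda>c. exp 1 ^ card (support I c)"])
  show "exp (overhang I c) \<le> 1 + (if k \<le> card (support I c) then exp 1 ^ card (support I c) else 0)" for c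
    by (simp add: overhang_def flip: exp_of_nat_mult)
  have "(\<Sum>c | c \<in> blocks \<and> k \<le> card (support I c). block_weight c * exp 1 ^ card (support I c))
    \<le> (card I * x * exp 1) ^ k * (1 + (exp 1 - 1) * x) ^ card I"
    by (rule sum_large_support_le[OF I]) simp
  also have "\<dots> \<le> (3 * card I * x) ^ k * exp (real (card I) * (2 * x))"
  proof (rule mult_mono, rule power_mono)
    show "card I * x * exp 1 \<le> 3 * card I * x"
      using mult_left_mono[OF exp_le, of "card I * x"] x_nonneg by (simp add: mult_ac)
    have "(1 + (exp 1 - 1) * x) ^ card I \<le> (1 + 2 * x) ^ card I"
      using exp_le x_nonneg by (intro power_mono add_mono mult_right_mono) auto
    also have "\<dots> \<le> exp (real (card I) * (2 * x))" using x_nonneg by (intro one_add_power_le_exp) auto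
    finally show "(1 + (exp 1 - 1) * x) ^ card I \<le> exp (real (card I) * (2 * x))" .
  qed (use x_nonneg in auto)
  finally show "(\<Sum>c | c \<in> blocks \<and> k \<le> card (support I c). block_weight c * exp 1 ^ card (support I c))
    \<le> (3 * card I * x) ^ k * exp (2 * card I * x)" by (simp add: mult_ac)
qed

text \<open>A lower tail, written as the upper tail of the negated count; exp (-1) \<le> 1 - 1 / 2
  yields the factor -1 / 2.\<close>

lemma prob_candidates:
  assumes I: "I \<subseteq> V"
  shows "list_prob b (\<lambda>xs. - t \<le> (\<Sum>i<b. - (if candidate I (xs ! i) then 1 else 0)))
    \<le> exp (t - real b * ((card I choose k) * ((x / k) ^ k * (1 - x) ^ card I) / 2))"
proof -
  let ?p = "(card I choose k) * ((x / k) ^ k * (1 - x) ^ card I)"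
  have "exp (1::real) \<ge> 2" using exp_ge_add_one_self[of 1] by simp
  then have "exp (- 1::real) \<le> 1 / 2" by (simp add: exp_minus field_simps)
  then have "list_prob b (\<lambda>xs. - t \<le> (\<Sum>i<b. - (if candidate I (xs ! i) then 1 else 0)))
    \<le> exp (real b * (- ?p / 2) - (- t))"
    using sum_candidate_ge[OF I]
    by (intro list_prob_tail[where Q = "\<lambda>_. candidate I" and f = "\<lambda>_. - 1 / 2"])
      (auto simp: sum_negf simp flip: sum_divide_distrib)
  then show ?thesis by (simp add: algebra_simps)
qed

text \<open>The covered sets are determined by the past, so truncating at \<tau> inside the event
  keeps every conditional probability below \<tau> |I| x^k. The 8 comes from exp 2 \<le> 1 + 8;
  increments are doubled to gain a larger multiple of t in the exponent.\<close>

lemma prob_killed: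
  fixes \<tau> t :: real
  assumes I: "I \<subseteq> V" and \<tau>: "0 \<le> \<tau>"
  shows "list_prob b (\<lambda>xs. 2 * t \<le> (\<Sum>i<b. 2 * (if killed I (take i xs) (xs ! i) \<and> card (covered I (take i xs)) \<le> \<tau> then 1 else 0)))
    \<le> exp (real b * (8 * (\<tau> * card I * x ^ k)) - 2 * t)"
proof (rule list_prob_tail[where Q = "\<lambda>ys c. killed I ys c \<and> card (covered I ys) \<le> \<tau>" and f = "\<lambda>_. 8"])
  fix ys
  show "(\<Sum>c | c \<in> blocks \<and> killed I ys c \<and> card (covered I ys) \<le> \<tau>. block_weight c * 8) \<le> 8 * (\<tau> * card I * x ^ k)"
  proof (cases "card (covered I ys) \<le> \<tau>")
    case True
    have "(\<Sum>c | c \<in> blocks \<and> killed I ys c. block_weight c) \<le> card (covered I ys) * card I * x ^ k"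
      using sum_killed_le[OF I] by simp
    also have "\<dots> \<le> \<tau> * card I * x ^ k" using True x_nonneg by (auto intro!: mult_right_mono)
    finally show ?thesis using True by (simp flip: sum_distrib_right)
  qed (use \<tau> x_nonneg in simp)
qed (use exp_2_le_9 in auto)

text \<open>A Chernoff bound for the size of one block. A single block with more than S vertices
  already makes the sum reach 2.\<close>

lemma prob_support:
  fixes S :: real
  shows "list_prob b (\<lambda>xs. (2::real) \<le> (\<Sum>i<b. 2 * (if S < card (support V (xs ! i)) then 1 else 0)))
    \<le> exp (real b * (8 * exp (2 * card V * x - S)) - 2)"
proof (rule list_prob_tail[where Q = "\<lambda>_ c. S < card (support V c)" and f = "\<lambda>_. 8"])
  have "(\<Sum>c | c \<in> blocks \<and> S < card (support V c). block_weight c)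
    \<le> (\<Sum>c | c \<in> blocks \<and> S < card (support V c). block_weight c * exp (card (support V c) - S))"
  proof (rule sum_mono)
    fix c assume "c \<in> {c \<in> blocks. S < card (support V c)}"
    then have "block_weight c * 1 \<le> block_weight c * exp (card (support V c) - S)"
      using block_weight_nonneg by (intro mult_left_mono) auto
    then show "block_weight c \<le> block_weight c * exp (card (support V c) - S)" by simp
  qed
  also have "\<dots> \<le> (\<Sum>c | c \<in> blocks \<and> 0 \<le> card (support V c). block_weight c * exp (card (support V c) - S))"
    using finite_blocks block_weight_nonneg by (intro sum_mono2) auto
  also have "\<dots> = exp (- S) * (\<Sum>c | c \<in> blocks \<and> 0 \<le> card (support V c). block_weight c * exp 1 ^ card (support V c))"
    unfolding sum_distrib_left
    by (intro sum.cong refl) (simp add: exp_diff exp_minus field_simps flip: exp_of_nat_mult)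
  also have "\<dots> \<le> exp (- S) * ((card V * x * exp 1) ^ 0 * (1 + (exp 1 - 1) * x) ^ card V)"
    by (intro mult_left_mono sum_large_support_le) auto
  also have "\<dots> \<le> exp (- S) * exp (real (card V) * (2 * x))"
  proof (intro mult_left_mono)
    have "(1 + (exp 1 - 1) * x) ^ card V \<le> (1 + 2 * x) ^ card V"
      using exp_le x_nonneg by (intro power_mono add_mono mult_right_mono) auto
    also have "\<dots> \<le> exp (real (card V) * (2 * x))" using x_nonneg by (intro one_add_power_le_exp) auto
    finally show "(card V * x * exp 1) ^ 0 * (1 + (exp 1 - 1) * x) ^ card V \<le> exp (real (card V) * (2 * x))" by simp
  qed auto
  also have "\<dots> = exp (2 * card V * x - S)" by (simp add: exp_diff exp_minus field_simps)
  finally show "(\<Sum>c | c \<in> blocks \<and> S < card (support V c). block_weight c * 8) \<le> 8 * exp (2 * card V * x - S)"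
    by (simp flip: sum_distrib_right)
qed (use exp_2_le_9 in auto)

lemma list_prob_mono:
  assumes "\<And>xs. xs \<in> lists_of_length blocks b \<Longrightarrow> Q xs \<Longrightarrow> R xs"
  shows "list_prob b Q \<le> list_prob b R"
  unfolding list_prob_def
  using assms finite_lists_of_length[OF finite_blocks] list_weight_nonneg[of blocks block_weight] block_weight_nonneg
  by (intro sum_mono2) auto

lemma list_prob_disj: "list_prob b (\<lambda>xs. Q xs \<or> R xs) \<le> list_prob b Q + list_prob b R"
proof -
  have "{xs. xs \<in> lists_of_length blocks b \<and> (Q xs \<or> R xs)} =
    {xs. xs \<in> lists_of_length blocks b \<and> Q xs} \<union> {xs. xs \<in> lists_of_length blocks b \<and> R xs}" by auto
  then show ?thesis
    unfolding list_prob_def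
    using finite_lists_of_length[OF finite_blocks] list_weight_nonneg[of blocks block_weight] block_weight_nonneg
    by (auto intro!: sum_Un_le)
qed

lemma list_prob_Bex:
  "finite J \<Longrightarrow> list_prob b (\<lambda>xs. \<exists>i\<in>J. Q i xs) \<le> (\<Sum>i\<in>J. list_prob b (Q i))"
  unfolding list_prob_def
  using finite_lists_of_length[OF finite_blocks] list_weight_nonneg[of blocks block_weight] block_weight_nonneg
  by (intro sum_Bex_le) auto

lemma list_prob_True: "list_prob b (\<lambda>_. True) = 1"
  using sum_list_weight[OF finite_blocks sum_block_weight] by (simp add: list_prob_def)

lemma list_prob_rev: "list_prob b (\<lambda>xs. Q (rev xs)) = list_prob b Q"
  unfolding list_prob_def by (rule sum_list_weight_rev[OF finite_blocks])

abbreviation bad_killed :: "nat \<Rightarrow> real \<Rightarrow> real \<Rightarrow> 'a set \<Rightarrow> ('a \<Rightarrow> nat) list \<Rightarrow> bool" where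
  "bad_killed b \<tau> m I xs \<equiv> 2 * m \<le> (\<Sum>i<b. 2 * (if killed I (take i xs) (xs ! i) \<and> real (card (covered I (take i xs))) \<le> \<tau> then 1 else 0))"

text \<open>If the first two events fail, at most \<tau> sets are covered by all of
  \<open>xs\<close>, hence by any prefix in either direction, and the truncation in
  \<open>bad_killed\<close> has no effect. If the others fail too, there are more than 2 m
  candidates but fewer than m killed blocks from each end, contradicting
  \<open>candidates_le_killed\<close>.\<close>

lemma independent_imp_bad:
  fixes S t y m \<tau> :: real
  assumes I: "I \<subseteq> V" and xs: "length xs = b"
    and no_edge: "\<And>e. e \<in> edges (block_graph k V xs) \<Longrightarrow> \<not> e \<subseteq> I"
    and supp: "\<And>c. c \<in> set xs \<Longrightarrow> real (card (support V c)) \<le> S"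
    and S: "0 \<le> S" and \<tau>: "t + S ^ (k - 2) * y \<le> \<tau>"
  shows "t \<le> (\<Sum>i<b. near_hit I (xs ! i)) \<or> y \<le> (\<Sum>i<b. overhang I (xs ! i)) \<or>
    - (2 * m) \<le> (\<Sum>i<b. - (if candidate I (xs ! i) then 1 else 0)) \<or>
    bad_killed b \<tau> m I xs \<or> bad_killed b \<tau> m I (rev xs)"
proof (rule ccontr)
  assume contra: "\<not> ?thesis"
  have fin: "finite I" using I finite_V finite_subset by blast
  have sum_eq: "(\<Sum>i<b. if P i then 1 else 0) = real (card {i. i < b \<and> P i})" for P
    by (simp add: sum.If_cases Int_def)
  have "card (support I c) \<le> card (support V c)" for c
    using I finite_V by (intro card_mono) (auto simp: support_def)
  then have supp': "real (card (support I c)) \<le> S" if "c \<in> set xs" for c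
    using supp[OF that] by (meson of_nat_mono order.trans)
  have "real (card (covered I xs)) \<le> (\<Sum>i<b. near_hit I (xs ! i)) + S ^ (k - 2) * (\<Sum>i<b. overhang I (xs ! i))"
    using card_covered_le[OF fin, of xs S] supp' xs by simp
  also have "\<dots> \<le> t + S ^ (k - 2) * y"
    using contra S by (intro add_mono mult_left_mono) auto
  finally have cov: "real (card (covered I xs)) \<le> \<tau>" using \<tau> by simp
  have trunc: "real (card (covered I ys)) \<le> \<tau>" if "set ys \<subseteq> set xs" for ys
  proof -
    have "covered I ys \<subseteq> covered I xs" using that by (auto simp: covered_def)
    then have "card (covered I ys) \<le> card (covered I xs)" using fin finite_covered by (intro card_mono) auto
    then show ?thesis using cov by linarith
  qed
  have K1: "real (card {i. i < b \<and> killed I (take i xs) (xs ! i)}) < m"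
  proof -
    have "(\<Sum>i<b. 2 * (if killed I (take i xs) (xs ! i) \<and> real (card (covered I (take i xs))) \<le> \<tau> then 1 else 0 :: real))
      = 2 * (\<Sum>i<b. if killed I (take i xs) (xs ! i) then 1 else 0)"
      unfolding sum_distrib_left using trunc[OF set_take_subset] by (intro sum.cong) auto
    then show ?thesis using contra unfolding sum_eq by linarith
  qed
  have K2: "real (card {i. i < b \<and> killed I (take i (rev xs)) (rev xs ! i)}) < m"
  proof -
    have "set (take i (rev xs)) \<subseteq> set xs" for i using set_take_subset[of i "rev xs"] by simp
    then have "(\<Sum>i<b. 2 * (if killed I (take i (rev xs)) (rev xs ! i) \<and> real (card (covered I (take i (rev xs)))) \<le> \<tau> then 1 else 0 :: real))
      = 2 * (\<Sum>i<b. if killed I (take i (rev xs)) (rev xs ! i) then 1 else 0)"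
      unfolding sum_distrib_left using trunc by (intro sum.cong) auto
    then show ?thesis using contra unfolding sum_eq by linarith
  qed
  have X: "2 * m < real (card {i. i < b \<and> candidate I (xs ! i)})"
  proof -
    have "(\<Sum>i<b. - (if candidate I (xs ! i) then 1 else 0 :: real)) = - real (card {i. i < b \<and> candidate I (xs ! i)})"
      unfolding sum_negf sum_eq ..
    then show ?thesis using contra by linarith
  qed
  have "card {i. i < b \<and> candidate I (xs ! i)}
    \<le> card {i. i < b \<and> killed I (take i xs) (xs ! i)} + card {i. i < b \<and> killed I (take i (rev xs)) (rev xs ! i)}"
    using candidates_le_killed[OF I, of xs] no_edge xs by simp
  then show False using K1 K2 X by linarith
qed

text \<open>The cap on block sizes does not depend on I, so its failure is paid for once, outside
  the factor N^n of the union bound. The factor 2 counts the two directions of reading the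
  list.\<close>

lemma exists_blocks:
  fixes S t y m \<tau> :: real and n b :: nat
  assumes S: "0 \<le> S" and \<tau>: "t + S ^ (k - 2) * y \<le> \<tau>" "0 \<le> \<tau>"
    and small: "real (card V) ^ n * (exp (b * (2 * (n * x) ^ (k - 1)) - t)
        + exp (b * ((3 * n * x) ^ k * exp (2 * n * x)) - y)
        + exp (2 * m - b * ((n choose k) * ((x / k) ^ k * (1 - x) ^ n) / 2))
        + 2 * exp (b * (8 * (\<tau> * n * x ^ k)) - 2 * m))
      + exp (b * (8 * exp (2 * card V * x - S)) - 2) < 1"
  shows "\<exists>xs. \<forall>I. I \<subseteq> V \<and> card I = n \<longrightarrow> (\<exists>e\<in>edges (block_graph k V xs). e \<subseteq> I)"
proof (rule ccontr)
  assume contra: "\<not> ?thesis"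
  define Is where "Is = {I. I \<subseteq> V \<and> card I = n}"
  have finIs: "finite Is" using finite_V by (simp add: Is_def)
  define T1 where "T1 = exp (b * (2 * (n * x) ^ (k - 1)) - t)"
  define T2 where "T2 = exp (b * ((3 * n * x) ^ k * exp (2 * n * x)) - y)"
  define T3 where "T3 = exp (2 * m - b * ((n choose k) * ((x / k) ^ k * (1 - x) ^ n) / 2))"
  define T4 where "T4 = exp (b * (8 * (\<tau> * n * x ^ k)) - 2 * m)"
  define bad where "bad I xs \<longleftrightarrow> t \<le> (\<Sum>i<b. near_hit I (xs ! i)) \<or> y \<le> (\<Sum>i<b. overhang I (xs ! i)) \<or>
    - (2 * m) \<le> (\<Sum>i<b. - (if candidate I (xs ! i) then 1 else 0 :: real)) \<or>
    bad_killed b \<tau> m I xs \<or> bad_killed b \<tau> m I (rev xs)" for I xs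
  define big where "big xs \<longleftrightarrow> (2::real) \<le> (\<Sum>i<b. 2 * (if S < card (support V (xs ! i)) then 1 else 0))" for xs
  have "list_prob b (\<lambda>_. True) \<le> list_prob b (\<lambda>xs. (\<exists>I\<in>Is. bad I xs) \<or> big xs)"
  proof (rule list_prob_mono)
    fix xs assume xs: "xs \<in> lists_of_length blocks b"
    then have len: "length xs = b" by (simp add: lists_of_length_def)
    show "(\<exists>I\<in>Is. bad I xs) \<or> big xs"
    proof (cases "\<exists>c\<in>set xs. S < card (support V c)")
      case True
      then obtain j where j: "j < b" "S < card (support V (xs ! j))"
        using len by (auto simp: in_set_conv_nth)
      then have "2 * (if S < card (support V (xs ! j)) then 1 else 0 :: real)
        \<le> (\<Sum>i<b. 2 * (if S < card (support V (xs ! i)) then 1 else 0))"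
        by (intro member_le_sum) auto
      then show ?thesis using j by (simp add: big_def)
    next
      case False
      obtain I where I: "I \<subseteq> V" "card I = n" "\<not> (\<exists>e\<in>edges (block_graph k V xs). e \<subseteq> I)"
        using contra by blast
      have "bad I xs" unfolding bad_def
        using I False by (intro independent_imp_bad[OF I(1) len _ _ S \<tau>(1)]) (auto simp: not_less)
      then show ?thesis using I by (auto simp: Is_def)
    qed
  qed
  then have "1 \<le> list_prob b (\<lambda>xs. \<exists>I\<in>Is. bad I xs) + list_prob b big"
    using list_prob_disj[of b "\<lambda>xs. \<exists>I\<in>Is. bad I xs" big] by (simp add: list_prob_True)
  also have "list_prob b (\<lambda>xs. \<exists>I\<in>Is. bad I xs) \<le> (\<Sum>I\<in>Is. list_prob b (bad I))"
    by (rule list_prob_Bex[OF finIs])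
  also have "\<dots> \<le> (\<Sum>I\<in>Is. T1 + T2 + T3 + 2 * T4)"
  proof (rule sum_mono)
    fix I assume "I \<in> Is"
    then have I: "I \<subseteq> V" "card I = n" by (auto simp: Is_def)
    have "list_prob b (bad I) \<le> list_prob b (\<lambda>xs. t \<le> (\<Sum>i<b. near_hit I (xs ! i)))
      + (list_prob b (\<lambda>xs. y \<le> (\<Sum>i<b. overhang I (xs ! i)))
      + (list_prob b (\<lambda>xs. - (2 * m) \<le> (\<Sum>i<b. - (if candidate I (xs ! i) then 1 else 0)))
      + (list_prob b (bad_killed b \<tau> m I) + list_prob b (\<lambda>xs. bad_killed b \<tau> m I (rev xs)))))"
      unfolding bad_def
      by (intro order.trans[OF list_prob_disj] add_left_mono order.refl)
    moreover have "list_prob b (\<lambda>xs. bad_killed b \<tau> m I (rev xs)) = list_prob b (bad_killed b \<tau> m I)"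
      by (rule list_prob_rev)
    ultimately show "list_prob b (bad I) \<le> T1 + T2 + T3 + 2 * T4"
      using prob_near_hit[OF I(1), of b t] prob_overhang[OF I(1), of b y] prob_candidates[OF I(1), of b "2 * m"]
        prob_killed[OF I(1) \<tau>(2), of b m]
      unfolding I(2) T1_def T2_def T3_def T4_def by linarith
  qed
  also have "\<dots> = card Is * (T1 + T2 + T3 + 2 * T4)" by simp
  also have "\<dots> \<le> real (card V) ^ n * (T1 + T2 + T3 + 2 * T4)"
  proof (rule mult_right_mono)
    show "real (card Is) \<le> real (card V) ^ n"
      unfolding Is_def using card_subsets_le_power[OF finite_V] by (simp flip: of_nat_power)
    show "0 \<le> T1 + T2 + T3 + 2 * T4" by (simp add: T1_def T2_def T3_def T4_def add_nonneg_nonneg)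
  qed
  also have "list_prob b big \<le> exp (b * (8 * exp (2 * card V * x - S)) - 2)"
    using prob_support[of b S] unfolding big_def by simp
  finally show False using small by (simp add: T1_def T2_def T3_def T4_def)
qed

end

section \<open>Parameters for the lower bound\<close>

lemma nat_floor_bounds:
  fixes z :: real
  assumes "z \<ge> 1"
  shows "real (nat \<lfloor>z\<rfloor>) \<le> z" "z / 2 \<le> real (nat \<lfloor>z\<rfloor>)"
proof -
  have "1 \<le> \<lfloor>z\<rfloor>" using assms by simp
  then have eq: "real (nat \<lfloor>z\<rfloor>) = of_int \<lfloor>z\<rfloor>" and "1 \<le> real_of_int \<lfloor>z\<rfloor>" by simp_all
  show "real (nat \<lfloor>z\<rfloor>) \<le> z" unfolding eq by (rule of_int_floor_le)
  have "z < real_of_int \<lfloor>z\<rfloor> + 1" by linarith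
  then show "z / 2 \<le> real (nat \<lfloor>z\<rfloor>)" unfolding eq using \<open>1 \<le> real_of_int \<lfloor>z\<rfloor>\<close> by linarith
qed

lemma lower_asymptotics:
  fixes k :: nat
  assumes k: "k \<ge> 3"
  shows "\<forall>\<^sub>F n in sequentially. \<exists>x::real. \<exists>b::nat. \<exists>S t y m \<tau> :: real. \<exists>N::nat.
    N = nat \<lfloor>real n ^ k / ln n ^ 4\<rfloor> \<and>
    0 \<le> x \<and> x \<le> 1 \<and> 0 \<le> S \<and> 0 \<le> \<tau> \<and> t + S ^ (k - 2) * y \<le> \<tau> \<and>
    real N ^ n * (exp (b * (2 * (n * x) ^ (k - 1)) - t)
        + exp (b * ((3 * n * x) ^ k * exp (2 * n * x)) - y)
        + exp (2 * m - b * ((n choose k) * ((x / k) ^ k * (1 - x) ^ n) / 2))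
        + 2 * exp (b * (8 * (\<tau> * n * x ^ k)) - 2 * m))
      + exp (b * (8 * exp (2 * N * x - S)) - 2) < 1"
proof -
  \<comment> \<open>\<kappa> (n x)^k bounds the probability of a candidate from below: (n / k)^k for
    the binomial coefficient, (x / k)^k for the colors and 1 / 2 for (1 - x)^n.\<close>
  define \<kappa> :: real where "\<kappa> = 1 / (2 * real k ^ (2 * k))"
  \<comment> \<open>Chosen so that 8 \<rho> = \<kappa> / 64, the factor of P in \<tau>: the covered
    sets number at most 4 \<rho> P from near hits and 2 \<rho> P from overhangs.\<close>
  define \<rho> where "\<rho> = \<kappa> / 512"
  \<comment> \<open>The number b of blocks is at most P^(k - 1) = n^\<alpha>, which the tail for
    block sizes has to beat.\<close>
  define \<alpha> where "\<alpha> = real ((k - 1) * (k - 1))"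
  have kk: "real k ^ (2 * k) \<ge> 1" using k by (intro one_le_power) auto
  have \<kappa>: "0 < \<kappa>" "\<kappa> \<le> 1"
  proof -
    have "1 \<le> 2 * real k ^ (2 * k)" using kk by linarith
    moreover from this have "0 < 2 * real k ^ (2 * k)" by linarith
    ultimately show "0 < \<kappa>" "\<kappa> \<le> 1" by (simp_all add: \<kappa>_def divide_le_eq_1_pos del: zero_less_mult_iff)
  qed
  have \<rho>: "0 < \<rho>" "\<rho> \<le> 1" using \<kappa> by (auto simp: \<rho>_def)
  have \<alpha>: "0 < \<alpha>" using k by (auto simp: \<alpha>_def)
  have e1: "\<forall>\<^sub>F n::nat in sequentially. 16 * (real k + 5) / (\<kappa> * \<rho>) \<le> sqrt (ln n)"
  proof -
    have "filterlim (\<lambda>n::nat. sqrt (ln n)) at_top sequentially" by real_asymp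
    then show ?thesis by (simp add: filterlim_at_top)
  qed
  have e2: "\<forall>\<^sub>F n::nat in sequentially. (real k + 5) / (2 * \<rho>) \<le> real n / ln n"
  proof -
    have "filterlim (\<lambda>n::nat. real n / ln n) at_top sequentially" by real_asymp
    then show ?thesis by (simp add: filterlim_at_top)
  qed
  have e3: "\<forall>\<^sub>F n::nat in sequentially. 3 ^ (2 * k) \<le> ln n"
  proof -
    have "filterlim (\<lambda>n::nat. ln n) at_top sequentially" by real_asymp
    then show ?thesis by (simp add: filterlim_at_top)
  qed
  have e4: "\<forall>\<^sub>F n::nat in sequentially. sqrt (ln n) ^ 3 / n < \<rho> / 2"
  proof -
    have "(\<lambda>n::nat. sqrt (ln n) ^ 3 / n) \<longlonglongrightarrow> 0" by real_asymp
    then show ?thesis by (rule order_tendstoD) (use \<rho> in simp)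
  qed
  have e5: "\<forall>\<^sub>F n::nat in sequentially. n powr \<alpha> * exp (- (n / sqrt (ln n) ^ 5)) < 1 / 16"
  proof -
    have "(\<lambda>n::nat. n powr \<alpha> * exp (- (n / sqrt (ln n) ^ 5))) \<longlonglongrightarrow> 0" using \<alpha> by real_asymp
    then show ?thesis by (rule order_tendstoD) simp
  qed
  have e6: "\<forall>\<^sub>F n::nat in sequentially. k \<le> n" by (rule eventually_ge_at_top)
  show ?thesis
    using e1 e2 e3 e4 e5 e6
  proof eventually_elim
    case (elim n)
    define l where "l = sqrt (ln (real n))"
    have n: "real n \<ge> 3" "real n > 0" "real n \<ge> 1" using elim k by auto
    have lln: "ln (real n) \<ge> 1"
      using n by (intro ln_ge_1) auto
    then have l: "l \<ge> 1" "l > 0" "l ^ 2 = ln n" by (auto simp: l_def)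
    have l8: "l ^ 8 = ln n ^ 4" using l(3) by (simp flip: l(3) power_mult)
    define P where "P = real n ^ (k - 1)"
    \<comment> \<open>The cube is needed against the union bound: \<mu> becomes of order n l^3, a
      factor l above its exponent W = k n l^2, and this l absorbs all constants.\<close>
    define x where "x = l ^ 3 / P"
    have nP: "real n * real n \<le> P"
    proof -
      have "real n ^ 2 \<le> real n ^ (k - 1)" using n k by (intro power_increasing) auto
      then show ?thesis by (simp add: P_def power2_eq_square)
    qed
    have P: "P > 0" using n by (simp add: P_def)
    have nk: "real n ^ k = real n * P" using k power_minus_mult[of k "real n"] by (simp add: P_def mult.commute)
    have xP: "x * P = l ^ 3" using P by (simp add: x_def)
    have x0: "0 < x" using l P by (simp add: x_def)
    have nx: "real n * x \<le> \<rho> / 2"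
    proof -
      have "real n * x * n = l ^ 3 * (real n * real n) / P" using P by (simp add: x_def)
      also have "\<dots> \<le> l ^ 3 * P / P" using nP l P by (intro divide_right_mono mult_left_mono) auto
      finally have "real n * x * n \<le> l ^ 3" using P by simp
      then have "real n * x \<le> l ^ 3 / n" using n by (simp add: field_simps)
      then show ?thesis using elim(4) unfolding l_def by linarith
    qed
    have x1: "x \<le> real n * x" using n x0 by (simp add: mult_le_cancel_right1)
    have xr: "x \<le> \<rho>" "x \<le> 1" using nx x1 \<rho> by linarith+
    \<comment> \<open>As many blocks as possible while the near hits, about b (n x)^(k - 1), stay
      below \<rho> P, so that only a small share of the (k - 1)-sets gets covered.\<close>
    define b where "b = nat \<lfloor>\<rho> / x ^ (k - 1)\<rfloor>"
    have xk: "x ^ (k - 1) > 0" using x0 by simp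
    have xk\<rho>: "x ^ (k - 1) \<le> \<rho>"
    proof -
      have "x ^ (k - 1) \<le> x ^ 1" using x0 xr k by (intro power_decreasing) auto
      then show ?thesis using xr by simp
    qed
    have z1: "\<rho> / x ^ (k - 1) \<ge> 1" using xk xk\<rho> by simp
    have b: "real b \<le> \<rho> / x ^ (k - 1)" "\<rho> / x ^ (k - 1) / 2 \<le> real b"
    proof -
      from nat_floor_bounds[OF z1] show "real b \<le> \<rho> / x ^ (k - 1)" "\<rho> / x ^ (k - 1) / 2 \<le> real b"
        unfolding b_def .
    qed
    have bx: "real b * x ^ (k - 1) \<le> \<rho>" "\<rho> / 2 \<le> real b * x ^ (k - 1)"
      using b xk by (auto simp: field_simps)
    define \<mu> where "\<mu> = real b * (real n * x) ^ k"
    have \<mu>eq: "\<mu> = (real b * x ^ (k - 1)) * (real n * l ^ 3)"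
    proof -
      have "(real n * x) ^ k = real n ^ k * x ^ k" by (simp add: power_mult_distrib)
      also have "x ^ k = x ^ (k - 1) * x" using k power_minus_mult[of k x] by simp
      finally have "\<mu> = (real b * x ^ (k - 1)) * (real n * (x * P))" by (simp add: \<mu>_def nk mult_ac)
      then show ?thesis by (simp only: xP)
    qed
    have nl: "0 \<le> real n * l ^ 3" using l by simp
    have \<mu>: "\<mu> \<le> \<rho> * (real n * l ^ 3)" "\<rho> / 2 * (real n * l ^ 3) \<le> \<mu>"
      unfolding \<mu>eq by (rule mult_right_mono[OF bx(1) nl], rule mult_right_mono[OF bx(2) nl])
    have \<mu>0: "0 \<le> \<mu>" using x0 by (simp add: \<mu>_def)
    have \<kappa>\<mu>: "0 \<le> \<kappa> * \<mu>" using \<kappa> \<mu>0 by simp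
    define N where "N = nat \<lfloor>real n ^ k / ln n ^ 4\<rfloor>"
    have N: "real N \<le> real n ^ k / l ^ 8"
    proof -
      have "0 \<le> real n ^ k / ln n ^ 4" using lln by simp
      then show ?thesis unfolding N_def l8 by (rule of_nat_floor)
    qed
    \<comment> \<open>The mean block size N x is at most n / l^5, so S exceeds 2 N x by at least n /
      l^5.\<close>
    define S where "S = 3 * (real n / l ^ 5)"
    \<comment> \<open>Both \<open>t\<close> and \<open>y\<close> are twice the drift of their
      exponential bounds, 2 \<rho> P and 3^(k + 1) \<mu>, so that half remains in the
      exponent.\<close>
    define t where "t = 4 * (\<rho> * P)"
    define y where "y = 2 * 3 ^ (k + 1) * \<mu>"
    \<comment> \<open>The candidates then leave the exponent 2 m - \<kappa> \<mu> / 2 = - \<kappa>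
      \<mu> / 4, and the killed blocks, with drift m, leave m - 2 m = - \<kappa> \<mu> / 8; the
      latter still beats W.\<close>
    define m where "m = \<kappa> * \<mu> / 8"
    define \<tau> where "\<tau> = \<kappa> / 64 * P"
    have S0: "0 \<le> S" using l by (simp add: S_def)
    have \<tau>0: "0 \<le> \<tau>" using \<kappa> P by (simp add: \<tau>_def)
    have tau: "t + S ^ (k - 2) * y \<le> \<tau>"
    proof -
      have P2: "P = real n ^ (k - 2) * real n"
      proof -
        have "k - 1 = Suc (k - 2)" using k by simp
        then show ?thesis by (simp add: P_def)
      qed
      \<comment> \<open>The tightest case is k = 3: a single l^5 from S against the l^3 of y leaves
        1 / l^2 = 1 / ln n, which absorbs the power of 3. This fixes the exponent 4 of ln n in
        N.\<close>
      have "l ^ 5 \<le> (l ^ 5) ^ (k - 2)"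
        using power_increasing[of 1 "k - 2" "l ^ 5"] l k by simp
      then have "S ^ (k - 2) \<le> 3 ^ (k - 2) * real n ^ (k - 2) / l ^ 5"
        unfolding S_def power_mult_distrib power_divide times_divide_eq_right
        using l by (intro divide_left_mono) auto
      moreover have "y \<le> 2 * 3 ^ (k + 1) * (\<rho> * (real n * l ^ 3))"
        unfolding y_def using \<mu>(1) by (rule mult_left_mono) simp
      moreover have "0 \<le> y" using \<mu>0 by (simp add: y_def)
      ultimately have "S ^ (k - 2) * y \<le> 3 ^ (k - 2) * real n ^ (k - 2) / l ^ 5 * (2 * 3 ^ (k + 1) * (\<rho> * (real n * l ^ 3)))"
        using l by (intro mult_mono) auto
      also have "\<dots> = 2 * (3 ^ (k - 2) * 3 ^ (k + 1)) * \<rho> * P / l ^ 2"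
      proof -
        have "l ^ 5 = l ^ 3 * l ^ 2" by (simp flip: power_add)
        then show ?thesis unfolding P2 using l by simp
      qed
      also have "(3 ^ (k - 2) * 3 ^ (k + 1) :: real) = 3 ^ (2 * k - 1)"
      proof -
        have "2 * k - 1 = (k - 2) + (k + 1)" using k by simp
        then show ?thesis by (simp only: power_add)
      qed
      also have "2 * 3 ^ (2 * k - 1) * \<rho> * P / l ^ 2 \<le> 2 * (\<rho> * P)"
      proof -
        have "(3::real) ^ (2 * k - 1) \<le> 3 ^ (2 * k)" by (intro power_increasing) auto
        also have "\<dots> \<le> l ^ 2" using elim(3) l by simp
        finally have "2 * (\<rho> * P) * 3 ^ (2 * k - 1) \<le> 2 * (\<rho> * P) * l ^ 2"
          using \<rho> P by (intro mult_left_mono) auto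
        then show ?thesis using l(2) by (simp add: pos_divide_le_eq mult_ac)
      qed
      finally have "t + S ^ (k - 2) * y \<le> 6 * (\<rho> * P)" unfolding t_def by linarith
      also have "\<dots> \<le> 8 * (\<rho> * P)" using mult_pos_pos[OF \<rho>(1) P] by linarith
      also have "\<dots> = \<tau>" by (simp add: \<rho>_def \<tau>_def)
      finally show ?thesis .
    qed
    define W where "W = real k * n * l ^ 2"
    have NW: "real N ^ n \<le> exp W"
    proof -
      have "real n ^ k / l ^ 8 \<le> real n ^ k / 1" using l by (intro divide_left_mono) auto
      then have "real N \<le> real n ^ k" using N by linarith
      then have "real N ^ n \<le> (real n ^ k) ^ n" by (intro power_mono) auto
      also have "\<dots> = exp (ln n) ^ (k * n)" using n by (simp add: power_mult)
      also have "\<dots> = exp (real (k * n) * ln n)" by (rule exp_of_nat_mult[symmetric])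
      also have "\<dots> = exp W" by (simp add: W_def l(3))
      finally show ?thesis .
    qed
    define A where "A = (real k + 5) * (real n * l ^ 2)"
    have W5: "W + 5 \<le> A"
    proof -
      have "1 * 1 \<le> real n * l ^ 2" using n l by (intro mult_mono one_le_power) auto
      moreover have "A = W + 5 * (real n * l ^ 2)" by (simp add: W_def A_def algebra_simps)
      ultimately show ?thesis by linarith
    qed
    have Wa: "W - 2 * (\<rho> * P) \<le> - 5"
    proof -
      have cross: "a * L \<le> d * c" if "a / c \<le> d / L" "c > 0" "L > 0" for a c d L :: real
        using that by (simp add: field_simps)
      have "(real k + 5) * l ^ 2 \<le> n * (2 * \<rho>)"
        unfolding l(3) using elim(2) \<rho> lln by (intro cross) auto
      then have "(real k + 5) * l ^ 2 * n \<le> n * (2 * \<rho>) * n" using n by (intro mult_right_mono) auto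
      also have "\<dots> = 2 * (\<rho> * (real n * real n))" by simp
      also have "\<dots> \<le> 2 * (\<rho> * P)" using nP \<rho> by (intro mult_left_mono) auto
      finally have "A \<le> 2 * (\<rho> * P)" by (simp add: A_def mult_ac)
      then show ?thesis using W5 by linarith
    qed
    have Wb: "W - \<kappa> * \<mu> / 8 \<le> - 5"
    proof -
      have "16 * (real k + 5) \<le> l * (\<kappa> * \<rho>)"
        using elim(1) mult_pos_pos[OF \<kappa>(1) \<rho>(1)] unfolding l_def by (simp only: pos_divide_le_eq)
      then have "16 * (real k + 5) * (real n * l ^ 2) \<le> l * (\<kappa> * \<rho>) * (real n * l ^ 2)"
        by (rule mult_right_mono) simp
      also have "\<dots> = 2 * \<kappa> * (\<rho> / 2 * (real n * l ^ 3))"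
        by (simp add: power2_eq_square power3_eq_cube mult_ac)
      also have "\<dots> \<le> 2 * \<kappa> * \<mu>" using \<mu>(2) \<kappa> by (intro mult_left_mono) auto
      finally have "16 * A \<le> 2 * (\<kappa> * \<mu>)" by (simp add: A_def mult_ac)
      then show ?thesis using W5 by linarith
    qed
    have T1: "exp (b * (2 * (n * x) ^ (k - 1)) - t) \<le> exp (- (2 * (\<rho> * P)))"
    proof -
      have "b * (2 * (n * x) ^ (k - 1)) = 2 * ((b * x ^ (k - 1)) * P)"
        by (simp add: power_mult_distrib P_def)
      also have "\<dots> \<le> 2 * (\<rho> * P)" using bx P by (intro mult_left_mono mult_right_mono) auto
      finally have "b * (2 * (n * x) ^ (k - 1)) - t \<le> - (2 * (\<rho> * P))" unfolding t_def by linarith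
      then show ?thesis by (simp only: exp_le_cancel_iff)
    qed
    have T2: "exp (b * ((3 * n * x) ^ k * exp (2 * n * x)) - y) \<le> exp (- (\<kappa> * \<mu> / 8))"
    proof -
      have "real (2 * n) * x = 2 * (real n * x)" by simp
      then have "real (2 * n) * x \<le> 1" using nx \<rho> by linarith
      then have "exp (2 * n * x) \<le> exp 1" by (simp only: exp_le_cancel_iff)
      also have "\<dots> \<le> (3::real)" by (rule exp_le)
      finally have "b * ((3 * n * x) ^ k * exp (2 * n * x)) \<le> b * ((3 * n * x) ^ k * 3)"
        using x0 by (intro mult_left_mono) auto
      also have "\<dots> = 3 ^ (k + 1) * \<mu>" by (simp add: \<mu>_def power_mult_distrib)
      finally have "b * ((3 * n * x) ^ k * exp (2 * n * x)) - y \<le> - (3 ^ (k + 1) * \<mu>)"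
        unfolding y_def by linarith
      moreover have "1 * \<mu> \<le> 3 ^ (k + 1) * \<mu>" using \<mu>0 by (intro mult_right_mono one_le_power) auto
      moreover have "\<kappa> * \<mu> \<le> 1 * \<mu>" using \<mu>0 \<kappa> by (intro mult_right_mono) auto
      ultimately have "b * ((3 * n * x) ^ k * exp (2 * n * x)) - y \<le> - (\<kappa> * \<mu> / 8)"
        using \<kappa>\<mu> by linarith
      then show ?thesis by (simp only: exp_le_cancel_iff)
    qed
    have T3: "exp (2 * m - b * ((n choose k) * ((x / k) ^ k * (1 - x) ^ n) / 2)) \<le> exp (- (\<kappa> * \<mu> / 8))"
    proof -
      have "1 + real n * (- x) \<le> (1 + (- x)) ^ n" using xr by (intro Bernoulli_inequality) auto
      then have "1 - real n * x \<le> (1 - x) ^ n" by simp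
      then have half: "1 / 2 \<le> (1 - x) ^ n" using nx \<rho> by linarith
      have "(real n / real k) ^ k \<le> real (n choose k)"
        using binomial_ge_n_over_k_pow_k[OF elim(6), where ?'a = real] by simp
      then have "(real n / real k) ^ k * ((x / k) ^ k * (1 / 2)) \<le> (n choose k) * ((x / k) ^ k * (1 - x) ^ n)"
        using half x0 by (intro mult_mono) auto
      moreover have "(real n / real k) ^ k * ((x / k) ^ k * (1 / 2)) = \<kappa> * (n * x) ^ k"
      proof -
        have "real k ^ (2 * k) = real k ^ k * real k ^ k" unfolding mult_2 power_add ..
        then have "\<kappa> = 1 / (2 * (real k ^ k * real k ^ k))" by (simp only: \<kappa>_def)
        then show ?thesis by (simp add: power_divide power_mult_distrib)
      qed
      ultimately have "b * (\<kappa> * (n * x) ^ k / 2) \<le> b * ((n choose k) * ((x / k) ^ k * (1 - x) ^ n) / 2)"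
        by (intro mult_left_mono divide_right_mono) auto
      moreover have "b * (\<kappa> * (n * x) ^ k / 2) = \<kappa> * \<mu> / 2" by (simp add: \<mu>_def)
      ultimately have "2 * m - b * ((n choose k) * ((x / k) ^ k * (1 - x) ^ n) / 2) \<le> - (\<kappa> * \<mu> / 8)"
        using \<kappa>\<mu> unfolding m_def by linarith
      then show ?thesis by (simp only: exp_le_cancel_iff)
    qed
    have T4: "exp (b * (8 * (\<tau> * n * x ^ k)) - 2 * m) \<le> exp (- (\<kappa> * \<mu> / 8))"
    proof -
      have "b * (8 * (\<tau> * n * x ^ k)) = \<kappa> / 8 * (b * ((real n * P) * x ^ k))" by (simp add: \<tau>_def)
      also have "\<dots> = \<kappa> * \<mu> / 8" unfolding nk[symmetric] by (simp add: \<mu>_def power_mult_distrib)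
      finally have "b * (8 * (\<tau> * n * x ^ k)) - 2 * m \<le> - (\<kappa> * \<mu> / 8)" unfolding m_def by linarith
      then show ?thesis by (simp only: exp_le_cancel_iff)
    qed
    have T5: "exp (b * (8 * exp (2 * N * x - S)) - 2) \<le> 1 / 2"
    proof -
      have "real N * x \<le> real n ^ k / l ^ 8 * x" using N x0 by (intro mult_right_mono) auto
      also have "\<dots> = real n * (x * P) / l ^ 8" by (simp add: nk mult_ac)
      also have "\<dots> = real n / l ^ 5"
      proof -
        have "l ^ 8 = l ^ 5 * l ^ 3" by (simp flip: power_add)
        moreover have "l ^ 3 \<noteq> 0" using l(2) by simp
        ultimately show ?thesis
          unfolding xP using mult_divide_mult_cancel_right[of "l ^ 3" "real n" "l ^ 5"] by (simp only: not_False_eq_True)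
      qed
      finally have "real N * x \<le> real n / l ^ 5" .
      moreover have "real (2 * N) * x = 2 * (real N * x)" by simp
      ultimately have "2 * N * x - S \<le> - (real n / l ^ 5)" unfolding S_def by linarith
      then have "real b * exp (2 * N * x - S) \<le> real b * exp (- (real n / l ^ 5))"
        by (intro mult_left_mono) auto
      also have "\<dots> \<le> n powr \<alpha> * exp (- (real n / l ^ 5))"
      proof (intro mult_right_mono)
        have "1 / P \<le> x" unfolding x_def using l P by (intro divide_right_mono one_le_power) auto
        then have "(1 / P) ^ (k - 1) \<le> x ^ (k - 1)" using P by (intro power_mono) auto
        then have "\<rho> / x ^ (k - 1) \<le> 1 / (1 / P) ^ (k - 1)"
          using \<rho> P xk by (intro frac_le) auto
        also have "\<dots> = real n ^ ((k - 1) * (k - 1))" by (simp add: P_def power_divide flip: power_mult)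
        also have "\<dots> = n powr \<alpha>" unfolding \<alpha>_def using n by (simp add: powr_realpow del: of_nat_mult)
        finally show "real b \<le> n powr \<alpha>" using b by linarith
      qed simp
      also have "\<dots> < 1 / 16" using elim(5) by (simp add: l_def)
      finally have "real b * (8 * exp (2 * N * x - S)) - 2 \<le> - 1" by linarith
      then have "exp (b * (8 * exp (2 * N * x - S)) - 2) \<le> exp (- 1)" by (simp only: exp_le_cancel_iff)
      also have "exp (- 1) \<le> (1::real) / 2"
        using exp_ge_add_one_self[of "1::real"] by (simp add: exp_minus field_simps)
      finally show ?thesis .
    qed
    have e5': "exp (- 5) \<le> (1::real) / 16"
    proof -
      have "(2::real) ^ 5 \<le> exp 1 ^ 5" using exp_ge_add_one_self[of "1::real"] by (intro power_mono) auto
      also have "\<dots> = exp 5" by (simp flip: exp_of_nat_mult)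
      finally show ?thesis by (simp add: exp_minus field_simps)
    qed
    have comb: "real N ^ n * exp (- z) \<le> 1 / 16" if "W - z \<le> - 5" for z
    proof -
      have "real N ^ n * exp (- z) \<le> exp W * exp (- z)" using NW by (intro mult_right_mono) auto
      also have "\<dots> = exp (W - z)" by (simp flip: exp_add)
      also have "\<dots> \<le> exp (- 5)" using that by simp
      finally show ?thesis using e5' by simp
    qed
    have "real N ^ n * (exp (b * (2 * (n * x) ^ (k - 1)) - t)
        + exp (b * ((3 * n * x) ^ k * exp (2 * n * x)) - y)
        + exp (2 * m - b * ((n choose k) * ((x / k) ^ k * (1 - x) ^ n) / 2))
        + 2 * exp (b * (8 * (\<tau> * n * x ^ k)) - 2 * m))
      \<le> real N ^ n * (exp (- (2 * (\<rho> * P))) + exp (- (\<kappa> * \<mu> / 8)) + exp (- (\<kappa> * \<mu> / 8)) + 2 * exp (- (\<kappa> * \<mu> / 8)))"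
      by (intro mult_left_mono add_mono T1 T2 T3 T4) auto
    also have "\<dots> = real N ^ n * exp (- (2 * (\<rho> * P))) + 4 * (real N ^ n * exp (- (\<kappa> * \<mu> / 8)))"
      by (simp add: algebra_simps)
    \<comment> \<open>Five terms of at most 1 / 16 each, since the killed blocks count twice; the
      block sizes add at most 1 / 2.\<close>
    also have "\<dots> \<le> 5 / 16" using comb[OF Wa] comb[OF Wb] by simp
    finally have fin: "real N ^ n * (exp (b * (2 * (n * x) ^ (k - 1)) - t)
        + exp (b * ((3 * n * x) ^ k * exp (2 * n * x)) - y)
        + exp (2 * m - b * ((n choose k) * ((x / k) ^ k * (1 - x) ^ n) / 2))
        + 2 * exp (b * (8 * (\<tau> * n * x ^ k)) - 2 * m))
      + exp (b * (8 * exp (2 * N * x - S)) - 2) < 1"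
      using T5 by linarith
    show ?case
      by (rule exI[of _ x], rule exI[of _ b], rule exI[of _ S], rule exI[of _ t], rule exI[of _ y],
          rule exI[of _ m], rule exI[of _ \<tau>], rule exI[of _ N])
        (intro conjI N_def less_imp_le[OF x0] xr(2) S0 \<tau>0 tau fin)
  qed
qed

lemma F_free_small_independent_sets:
  fixes k :: nat
  assumes k: "k \<ge> 3"
  shows "\<forall>\<^sub>F n in sequentially. \<exists>H :: nat hypergraph.
    uniform_hypergraph k H \<and> card (verts H) = nat \<lfloor>real n ^ k / ln n ^ 4\<rfloor> \<and>
    \<not> contains_copy (F_graph k) H \<and> \<not> (\<exists>S. independent_set H S \<and> card S = n)"
  using lower_asymptotics[OF k]
proof eventually_elim
  case (elim n)
  then obtain x :: real and b :: nat and S t y m \<tau> :: real and N :: nat where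
    N: "N = nat \<lfloor>real n ^ k / ln n ^ 4\<rfloor>"
    and x: "0 \<le> x" "x \<le> 1" and S: "0 \<le> S" and \<tau>: "0 \<le> \<tau>" "t + S ^ (k - 2) * y \<le> \<tau>"
    and small: "real N ^ n * (exp (b * (2 * (n * x) ^ (k - 1)) - t)
        + exp (b * ((3 * n * x) ^ k * exp (2 * n * x)) - y)
        + exp (2 * m - b * ((n choose k) * ((x / k) ^ k * (1 - x) ^ n) / 2))
        + 2 * exp (b * (8 * (\<tau> * n * x ^ k)) - 2 * m))
      + exp (b * (8 * exp (2 * N * x - S)) - 2) < 1"
    by blast
  interpret random_blocks "{..<N}" k x
    using k x by unfold_locales auto
  obtain xs :: "(nat \<Rightarrow> nat) list" where
    xs: "\<And>I. I \<subseteq> {..<N} \<Longrightarrow> card I = n \<Longrightarrow> \<exists>e\<in>edges (block_graph k {..<N} xs). e \<subseteq> I"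
    using exists_blocks[OF S \<tau>(2,1), of n b m] small by auto
  show ?case
  proof (intro exI conjI)
    show "uniform_hypergraph k (block_graph k {..<N} xs)" by (rule uniform_block_graph) simp
    show "card (verts (block_graph k {..<N} xs)) = nat \<lfloor>real n ^ k / ln n ^ 4\<rfloor>"
      by (simp add: block_graph_def N)
    show "\<not> contains_copy (F_graph k) (block_graph k {..<N} xs)"
      using k by (rule F_free_block_graph) simp
    show "\<not> (\<exists>S. independent_set (block_graph k {..<N} xs) S \<and> card S = n)"
    proof
      assume "\<exists>S. independent_set (block_graph k {..<N} xs) S \<and> card S = n"
      then obtain I where "independent_set (block_graph k {..<N} xs) I" "card I = n" by blast
      then show False using xs[of I] by (auto simp: independent_set_def block_graph_def)
    qed
  qed
qed

section \<open>Ramsey numbers\<close>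

definition ramsey_property :: "nat \<Rightarrow> 'b hypergraph \<Rightarrow> nat \<Rightarrow> nat \<Rightarrow> bool" where
  "ramsey_property k F n N \<longleftrightarrow> (\<forall>H :: nat hypergraph.
     uniform_hypergraph k H \<and> card (verts H) = N \<and> \<not> contains_copy F H \<longrightarrow>
     (\<exists>S. independent_set H S \<and> card S = n))"

lemma ramsey_number_eq: "ramsey_number k F n = (LEAST N. ramsey_property k F n N)"
  by (simp add: ramsey_number_def ramsey_property_def)

text \<open>This lets a single N serve all n below the range of the asymptotic estimate.\<close>

lemma ramsey_property_antimono:
  assumes "ramsey_property k F n N" "m \<le> n"
  shows "ramsey_property k F m N"
  unfolding ramsey_property_def
proof (intro allI impI)
  fix H :: "nat hypergraph"
  assume "uniform_hypergraph k H \<and> card (verts H) = N \<and> \<not> contains_copy F H"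
  then obtain S where "independent_set H S" "card S = n"
    using assms unfolding ramsey_property_def by blast
  then show "\<exists>S. independent_set H S \<and> card S = m"
    using exists_independent_set_card assms(2) by blast
qed

text \<open>A witness on more vertices can be restricted to any smaller number of vertices.\<close>

lemma ramsey_property_gt:
  fixes H :: "nat hypergraph"
  assumes H: "uniform_hypergraph k H" "\<not> contains_copy F H" "\<not> (\<exists>S. independent_set H S \<and> card S = n)"
    and r: "ramsey_property k F n r"
  shows "card (verts H) < r"
proof (rule ccontr)
  assume "\<not> card (verts H) < r"
  then obtain V where V: "V \<subseteq> verts H" "card V = r"
    by (metis not_less obtain_subset_with_card_n)
  define G :: "nat hypergraph" where "G = (V, {e \<in> edges H. e \<subseteq> V})"
  have "finite V" using V H finite_subset by (auto simp: uniform_hypergraph_def)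
  then have "uniform_hypergraph k G" "card (verts G) = r"
    using H V by (auto simp: uniform_hypergraph_def G_def)
  moreover have "\<not> contains_copy F G"
  proof
    assume "contains_copy F G"
    then obtain f where "inj_on f (verts F)" "f ` verts F \<subseteq> V" "\<forall>e\<in>edges F. f ` e \<in> edges H"
      by (auto simp: contains_copy_def G_def)
    then have "contains_copy F H" using V unfolding contains_copy_def by blast
    then show False using H by blast
  qed
  ultimately obtain S where S: "independent_set G S" "card S = n"
    using r unfolding ramsey_property_def by blast
  then have "independent_set H S" using V unfolding independent_set_def G_def fst_conv snd_conv by blast
  then show False using S H by blast
qed

theorem theorem1p4:
  fixes k :: nat
  assumes "k \<ge> 3"
  shows "\<exists>c1 c2 :: real. c1 > 0 \<and> c2 > 0 \<and>
    (\<forall>n::nat. n \<ge> 2 \<longrightarrow>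
       c1 * real n ^ k / ln (real n) ^ (2 * k - 2) \<le> real (ramsey_number k (F_graph k) n) \<and>
       real (ramsey_number k (F_graph k) n) \<le> c2 * real n ^ k / ln (real n))"
proof -
  let ?R = "ramsey_property k (F_graph k)"
  let ?r = "\<lambda>n. ramsey_number k (F_graph k) n"
  obtain C where C: "C > 0" and up: "\<forall>\<^sub>F n in sequentially. \<forall>H :: nat hypergraph.
    uniform_hypergraph k H \<and> \<not> contains_copy (F_graph k) H \<and> C * real n ^ k / ln n \<le> card (verts H)
    \<longrightarrow> (\<exists>S. independent_set H S \<and> card S = n)"
    using F_free_large_independent_set[OF assms] by blast
  obtain n1 where "\<forall>n\<ge>n1. \<forall>H :: nat hypergraph.
    uniform_hypergraph k H \<and> \<not> contains_copy (F_graph k) H \<and> C * real n ^ k / ln n \<le> card (verts H)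
    \<longrightarrow> (\<exists>S. independent_set H S \<and> card S = n)"
    using up unfolding eventually_sequentially by blast
  then have R1: "?R n N" if "n1 \<le> n" "C * real n ^ k / ln n \<le> real N" for n N
    using that unfolding ramsey_property_def by blast
  define N1 where "N1 = nat \<lceil>C * real n1 ^ k / ln n1\<rceil>"
  have "C * real n1 ^ k / ln n1 \<le> real N1" unfolding N1_def by (rule of_nat_ceiling)
  then have "?R n1 N1" using R1 by blast
  then have small: "?R n N1" if "n \<le> n1" for n using that by (rule ramsey_property_antimono)
  have le: "?r n \<le> N" if "?R n N" for n N
    unfolding ramsey_number_eq using that by (rule Least_le)
  \<comment> \<open>\<open>LEAST\<close> carries information only once some N with the property
    exists; the upper bound provides one for every n.\<close>
  have holds: "?R n (?r n)" for n
  proof -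
    have "\<exists>N. ?R n N"
    proof (cases "n \<le> n1")
      case False
      then show ?thesis using R1[of n "nat \<lceil>C * real n ^ k / ln n\<rceil>"] of_nat_ceiling by (meson nat_le_linear)
    qed (use small in blast)
    then show ?thesis unfolding ramsey_number_eq by (rule LeastI_ex)
  qed
  obtain n2 where n2: "\<And>n. n2 \<le> n \<Longrightarrow> \<exists>H :: nat hypergraph.
    uniform_hypergraph k H \<and> card (verts H) = nat \<lfloor>real n ^ k / ln n ^ 4\<rfloor> \<and>
    \<not> contains_copy (F_graph k) H \<and> \<not> (\<exists>S. independent_set H S \<and> card S = n)"
    using F_free_small_independent_sets[OF assms] unfolding eventually_sequentially by blast
  \<comment> \<open>From 3 on ln n \<ge> 1, so that (ln n)^4 may be replaced by (ln n)^(2 k -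
    2).\<close>
  define n3 where "n3 = max n2 3"
  \<comment> \<open>For 2 \<le> n < n3 the second entry pushes the lower bound down to at most 1,
    and the Ramsey number is positive because the empty hypergraph has no independent set of size
    n.\<close>
  define c1 where "c1 = min 1 (ln 2 ^ (2 * k - 2) / real n3 ^ k)"
  \<comment> \<open>C + 1 covers large n including the rounding up, and N1 covers n \<le> n1; both
    use n^k / ln n \<ge> 1.\<close>
  define c2 where "c2 = C + 1 + real N1"
  have "n3 > 0" by (simp add: n3_def max_def)
  then have n3: "real n3 ^ k > 0" by simp
  have c1: "c1 > 0" using n3 by (simp add: c1_def)
  have c2: "c2 > 0" using C by (simp add: c2_def)
  have lower: "c1 * real n ^ k / ln (real n) ^ (2 * k - 2) \<le> real (?r n)" if n: "n \<ge> 2" for n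
  proof (cases "n3 \<le> n")
    case True
    then have n3': "n2 \<le> n" "3 \<le> n" by (auto simp: n3_def)
    obtain H :: "nat hypergraph" where H: "uniform_hypergraph k H"
      "card (verts H) = nat \<lfloor>real n ^ k / ln n ^ 4\<rfloor>" "\<not> contains_copy (F_graph k) H"
      "\<not> (\<exists>S. independent_set H S \<and> card S = n)"
      using n2[OF n3'(1)] by blast
    have "nat \<lfloor>real n ^ k / ln n ^ 4\<rfloor> < ?r n"
      using ramsey_property_gt[OF H(1,3,4) holds] H(2) by simp
    \<comment> \<open>The strict inequality makes up for the floor.\<close>
    then have "real n ^ k / ln n ^ 4 \<le> real (?r n)" by linarith
    moreover have "ln (real n) \<ge> 1"
      using n3' by (intro ln_ge_1) auto
    then have "ln (real n) ^ 4 \<le> ln (real n) ^ (2 * k - 2)" "0 < ln (real n) ^ 4"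
      using assms by (auto intro!: power_increasing)
    then have "1 * real n ^ k / ln (real n) ^ (2 * k - 2) \<le> real n ^ k / ln (real n) ^ 4"
      by (simp add: frac_le)
    moreover have "c1 * real n ^ k / ln (real n) ^ (2 * k - 2) \<le> 1 * real n ^ k / ln (real n) ^ (2 * k - 2)"
      using \<open>ln (real n) \<ge> 1\<close> by (intro divide_right_mono mult_right_mono) (auto simp: c1_def)
    ultimately show ?thesis by linarith
  next
    case False
    have l2: "0 < ln (2::real)" "ln 2 \<le> ln (real n)" using n by auto
    have "c1 * real n ^ k / ln (real n) ^ (2 * k - 2) \<le> (ln 2 ^ (2 * k - 2) / real n3 ^ k) * real n3 ^ k / ln 2 ^ (2 * k - 2)"
      using False l2 c1 by (intro frac_le mult_mono power_mono) (auto simp: c1_def)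
    also have "\<dots> = 1" using n3 l2 by simp
    also have "1 \<le> real (?r n)"
    proof -
      have "\<not> ?R n 0"
      proof
        assume "?R n 0"
        moreover have "uniform_hypergraph k ({}, {})" "\<not> contains_copy (F_graph k) (({}, {}) :: nat hypergraph)"
          using assms by (auto simp: uniform_hypergraph_def contains_copy_def F_graph_def)
        ultimately obtain S :: "nat set" where "independent_set ({}, {}) S" "card S = n"
          unfolding ramsey_property_def by fastforce
        then show False using n by (simp add: independent_set_def)
      qed
      then have "?r n \<noteq> 0" using holds[of n] by metis
      then show ?thesis by simp
    qed
    finally show ?thesis .
  qed
  have upper: "real (?r n) \<le> c2 * real n ^ k / ln (real n)" if n: "n \<ge> 2" for n
  proof -
    define z where "z = real n ^ k / ln n"
    have ln: "0 < ln (real n)" using n by simp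
    have "ln (real n) \<le> real n ^ 1" using ln_le_minus_one[of "real n"] n by simp
    also have "\<dots> \<le> real n ^ k" using n assms by (intro power_increasing) auto
    finally have z: "1 \<le> z" using ln by (simp add: z_def)
    have "real (?r n) \<le> c2 * z"
    proof (cases "n \<le> n1")
      case True
      have "real (?r n) \<le> real N1" using le[OF small[OF True]] by simp
      also have "\<dots> \<le> real N1 * z" using z by (simp add: mult_le_cancel_left1)
      also have "\<dots> \<le> c2 * z" using z C by (intro mult_right_mono) (auto simp: c2_def)
      finally show ?thesis .
    next
      case False
      have "C * z \<le> real (nat \<lceil>C * z\<rceil>)" by (rule of_nat_ceiling)
      then have "?R n (nat \<lceil>C * z\<rceil>)" using R1 False by (simp add: z_def)
      then have "real (?r n) \<le> real (nat \<lceil>C * z\<rceil>)" using le by simp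
      also have "\<dots> \<le> C * z + 1"
      proof -
        have "0 \<le> C * z" using C z by simp
        then show ?thesis by linarith
      qed
      also have "\<dots> \<le> (C + 1) * z" using z by (simp add: algebra_simps)
      also have "\<dots> \<le> c2 * z" using z by (intro mult_right_mono) (auto simp: c2_def)
      finally show ?thesis .
    qed
    then show ?thesis by (simp add: z_def)
  qed
  show ?thesis
    using c1 c2 lower upper by blast
qed

end
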